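(* Let $g_n\colon\mathbb{D}\to\mathbb{D}$, $n\in\mathbb{N}$, be inner functions with $g_n(0)=0$, and let $G_n = g_n\circ\cdots\circ g_1$. Then $\{g_n\}_{n\in\mathbb{N}}$ is contracting if and only if the sequence $\{\widehat G_n\}_{n\in\mathbb{N}}$ has a mixing subsequence.
   Context: $\mathbb{D}$ is the open unit disc in $\mathbb{C}$, $m$ is normalised Lebesgue measure on $\partial\mathbb{D}$, and $\mathbb{N}=\{1,2,3,\dots\}$. An analytic map $g\colon\mathbb{D}\to\mathbb{D}$ is inner if $\hat g(e^{i\theta})=\lim_{r\nearrow 1}g(re^{i\theta})$ exists and has modulus one for almost every $e^{i\theta}\in\partial\mathbb{D}$; $\hat g$ is its (a.e. defined) boundary map. If $g(0)=0$, then $\hat g$ preserves $m$. A sequence $\{T_n\}_{n\in\mathbb{N}}$ of measure-preserving maps of a probability space $(X,\mathcal{A},\mu)$ is called ergodic if $\lim_{N\to\infty}\left\|\frac1N\sum_{n=1}^N\varphi\circ T_n-\int_X\varphi\,d\mu\right\|_{2}=0$ for every complex-valued $\varphi\in L^2(\mu)$, and mixing if all its subsequences are ergodic. For boundary maps this is applied with $(X,\mu)=(\partial\mathbb{D},m)$. The sequence $\{g_n\}$ is contracting if $G_n\to0$ uniformly on compact subsets of $\mathbb{D}$ as $n\to\infty$. *)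

theory Defs
  imports "HOL-Probability.Probability" "HOL-Complex_Analysis.Complex_Analysis"
begin

text \<open>Normalised Lebesgue measure on the unit circle, on its Borel sets.\<close>

definition circle_measure :: "complex measure" where
  "circle_measure =
     distr (uniform_measure lborel {0..<2 * pi}) (restrict_space borel (sphere 0 1)) cis"

lemma prob_space_circle_measure: "prob_space circle_measure"
proof -
  have "prob_space (uniform_measure lborel {0..<2 * pi})"
    by (rule prob_space_uniform_measure) auto
  moreover have "cis \<in> borel_measurable borel"
    by (intro borel_measurable_continuous_onI continuous_intros)
  then have "cis \<in> uniform_measure lborel {0..<2 * pi} \<rightarrow>\<^sub>M restrict_space borel (sphere 0 1)"
    by (auto intro!: measurable_restrict_space2)
  ultimately show ?thesis
    unfolding circle_measure_def by (rule prob_space.prob_space_distr)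
qed

definition radial_limit :: "(complex \<Rightarrow> complex) \<Rightarrow> complex \<Rightarrow> complex \<Rightarrow> bool" where
  "radial_limit g w l \<longleftrightarrow> ((\<lambda>r::real. g (of_real r * w)) \<longlongrightarrow> l) (at_left 1)"

definition inner_function :: "(complex \<Rightarrow> complex) \<Rightarrow> bool" where
  "inner_function g \<longleftrightarrow>
     g holomorphic_on ball 0 1 \<and> g ` ball 0 1 \<subseteq> ball 0 1 \<and>
     (AE w in circle_measure. \<exists>l. radial_limit g w l \<and> norm l = 1)"

text \<open>For an inner function the \<open>else\<close> branch only concerns a null set. The value \<open>w\<close> there
  is an arbitrary choice that makes the map a Borel self-map of the whole circle.\<close>

definition boundary_map :: "(complex \<Rightarrow> complex) \<Rightarrow> complex \<Rightarrow> complex" where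
  "boundary_map g w =
     (if \<exists>l. radial_limit g w l \<and> norm l = 1 then (THE l. radial_limit g w l) else w)"

text \<open>Sequences are indexed by the positive integers: the value at index \<open>0\<close> of a sequence of
  maps is never used.\<close>

primrec forward_comp :: "(nat \<Rightarrow> complex \<Rightarrow> complex) \<Rightarrow> nat \<Rightarrow> complex \<Rightarrow> complex" where
  "forward_comp g 0 = id"
| "forward_comp g (Suc n) = g (Suc n) \<circ> forward_comp g n"

definition contracting :: "(nat \<Rightarrow> complex \<Rightarrow> complex) \<Rightarrow> bool" where
  "contracting g \<longleftrightarrow>
     (\<forall>K. compact K \<and> K \<subseteq> ball 0 1 \<longrightarrow>
        uniform_limit K (forward_comp g) (\<lambda>_. 0) sequentially)"

definition measure_preserving_map :: "'a measure \<Rightarrow> ('a \<Rightarrow> 'a) \<Rightarrow> bool" where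
  "measure_preserving_map M T \<longleftrightarrow> T \<in> M \<rightarrow>\<^sub>M M \<and> distr M M T = M"

definition in_L2 :: "'a measure \<Rightarrow> ('a \<Rightarrow> complex) \<Rightarrow> bool" where
  "in_L2 M f \<longleftrightarrow> f \<in> borel_measurable M \<and> integrable M (\<lambda>x. (norm (f x))\<^sup>2)"

definition norm_L2 :: "'a measure \<Rightarrow> ('a \<Rightarrow> complex) \<Rightarrow> real" where
  "norm_L2 M f = sqrt (LINT x|M. (norm (f x))\<^sup>2)"

definition ergodic_seq :: "'a measure \<Rightarrow> (nat \<Rightarrow> 'a \<Rightarrow> 'a) \<Rightarrow> bool" where
  "ergodic_seq M T \<longleftrightarrow>
     (\<forall>n\<ge>1. measure_preserving_map M (T n)) \<and>
     (\<forall>\<phi>. in_L2 M \<phi> \<longrightarrow>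
        (\<lambda>N. norm_L2 M (\<lambda>x. (\<Sum>n=1..N. (\<phi> \<circ> T n) x) / of_nat N - (LINT y|M. \<phi> y)))
          \<longlonglongrightarrow> 0)"

text \<open>A strictly increasing \<open>s\<close> on all of \<open>nat\<close> satisfies \<open>s n \<ge> n\<close>, hence maps positive
  indices to positive indices; conversely every strictly increasing sequence of positive indices
  \<open>s 1 < s 2 < \<dots>\<close> extends by \<open>s 0 = 0\<close>. So \<open>strict_mono\<close> describes exactly the subsequences of
  a sequence indexed from \<open>1\<close>.\<close>

definition mixing_seq :: "'a measure \<Rightarrow> (nat \<Rightarrow> 'a \<Rightarrow> 'a) \<Rightarrow> bool" where
  "mixing_seq M T \<longleftrightarrow> (\<forall>s::nat \<Rightarrow> nat. strict_mono s \<longrightarrow> ergodic_seq M (T \<circ> s))"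

end

theory Submission
  imports Defs
begin

text \<open>Write \<open>T\<^sub>n\<close> for the boundary map of \<open>G\<^sub>n\<close>. If \<open>G\<^sub>n \<rightarrow> 0\<close> on the disc, the Fourier
  coefficients of \<open>T\<^sub>n\<^sup>i\<close>, which are Taylor coefficients of \<open>G\<^sub>n\<^sup>i\<close>, tend to \<open>0\<close>, so \<open>T\<^sub>n\<^sup>i \<rightarrow> 0\<close> weakly for
  every \<open>i \<ge> 1\<close>. One can then pick a subsequence along which the powers \<open>T\<^sub>n\<^sup>i\<close> are almost orthogonal;
  this property passes to further subsequences and makes the averages of \<open>T\<^sub>n\<^sup>i\<close> small in \<open>L\<^sup>2\<close>, and
  trigonometric polynomials are dense. Conversely, \<open>|G\<^sub>n(z)|\<close> decreases by Schwarz' lemma; if it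
  does not tend to \<open>0\<close>, some subsequence has \<open>G\<^sub>n(z) \<rightarrow> a \<noteq> 0\<close>, and ergodicity applied to
  \<open>\<phi>(w) = w\<close> together with Cauchy's formula contradicts this.

  That \<open>G\<^sub>n\<close> is inner at all needs Fatou's theorem: the Fourier coefficients of
  \<open>f\<^sup>* \<circ> g\<^sup>*\<close>, where \<open>*\<close> denotes boundary maps, are the Taylor
  coefficients of \<open>f \<circ> g\<close>, but a radius need not be mapped by \<open>g\<close> into a Stolz angle, so radial
  convergence of \<open>f \<circ> g\<close> does not follow from that of \<open>f\<close> and \<open>g\<close>.\<close>

section \<open>Integration over the circle\<close>

text \<open>Ergodicity concerns all of L^2, while the disc only sees Taylor coefficients. One
  closure principle, \<open>circle_class\<close>, bridges the gap. It serves three times: to test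
  weak convergence, to show that boundary maps preserve the measure, and to extend ergodicity from
  monomials to bounded functions.

  Only finitely many correlations can be made small at one stage of the selection, so stage
  \<open>l\<close> controls the powers \<open>i \<le> l\<close>, with bound \<open>1 / l\<close>.
  For a fixed \<open>i\<close> the uncontrolled stages cost a constant per step, hence linear growth
  of the squared sums, which division by \<open>N\<^sup>2\<close> removes. A further subsequence
  \<open>t\<close> satisfies \<open>t l \<ge> l\<close>, so it inherits the condition.

  Boundary values of a composite must be named before they can be shown to be radial limits.
  Therefore \<open>boundary_function\<close> is defined by coefficients alone; the coefficients of
  the composite are found through the dilates \<open>f (of_real r * g z)\<close>, and Fatou's
  theorem then upgrades coefficients to radial limits. Boundary maps of inner functions fixing 0
  preserve null sets under preimages, which makes the composite of boundary maps meaningful almost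
  everywhere.\<close>

lemma space_circle_measure [simp]: "space circle_measure = sphere 0 1"
  by (simp add: circle_measure_def space_restrict_space)

lemma sets_circle_measure:
  "sets circle_measure = sets (restrict_space borel (sphere 0 1))"
  by (simp add: circle_measure_def)

interpretation circle: prob_space circle_measure
  by (rule prob_space_circle_measure)

lemma borel_measurable_circle:
  "f \<in> measurable borel N \<Longrightarrow> f \<in> measurable circle_measure N"
  by (metis circle_measure_def measurable_distr_eq1 measurable_restrict_space1)

lemma measurable_cis [measurable]: "cis \<in> borel_measurable borel"
  by (intro borel_measurable_continuous_onI continuous_intros)

lemma measurable_cis_circle:
  "cis \<in> uniform_measure lborel {0..<2 * pi} \<rightarrow>\<^sub>M restrict_space borel (sphere 0 1)"
  by (auto intro!: measurable_restrict_space2)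

lemma measurable_comp_cis:
  assumes "f \<in> borel_measurable circle_measure"
  shows "(\<lambda>t. f (cis t)) \<in> borel_measurable borel"
proof -
  have "cis \<in> borel \<rightarrow>\<^sub>M circle_measure"
    by (subst measurable_cong_sets[OF refl sets_circle_measure])
       (auto intro!: measurable_restrict_space2)
  from measurable_comp[OF this assms] show ?thesis by (simp add: o_def)
qed

lemma AE_circleI:
  assumes "AE t in lborel. t \<in> {0..<2*pi} \<longrightarrow> P (cis t)"
    and sets: "{w \<in> sphere 0 1. P w} \<in> sets circle_measure"
  shows "AE w in circle_measure. P w"
proof -
  have "AE t in uniform_measure lborel {0..<2*pi}. P (cis t)"
    by (subst AE_uniform_measure) (use assms(1) in auto)
  then show ?thesis
    unfolding circle_measure_def
    by (subst AE_distr_iff)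
       (use sets in \<open>auto simp: measurable_cis_circle sets_circle_measure space_restrict_space\<close>)
qed

lemma circle_integral_lborel:
  fixes f :: "complex \<Rightarrow> 'a::{banach, second_countable_topology}"
  assumes f: "f \<in> borel_measurable circle_measure"
  shows "(LINT w|circle_measure. f w) = (1 / (2*pi)) *\<^sub>R (LINT t:{0..<2*pi}|lborel. f (cis t))"
proof -
  have eq: "uniform_measure lborel {0..<2*pi} = density lborel (\<lambda>t. ennreal (indicator {0..<2*pi} t / (2*pi)))"
  proof -
    have "indicator {0..<2*pi} t / emeasure lborel {0..<2*pi} = ennreal (indicator {0..<2*pi} t / (2*pi))" for t
      by (auto simp: indicator_def divide_ennreal simp flip: ennreal_1)
    then show ?thesis by (simp add: uniform_measure_def)
  qed
  have "(LINT w|circle_measure. f w) = (LINT t|uniform_measure lborel {0..<2*pi}. f (cis t))"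
    unfolding circle_measure_def
    by (rule integral_distr) (use f in \<open>auto simp: measurable_cis_circle measurable_cong_sets[OF sets_circle_measure refl]\<close>)
  also have "\<dots> = (LINT t|lborel. (indicator {0..<2*pi} t / (2*pi)) *\<^sub>R f (cis t))"
    unfolding eq
    by (rule integral_density) (use measurable_comp_cis[OF f] in auto)
  also have "\<dots> = (1 / (2*pi)) *\<^sub>R (LINT t:{0..<2*pi}|lborel. f (cis t))"
    unfolding set_lebesgue_integral_def
    by (subst integral_scaleR_right[symmetric]) (auto intro!: Bochner_Integration.integral_cong)
  finally show ?thesis .
qed

text \<open>Contour integrals are gauge integrals over the closed parameter interval, whereas
  \<open>circle_measure\<close> comes from the half-open one. Boundedness gives Lebesgue
  integrability, and the extra endpoint is negligible.\<close>

lemma circle_integral_HK: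
  fixes f :: "complex \<Rightarrow> 'a::euclidean_space"
  assumes f: "f \<in> borel_measurable circle_measure" and B: "\<And>w. norm w = 1 \<Longrightarrow> norm (f w) \<le> B"
  shows "((\<lambda>t. f (cis t)) has_integral ((2*pi) *\<^sub>R (LINT w|circle_measure. f w))) {0..2*pi}"
proof -
  have int: "set_integrable lborel {0..<2*pi} (\<lambda>t. f (cis t))"
  proof (rule set_integrable_bound[where f="\<lambda>_. B"])
    show "set_integrable lborel {0..<2*pi} (\<lambda>_. B)"
      by (auto simp: set_integrable_def intro!: integrable_mult_left integrable_real_indicator)
    show "set_borel_measurable lborel {0..<2*pi} (\<lambda>t. f (cis t))"
      unfolding set_borel_measurable_def using measurable_comp_cis[OF f] by auto
    show "AE x\<in>{0..<2*pi} in lborel. norm (f (cis x)) \<le> norm B"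
      using order_trans[OF B abs_ge_self] by (intro AE_I2) (simp add: norm_cis)
  qed
  have "((\<lambda>t. f (cis t)) has_integral (LINT t:{0..<2*pi}|lborel. f (cis t))) {0..<2*pi}"
    using set_borel_integral_eq_integral[OF int] by (simp add: has_integral_iff)
  then have "((\<lambda>t. f (cis t)) has_integral (LINT t:{0..<2*pi}|lborel. f (cis t))) {0..2*pi}"
    by (rule iffD1[OF has_integral_spike_set_eq, rotated 2])
       (auto intro: negligible_subset[of "{2*pi}"])
  then show ?thesis
    by (simp add: circle_integral_lborel[OF f])
qed

text \<open>On the circle of radius \<open>r\<close> the contour differential is
  \<open>\<i> * u\<close> times the angular one; this accounts for the extra factor
  \<open>of_real r * w\<close> and for the division by \<open>2 * pi * \<i>\<close>. Every use of
  Cauchy's formula below passes through this conversion.\<close>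

lemma contour_integral_circle_measure:
  fixes f :: "complex \<Rightarrow> complex"
  assumes f: "continuous_on (sphere 0 r) f" and r: "0 < r"
    and I: "(f has_contour_integral I) (circlepath 0 r)"
  shows "(LINT w|circle_measure. f (of_real r * w) * (of_real r * w)) = I / (2 * pi * \<i>)"
proof -
  let ?g = "\<lambda>w. f (of_real r * w) * (of_real r * w)"
  have cont: "continuous_on (sphere 0 1) ?g"
    by (intro continuous_intros continuous_on_compose2[OF f]) (use r in \<open>auto simp: norm_mult\<close>)
  have meas: "?g \<in> borel_measurable circle_measure"
    by (subst measurable_cong_sets[OF sets_circle_measure refl])
       (rule borel_measurable_continuous_on_restrict[OF cont])
  obtain B where B: "norm (?g w) \<le> B" if "norm w = 1" for w
  proof -
    have "bounded (?g ` sphere 0 1)"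
      by (rule compact_imp_bounded[OF compact_continuous_image[OF cont compact_sphere]])
    then obtain B where "\<forall>x\<in>?g ` sphere 0 1. norm x \<le> B"
      unfolding bounded_iff by blast
    then show ?thesis by (intro that[of B]) simp
  qed
  have 1: "((\<lambda>t. f (of_real r * cis t) * (of_real r * cis t)) has_integral ((2*pi) *\<^sub>R (LINT w|circle_measure. ?g w))) {0..2*pi}"
    by (rule circle_integral_HK[OF meas B])
  have "((\<lambda>t. f (0 + of_real r * cis t) * of_real r * \<i> * cis t) has_integral I) {0..2*pi}"
    using I unfolding circlepath_def by (subst (asm) has_contour_integral_part_circlepath_iff) auto
  from has_integral_mult_left[OF this, of "1/\<i>"]
  have "((\<lambda>t. ?g (cis t)) has_integral (I / \<i>)) {0..2*pi}"
    by (simp add: mult_ac)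
  from has_integral_unique[OF 1 this] show ?thesis
    by (simp add: field_simps scaleR_conv_of_real)
qed

section \<open>Bounded Borel functions on the circle\<close>

text \<open>The bound is required at every point of the circle rather than almost everywhere, so
  that composition with any measurable self-map of the circle preserves it, before anything is known
  about null sets.\<close>

definition bounded_borel :: "(complex \<Rightarrow> complex) \<Rightarrow> bool" where
  "bounded_borel f \<longleftrightarrow>
     f \<in> borel_measurable circle_measure \<and> (\<exists>B. \<forall>w. norm w = 1 \<longrightarrow> norm (f w) \<le> B)"

lemma bounded_borelI:
  "f \<in> borel_measurable circle_measure \<Longrightarrow> (\<And>w. norm w = 1 \<Longrightarrow> norm (f w) \<le> B) \<Longrightarrow> bounded_borel f"
  by (auto simp: bounded_borel_def)

lemma bounded_borel_bound:
  assumes "bounded_borel f" obtains B where "0 < B" "\<And>w. norm w = 1 \<Longrightarrow> norm (f w) \<le> B"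
proof -
  from assms obtain B where "\<And>w. norm w = 1 \<Longrightarrow> norm (f w) \<le> B" by (auto simp: bounded_borel_def)
  then show ?thesis by (intro that[of "max B 1"]) (auto simp: le_max_iff_disj)
qed

lemma bounded_borel_measurable: "bounded_borel f \<Longrightarrow> f \<in> borel_measurable circle_measure"
  by (simp add: bounded_borel_def)

lemma bounded_borel_integrable: assumes "bounded_borel f" shows "integrable circle_measure f"
proof -
  obtain B where "\<And>w. norm w = 1 \<Longrightarrow> norm (f w) \<le> B" using bounded_borel_bound[OF assms] by blast
  then show ?thesis
    by (intro circle.integrable_const_bound[where B=B] AE_I2) (auto simp: bounded_borel_measurable assms)
qed

lemma bounded_borel_const [intro, simp]: "bounded_borel (\<lambda>_. c)"
  by (rule bounded_borelI[of _ "norm c"]) auto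

lemma bounded_borel_add [intro]:
  assumes "bounded_borel f" "bounded_borel g" shows "bounded_borel (\<lambda>w. f w + g w)"
proof -
  obtain A B where "\<And>w. norm w = 1 \<Longrightarrow> norm (f w) \<le> A" "\<And>w. norm w = 1 \<Longrightarrow> norm (g w) \<le> B"
    using bounded_borel_bound assms by metis
  then have "norm w = 1 \<Longrightarrow> norm (f w + g w) \<le> A + B" for w
    by (meson add_mono norm_triangle_le)
  then show ?thesis
    using assms[THEN bounded_borel_measurable] by (intro bounded_borelI borel_measurable_add)
qed

lemma bounded_borel_mult [intro]:
  assumes "bounded_borel f" "bounded_borel g" shows "bounded_borel (\<lambda>w. f w * g w)"
proof -
  obtain A B where *: "0 < A" "\<And>w. norm w = 1 \<Longrightarrow> norm (f w) \<le> A" "\<And>w. norm w = 1 \<Longrightarrow> norm (g w) \<le> B"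
    using bounded_borel_bound assms by metis
  have "norm w = 1 \<Longrightarrow> norm (f w * g w) \<le> A * B" for w
    unfolding norm_mult using * by (intro mult_mono) auto
  then show ?thesis
    using assms[THEN bounded_borel_measurable] by (intro bounded_borelI borel_measurable_times)
qed

lemma bounded_borel_power [intro]: "bounded_borel f \<Longrightarrow> bounded_borel (\<lambda>w. f w ^ k)"
  by (induction k) auto

lemma bounded_borel_cnj [intro]:
  assumes "bounded_borel f" shows "bounded_borel (\<lambda>w. cnj (f w))"
proof -
  have "cnj \<in> borel_measurable borel"
    by (intro borel_measurable_continuous_onI continuous_intros)
  with assms show ?thesis
    unfolding bounded_borel_def by (auto intro: measurable_compose)
qed

lemma bounded_borel_diff [intro]:
  "bounded_borel f \<Longrightarrow> bounded_borel g \<Longrightarrow> bounded_borel (\<lambda>w. f w - g w)"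
  using bounded_borel_add[of f "\<lambda>w. (-1) * g w"] bounded_borel_mult[of "\<lambda>_. -1" g] by simp

lemma bounded_borel_sum [intro]:
  "(\<And>i. i \<in> I \<Longrightarrow> bounded_borel (f i)) \<Longrightarrow> bounded_borel (\<lambda>w. \<Sum>i\<in>I. f i w)"
  by (induction I rule: infinite_finite_induct) auto

lemma continuous_on_bounded_borel:
  assumes "continuous_on (sphere 0 1) f" shows "bounded_borel f"
proof -
  have "bounded (f ` sphere 0 1)"
    by (rule compact_imp_bounded[OF compact_continuous_image[OF assms compact_sphere]])
  then obtain B where "\<forall>x\<in>f ` sphere 0 1. norm x \<le> B"
    unfolding bounded_iff by blast
  moreover have "f \<in> borel_measurable circle_measure"
    by (subst measurable_cong_sets[OF sets_circle_measure refl])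
       (rule borel_measurable_continuous_on_restrict[OF assms])
  ultimately show ?thesis by (auto intro!: bounded_borelI)
qed

lemma bounded_borel_monomial [intro]: "bounded_borel (\<lambda>w. w ^ j * cnj w ^ k)"
  by (intro continuous_on_bounded_borel continuous_intros)

lemma bounded_borel_LIMSEQ:
  assumes "\<And>n. bounded_borel (u n)" "\<And>n w. norm w = 1 \<Longrightarrow> norm (u n w) \<le> B"
    "\<And>w. norm w = 1 \<Longrightarrow> (\<lambda>n. u n w) \<longlonglongrightarrow> f w"
  shows "bounded_borel f"
proof (rule bounded_borelI)
  show "f \<in> borel_measurable circle_measure"
    by (rule borel_measurable_LIMSEQ_metric[of u]) (use assms in \<open>auto simp: bounded_borel_measurable\<close>)
  show "norm (f w) \<le> B" if "norm w = 1" for w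
    by (rule LIMSEQ_le_const2[OF tendsto_norm[OF assms(3)[OF that]]]) (use assms(2) that in auto)
qed

lemma circle_dominated_convergence:
  assumes "\<And>n. u n \<in> borel_measurable circle_measure" "f \<in> borel_measurable circle_measure"
    and "\<And>n w. norm w = 1 \<Longrightarrow> norm (u n w) \<le> B"
    and "AE w in circle_measure. (\<lambda>n. u n w) \<longlonglongrightarrow> f w"
  shows "(\<lambda>n. LINT w|circle_measure. u n w :: complex) \<longlonglongrightarrow> (LINT w|circle_measure. f w)"
  by (rule integral_dominated_convergence[where w="\<lambda>_. B"]) (use assms in auto)

section \<open>A monotone class principle on the circle\<close>

inductive trig_poly :: "(complex \<Rightarrow> complex) \<Rightarrow> bool" where
  monomial: "trig_poly (\<lambda>w. c * (w ^ j * cnj w ^ k))"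
| add: "trig_poly f \<Longrightarrow> trig_poly g \<Longrightarrow> trig_poly (\<lambda>w. f w + g w)"

lemma trig_poly_mult: "trig_poly f \<Longrightarrow> trig_poly g \<Longrightarrow> trig_poly (\<lambda>w. f w * g w)"
proof (induction f rule: trig_poly.induct)
  case (monomial c j k)
  from monomial show ?case
  proof (induction g rule: trig_poly.induct)
    case (monomial d l m)
    have "(\<lambda>w. c * (w ^ j * cnj w ^ k) * (d * (w ^ l * cnj w ^ m))) =
          (\<lambda>w. (c * d) * (w ^ (j + l) * cnj w ^ (k + m)))"
      by (simp add: power_add mult_ac)
    then show ?case by (metis trig_poly.monomial)
  next
    case (add f g)
    then show ?case using trig_poly.add by (simp add: distrib_left)
  qed
next
  case (add f g)
  then show ?case using trig_poly.add by (simp add: distrib_right)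
qed

lemma real_polynomial_function_trig_poly:
  fixes p :: "complex \<Rightarrow> real"
  assumes "real_polynomial_function p"
  shows "trig_poly (\<lambda>w. of_real (p w))"
  using assms
proof induction
  case (linear f)
  interpret bounded_linear f by fact
  \<comment> \<open>A real-linear \<open>f\<close> has the form \<open>f w = 2 * Re (a * w)\<close>;
    evaluation at \<open>1\<close> and \<open>\<i>\<close> gives this \<open>a\<close>.\<close>
  let ?a = "Complex (f 1 / 2) (- f \<i> / 2)"
  have "complex_of_real (f w) = ?a * (w ^ 1 * cnj w ^ 0) + cnj ?a * (w ^ 0 * cnj w ^ 1)" for w
  proof -
    have "w = Re w *\<^sub>R 1 + Im w *\<^sub>R \<i>" by (simp add: complex_eq_iff)
    then have "f w = Re w * f 1 + Im w * f \<i>"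
      by (metis add scaleR real_scaleR_def)
    then show ?thesis by (simp add: complex_eq_iff)
  qed
  then have "(\<lambda>w. complex_of_real (f w)) =
      (\<lambda>w. ?a * (w ^ 1 * cnj w ^ 0) + cnj ?a * (w ^ 0 * cnj w ^ 1))" ..
  then show ?case
    by (simp only: trig_poly.intros)
next
  case (const c)
  have "(\<lambda>w::complex. complex_of_real c) = (\<lambda>w. c * (w ^ 0 * cnj w ^ 0))" by simp
  then show ?case by (metis trig_poly.monomial)
next
  case (add f g)
  then show ?case using trig_poly.add by simp
next
  case (mult f g)
  then show ?case using trig_poly_mult by simp
qed

text \<open>A functional monotone class theorem: if \<open>P\<close> holds for monomials and is
  stable under linear combinations and uniformly bounded pointwise limits, then it holds for every
  bounded Borel function. The route is Stone-Weierstrass, closed sets, Borel sets, simple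
  functions.\<close>

locale circle_class =
  fixes P :: "(complex \<Rightarrow> complex) \<Rightarrow> bool"
  assumes monomial: "\<And>j k. P (\<lambda>w. w ^ j * cnj w ^ k)"
    and add: "\<And>f g. bounded_borel f \<Longrightarrow> bounded_borel g \<Longrightarrow> P f \<Longrightarrow> P g \<Longrightarrow> P (\<lambda>w. f w + g w)"
    and scale: "\<And>c f. bounded_borel f \<Longrightarrow> P f \<Longrightarrow> P (\<lambda>w. c * f w)"
    and limit: "\<And>u f B. (\<And>n. bounded_borel (u n)) \<Longrightarrow> bounded_borel f \<Longrightarrow> (\<And>n. P (u n)) \<Longrightarrow>
      (\<And>n w. norm w = 1 \<Longrightarrow> norm (u n w) \<le> B) \<Longrightarrow>
      (\<And>w. norm w = 1 \<Longrightarrow> (\<lambda>n. u n w) \<longlonglongrightarrow> f w) \<Longrightarrow> P f"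
begin

lemma bounded_limit:
  assumes "\<And>n. bounded_borel (u n)" "\<And>n. P (u n)"
      "\<And>n w. norm w = 1 \<Longrightarrow> norm (u n w) \<le> B"
      "\<And>w. norm w = 1 \<Longrightarrow> (\<lambda>n. u n w) \<longlonglongrightarrow> f w"
  shows "P f"
  using limit[OF assms(1) bounded_borel_LIMSEQ[OF assms(1,3,4)] assms(2,3,4)] .

text \<open>The limit axiom tests points of the circle only, so a constant sequence may be given a
  limit that differs from it elsewhere.\<close>

lemma cong: "bounded_borel f \<Longrightarrow> P f \<Longrightarrow> (\<And>w. norm w = 1 \<Longrightarrow> f w = g w) \<Longrightarrow> P g"
  by (rule bounded_borel_bound[of f], assumption, rule bounded_limit[of "\<lambda>_. f"]) auto

lemma const: "P (\<lambda>_. c)"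
  using scale[OF bounded_borel_monomial[of 0 0] monomial[of 0 0], of c] by simp

lemma trig_poly: "trig_poly f \<Longrightarrow> bounded_borel f \<and> P f"
  by (induction rule: trig_poly.induct) (auto intro!: scale monomial add)

lemma continuous:
  fixes g :: "complex \<Rightarrow> real"
  assumes "continuous_on (sphere 0 1) g"
  shows "P (\<lambda>w. of_real (g w))"
proof -
  have "\<exists>p. real_polynomial_function p \<and> (\<forall>w\<in>sphere 0 1. \<bar>g w - p w\<bar> < 1 / real (Suc n))" for n
    by (rule Stone_Weierstrass_real_polynomial_function[OF compact_sphere assms, of "1 / real (Suc n)"]) auto
  then obtain p where p: "\<And>n. real_polynomial_function (p n)"
      "\<And>n w. norm w = 1 \<Longrightarrow> \<bar>g w - p n w\<bar> < 1 / real (Suc n)"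
    by (metis dist_0_norm mem_sphere)
  have "bounded_borel (\<lambda>w. of_real (g w))"
    by (intro continuous_on_bounded_borel continuous_intros assms)
  then obtain B where B: "\<And>w. norm w = 1 \<Longrightarrow> \<bar>g w\<bar> \<le> B"
    by (metis bounded_borel_bound norm_of_real)
  show ?thesis
  proof (rule bounded_limit[where u="\<lambda>n w. of_real (p n w)" and B="B + 1"])
    show "bounded_borel (\<lambda>w. of_real (p n w))" "P (\<lambda>w. of_real (p n w))" for n
      using real_polynomial_function_trig_poly[OF p(1)] trig_poly by auto
    show "norm (complex_of_real (p n w)) \<le> B + 1" if "norm w = 1" for n w
    proof -
      have "1 / real (Suc n) \<le> 1" by simp
      then have "\<bar>p n w\<bar> \<le> B + 1" using p(2)[OF that, of n] B[OF that] by linarith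
      then show ?thesis by simp
    qed
    show "(\<lambda>n. complex_of_real (p n w)) \<longlonglongrightarrow> of_real (g w)" if "norm w = 1" for w
    proof -
      have "\<forall>\<^sub>F n in sequentially. norm (p n w - g w) \<le> 1 / real (Suc n)"
        using p(2)[OF that] by (intro always_eventually allI) (simp add: abs_minus_commute less_imp_le)
      then have "(\<lambda>n. p n w - g w) \<longlonglongrightarrow> 0"
        by (rule Lim_null_comparison) (rule LIMSEQ_Suc[OF lim_1_over_n])
      then show ?thesis
        by (intro tendsto_of_real) (simp add: LIM_zero_iff)
    qed
  qed
qed

lemma closed:
  assumes "closed C"
  shows "P (\<lambda>w. of_real (indicator C w))"
proof (cases "C = {}")
  case True
  then show ?thesis using const[of 0] by simp
next
  case False
  \<comment> \<open>These decrease to the indicator of \<open>C\<close>, because a point off a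
    closed set has positive distance from it. The distance to the empty set is 0 by convention, so
    there the limit would be 1; hence the case split.\<close>
  let ?u = "\<lambda>n w. max 0 (1 - real n * infdist w C)"
  have cont: "continuous_on (sphere 0 1) (?u n)" for n
    by (intro continuous_intros)
  show ?thesis
  proof (rule bounded_limit[where u="\<lambda>n w. of_real (?u n w)" and B=1])
    show "bounded_borel (\<lambda>w. of_real (?u n w))" for n
      by (intro continuous_on_bounded_borel continuous_on_of_real cont)
    show "P (\<lambda>w. of_real (?u n w))" for n
      by (rule continuous[OF cont])
    show "norm (complex_of_real (?u n w)) \<le> 1" for n w
      by (simp add: infdist_nonneg)
    show "(\<lambda>n. complex_of_real (?u n w)) \<longlonglongrightarrow> of_real (indicator C w)" for w
    proof (cases "w \<in> C")
      case True
      then show ?thesis by simp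
    next
      case nin: False
      then have pos: "0 < infdist w C"
        using assms False in_closed_iff_infdist_zero infdist_nonneg[of w C] by (metis less_eq_real_def)
      have "\<forall>\<^sub>F n in sequentially. 1 / infdist w C \<le> real n"
        by real_asymp
      then have "\<forall>\<^sub>F n in sequentially. complex_of_real (?u n w) = 0"
        by eventually_elim (use pos in \<open>simp add: field_simps max_def\<close>)
      then have "(\<lambda>n. complex_of_real (?u n w)) \<longlonglongrightarrow> 0" by (rule tendsto_eventually)
      then show ?thesis using nin by simp
    qed
  qed
qed

text \<open>Dynkin's argument: closed sets are stable under intersection and generate the Borel
  sets. Complements come from linearity, disjoint countable unions from partial sums, which are
  bounded by 1.\<close>

lemma borel_set:
  assumes "A \<in> sets borel"
  shows "P (\<lambda>w. of_real (indicator A w))"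
proof -
  have bb: "bounded_borel (\<lambda>w. of_real (indicator A w))" if "A \<in> sets borel" for A
    by (rule bounded_borelI[where B=1], rule borel_measurable_circle)
       (use that in \<open>auto simp: indicator_def\<close>)
  have A: "A \<in> sigma_sets UNIV (Collect closed)"
    using assms by (simp add: borel_eq_closed)
   have "Int_stable (Collect closed :: complex set set)" by (auto simp: Int_stable_def)
  moreover have "Collect closed \<subseteq> Pow (UNIV :: complex set)" by simp
  ultimately show ?thesis using A
  proof (induction A rule: sigma_sets_induct_disjoint)
    case (basic A)
    then show ?case using closed by simp
  next
    case empty
    then show ?case using const[of 0] by simp
  next
    case (compl A)
    then have *: "bounded_borel (\<lambda>w. of_real (indicator A w))"
      by (intro bb) (simp add: borel_eq_closed)
    let ?f = "\<lambda>w. 1 + (-1) * complex_of_real (indicator A w)"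
    have bf: "bounded_borel ?f" using * by (intro bounded_borel_add bounded_borel_mult bounded_borel_const)
    have "P ?f"
      by (rule add[OF bounded_borel_const bounded_borel_mult[OF bounded_borel_const *] const scale[OF * compl(2)]])
    with bf show ?case
      by (rule cong) (auto simp: indicator_def)
  next
    case (union A)
    then have *: "bounded_borel (\<lambda>w. of_real (indicator (A i) w))" for i
      by (intro bb) (auto simp: borel_eq_closed)
    show ?case
    proof (rule bounded_limit[where u="\<lambda>n w. \<Sum>i<n. of_real (indicator (A i) w)" and B=1])
      show "bounded_borel (\<lambda>w. \<Sum>i<n. complex_of_real (indicator (A i) w))" for n
        using * by auto
      show "P (\<lambda>w. \<Sum>i<n. complex_of_real (indicator (A i) w))" for n
      proof (induction n)
        case 0
        then show ?case using const[of 0] by simp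
      next
        case (Suc n)
        have "P (\<lambda>w. (\<Sum>i<n. complex_of_real (indicator (A i) w)) + of_real (indicator (A n) w))"
          by (rule add) (use * Suc union in auto)
        then show ?case by (simp add: add.commute)
      qed
      have sums: "(\<lambda>i. indicator (A i) w :: real) sums indicator (\<Union>i. A i) w" for w
        by (rule indicator_sums) (use union(1) in \<open>auto simp: disjoint_family_on_def\<close>)
      show "norm (\<Sum>i<n. complex_of_real (indicator (A i) w)) \<le> 1" for n w
      proof -
        have "(\<Sum>i<n. indicator (A i) w :: real) \<le> indicator (\<Union>i. A i) w"
          using sums[of w] by (metis indicator_pos_le sum_le_suminf sums_iff finite_lessThan)
        also have "\<dots> \<le> 1" by (simp add: indicator_def)
        finally have "(\<Sum>i<n. indicator (A i) w :: real) \<le> 1" .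
        then have "norm (complex_of_real (\<Sum>i<n. indicator (A i) w)) \<le> 1"
          unfolding norm_of_real by (simp add: sum_nonneg)
        then show ?thesis unfolding of_real_sum .
      qed
      show "(\<lambda>n. \<Sum>i<n. complex_of_real (indicator (A i) w)) \<longlonglongrightarrow> of_real (indicator (\<Union>i. A i) w)" for w
        using tendsto_of_real[OF sums[of w, unfolded sums_def]] by simp
    qed
  qed
qed

lemma simple_function:
  assumes "simple_function circle_measure h"
  shows "bounded_borel h" "P h"
proof -
  have fin: "finite (h ` sphere 0 1)" and sets: "\<And>y. h -` {y} \<inter> sphere 0 1 \<in> sets circle_measure"
    using assms by (auto simp: simple_function_def simple_function_borel_measurable) (metis simple_functionD(2)[OF assms] space_circle_measure)
  let ?s = "\<lambda>Y w. \<Sum>y\<in>Y. y * of_real (indicator (h -` {y} \<inter> sphere 0 1) w)"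
  have 1: "bounded_borel (\<lambda>w. of_real (indicator (h -` {y} \<inter> sphere 0 1) w))" for y
    using sets[of y] by (intro bounded_borelI[where B=1]) (auto split: split_indicator)
  have 2: "P (\<lambda>w. of_real (indicator (h -` {y} \<inter> sphere 0 1) w))" for y
  proof -
    obtain B where B: "B \<in> sets borel" "h -` {y} \<inter> sphere 0 1 = sphere 0 1 \<inter> B"
      using sets[of y] unfolding sets_circle_measure sets_restrict_space by auto
    show ?thesis
    proof (rule cong[OF _ borel_set[OF B(1)]])
      show "bounded_borel (\<lambda>w. of_real (indicator B w))"
        by (rule bounded_borelI[where B=1], rule borel_measurable_circle)
           (use B in \<open>auto simp: indicator_def\<close>)
      show "complex_of_real (indicator B w) = of_real (indicator (h -` {y} \<inter> sphere 0 1) w)" if "norm w = 1" for w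
        unfolding B(2) using that by (simp add: indicator_def)
    qed
  qed
  have 3: "bounded_borel (?s Y) \<and> P (?s Y)" if "finite Y" for Y
    using that
  proof induction
    case empty
    show ?case using const[of 0] by simp
  next
    case (insert y Y)
    have "bounded_borel (\<lambda>w. y * of_real (indicator (h -` {y} \<inter> sphere 0 1) w))"
      using 1 by auto
    moreover have "P (\<lambda>w. y * of_real (indicator (h -` {y} \<inter> sphere 0 1) w))"
      by (rule scale[OF 1 2])
    ultimately show ?case
      using insert by (simp add: add bounded_borel_add)
  qed
  have eq: "?s (h ` sphere 0 1) w = h w" if "norm w = 1" for w
  proof -
    have "?s (h ` sphere 0 1) w = (\<Sum>y\<in>h ` sphere 0 1. if y = h w then y else 0)"
      by (rule sum.cong) (use that in \<open>auto simp: indicator_def\<close>)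
    also have "\<dots> = h w" using fin that by (subst sum.delta) auto
    finally show ?thesis .
  qed
  show "bounded_borel h"
  proof -
    obtain B where "\<And>w. norm w = 1 \<Longrightarrow> norm (?s (h ` sphere 0 1) w) \<le> B"
      using 3[OF fin] bounded_borel_bound by blast
    with eq show ?thesis
      using borel_measurable_simple_function[OF assms] by (auto intro!: bounded_borelI[where B=B])
  qed
  show "P h" using cong[of "?s (h ` sphere 0 1)"] 3[OF fin] eq by blast
qed

lemma bounded_borel:
  assumes "bounded_borel f"
  shows "P f"
proof -
  obtain F where F: "\<And>i. simple_function circle_measure (F i)"
      "\<And>x. x \<in> space circle_measure \<Longrightarrow> (\<lambda>i. F i x) \<longlonglongrightarrow> f x"
      "\<And>i x. x \<in> space circle_measure \<Longrightarrow> dist (F i x) 0 \<le> 2 * dist (f x) 0"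
    using borel_measurable_implies_sequence_metric[OF bounded_borel_measurable[OF assms], of 0] by metis
  obtain B where B: "\<And>w. norm w = 1 \<Longrightarrow> norm (f w) \<le> B" using bounded_borel_bound[OF assms] by blast
  show ?thesis
  proof (rule bounded_limit[where u=F and B="2 * B"])
    show "norm (F n w) \<le> 2 * B" if "norm w = 1" for n w
      using F(3)[of w n] B[OF that] that by simp
  qed (use F simple_function in auto)
qed

end

section \<open>Fourier coefficients and boundary functions\<close>

lemma norm_circle_integral_le:
  assumes "bounded_borel f" "\<And>w. norm w = 1 \<Longrightarrow> norm (f w) \<le> g w" "integrable circle_measure g"
  shows "norm (LINT w|circle_measure. f w) \<le> (LINT w|circle_measure. g w)"
  by (rule Bochner_Integration.integral_norm_bound_integral)
     (use assms bounded_borel_integrable in auto)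

text \<open>Uniformly bounded functions act on L^1 with a common norm bound \<open>C\<close>, so
  replacing the test function \<open>f\<close> by \<open>h m\<close> costs at most \<open>C\<close>
  times their L^1 distance, whatever \<open>n\<close> is. That is the limit axiom of
  \<open>circle_class\<close>; the monomial axiom is the hypothesis \<open>conv\<close>.\<close>

lemma weak_convergence_circle:
  assumes u: "\<And>n. bounded_borel (u n)" "\<And>n w. norm w = 1 \<Longrightarrow> norm (u n w) \<le> B"
    and v: "bounded_borel v"
    and conv: "\<And>j k. (\<lambda>n. LINT w|circle_measure. u n w * (w ^ j * cnj w ^ k))
        \<longlonglongrightarrow> (LINT w|circle_measure. v w * (w ^ j * cnj w ^ k))"
    and K: "bounded_borel K"
  shows "(\<lambda>n. LINT w|circle_measure. u n w * K w) \<longlonglongrightarrow> (LINT w|circle_measure. v w * K w)"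
proof -
  let ?P = "\<lambda>K. (\<lambda>n. LINT w|circle_measure. u n w * K w) \<longlonglongrightarrow> (LINT w|circle_measure. v w * K w)"
  obtain B' where B': "\<And>w. norm w = 1 \<Longrightarrow> norm (v w) \<le> B'"
    using bounded_borel_bound[OF v] by blast
  define C where "C = max 1 (max B B')"
  have C: "norm w = 1 \<Longrightarrow> norm (u n w) \<le> C" "norm w = 1 \<Longrightarrow> norm (v w) \<le> C" "0 < C" for n w
    using u(2)[of w n] B'[of w] by (auto simp: C_def)
  have int: "bounded_borel f \<Longrightarrow> integrable circle_measure (\<lambda>w. u n w * f w)"
    "bounded_borel f \<Longrightarrow> integrable circle_measure (\<lambda>w. v w * f w)" for n f
    using u v by (auto intro!: bounded_borel_integrable bounded_borel_mult)
  interpret circle_class ?P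
  proof
    show "?P (\<lambda>w. w ^ j * cnj w ^ k)" for j k by (rule conv)
    show "?P (\<lambda>w. f w + g w)" if "bounded_borel f" "bounded_borel g" "?P f" "?P g" for f g
      using that int by (simp add: distrib_left tendsto_add)
    show "?P (\<lambda>w. c * f w)" if "bounded_borel f" "?P f" for c f
      using tendsto_mult_left[OF that(2), of c] by (simp add: mult.left_commute)
  next
    fix h :: "nat \<Rightarrow> complex \<Rightarrow> complex" and f A
    assume h: "\<And>m. bounded_borel (h m)" "bounded_borel f" "\<And>m. ?P (h m)"
      "\<And>m w. norm w = 1 \<Longrightarrow> norm (h m w) \<le> A" "\<And>w. norm w = 1 \<Longrightarrow> (\<lambda>m. h m w) \<longlonglongrightarrow> f w"
    define d where "d m = (LINT w|circle_measure. norm (f w - h m w))" for m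
    have bb: "bounded_borel (\<lambda>w. f w - h m w)" for m using h by auto
    have "(\<lambda>m. LINT w|circle_measure. norm (f w - h m w)) \<longlonglongrightarrow> (LINT w|circle_measure. 0)"
    proof (rule integral_dominated_convergence[where w="\<lambda>_. 2 * A"])
      show "AE w in circle_measure. (\<lambda>m. norm (f w - h m w)) \<longlonglongrightarrow> 0"
      proof (rule AE_I2)
        fix w assume "w \<in> space circle_measure"
        then have "(\<lambda>m. h m w) \<longlonglongrightarrow> f w" using h(5) by simp
        from tendsto_norm[OF tendsto_diff[OF tendsto_const[of "f w"] this]]
        show "(\<lambda>m. norm (f w - h m w)) \<longlonglongrightarrow> 0" by simp
      qed
      show "AE w in circle_measure. norm (norm (f w - h m w)) \<le> 2 * A" for m
      proof (rule AE_I2)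
        fix w assume "w \<in> space circle_measure"
        then have w: "norm w = 1" by simp
        have "norm (f w) \<le> A"
          by (rule LIMSEQ_le_const2[OF tendsto_norm[OF h(5)[OF w]]]) (use h(4) w in auto)
        then show "norm (norm (f w - h m w)) \<le> 2 * A"
          using norm_triangle_ineq4[of "f w" "h m w"] h(4)[OF w, of m] by simp
      qed
    qed (use bb[THEN bounded_borel_measurable] in \<open>auto intro!: borel_measurable_norm\<close>)
    then have d0: "d \<longlonglongrightarrow> 0" by (simp add: d_def[abs_def])
    have ineq: "norm ((LINT w|circle_measure. x w * f w) - (LINT w|circle_measure. x w * h m w)) \<le> C * d m"
      if x: "bounded_borel x" "\<And>w. norm w = 1 \<Longrightarrow> norm (x w) \<le> C" for x m
    proof -
      have "(LINT w|circle_measure. x w * f w) - (LINT w|circle_measure. x w * h m w)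
          = (LINT w|circle_measure. x w * (f w - h m w))"
        using x h by (subst Bochner_Integration.integral_diff[symmetric])
          (auto intro!: bounded_borel_integrable bounded_borel_mult simp: right_diff_distrib)
      also have "norm \<dots> \<le> (LINT w|circle_measure. C * norm (f w - h m w))"
        by (rule norm_circle_integral_le)
           (use x bb in \<open>auto simp: norm_mult intro!: mult_right_mono bounded_borel_mult
              integrable_norm bounded_borel_integrable\<close>)
      finally show ?thesis by (simp add: d_def)
    qed
    show "?P f"
    proof (rule LIMSEQ_I)
      fix e :: real assume e: "0 < e"
      then have "\<forall>\<^sub>F m in sequentially. norm (d m) < e / (4 * C)"
        using d0 C(3) by (intro order_tendstoD[OF tendsto_norm_zero[OF d0]]) simp
      then obtain m where "norm (d m) < e / (4 * C)" by (auto simp: eventually_sequentially)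
      then have m: "C * d m < e / 4" using C(3) by (simp add: field_simps abs_less_iff)
      obtain N where N: "\<And>n. n \<ge> N \<Longrightarrow>
        norm ((LINT w|circle_measure. u n w * h m w) - (LINT w|circle_measure. v w * h m w)) < e / 2"
        using LIMSEQ_D[OF h(3)[of m], of "e / 2"] e by auto
      show "\<exists>N. \<forall>n\<ge>N. norm ((LINT w|circle_measure. u n w * f w) - (LINT w|circle_measure. v w * f w)) < e"
      proof (intro exI[of _ N] allI impI)
        fix n assume "n \<ge> N"
        have "norm ((LINT w|circle_measure. u n w * f w) - (LINT w|circle_measure. u n w * h m w)) < e / 4"
          using ineq[OF u(1) C(1)] m by (rule le_less_trans)
        moreover have "norm ((LINT w|circle_measure. v w * f w) - (LINT w|circle_measure. v w * h m w)) < e / 4"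
          using ineq[OF v C(2)] m by (rule le_less_trans)
        moreover note N[OF \<open>n \<ge> N\<close>]
        ultimately show "norm ((LINT w|circle_measure. u n w * f w) - (LINT w|circle_measure. v w * f w)) < e"
          by norm
      qed
    qed
  qed
  show ?thesis by (rule bounded_borel[OF K])
qed

lemma bounded_borel_comp:
  assumes "bounded_borel f" "T \<in> circle_measure \<rightarrow>\<^sub>M circle_measure"
  shows "bounded_borel (\<lambda>w. f (T w))"
proof -
  obtain B where B: "\<And>w. norm w = 1 \<Longrightarrow> norm (f w) \<le> B" using bounded_borel_bound[OF assms(1)] by blast
  have "norm (T w) = 1" if "norm w = 1" for w
    using measurable_space[OF assms(2)] that by simp
  then show ?thesis
    using measurable_compose[OF assms(2) bounded_borel_measurable[OF assms(1)]] B
    by (intro bounded_borelI) auto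
qed

text \<open>A finite measure on the circle is determined by its trigonometric moments; here those of
  the image measure under \<open>T\<close> agree with those of
  \<open>circle_measure\<close>.\<close>

lemma measure_preserving_of_coefficients:
  assumes T: "T \<in> circle_measure \<rightarrow>\<^sub>M circle_measure"
    and eq: "\<And>j k. (LINT w|circle_measure. T w ^ j * cnj (T w) ^ k) = (LINT w|circle_measure. w ^ j * cnj w ^ k)"
  shows "measure_preserving_map circle_measure T"
proof -
  let ?P = "\<lambda>f. (LINT w|circle_measure. f (T w)) = (LINT w|circle_measure. f w)"
  have Tn: "norm (T w) = 1" if "norm w = 1" for w
    using measurable_space[OF T] that by simp
  interpret circle_class ?P
  proof
    show "?P (\<lambda>w. w ^ j * cnj w ^ k)" for j k by (rule eq)
    show "?P (\<lambda>w. f w + g w)" if "bounded_borel f" "bounded_borel g" "?P f" "?P g" for f g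
      using that by (simp add: bounded_borel_integrable bounded_borel_comp[OF _ T])
    show "?P (\<lambda>w. c * f w)" if "bounded_borel f" "?P f" for c f
      using that by simp
  next
    fix h :: "nat \<Rightarrow> complex \<Rightarrow> complex" and f A
    assume h: "\<And>m. bounded_borel (h m)" "bounded_borel f" "\<And>m. ?P (h m)"
      "\<And>m w. norm w = 1 \<Longrightarrow> norm (h m w) \<le> A" "\<And>w. norm w = 1 \<Longrightarrow> (\<lambda>m. h m w) \<longlonglongrightarrow> f w"
    have "(\<lambda>m. LINT w|circle_measure. h m w) \<longlonglongrightarrow> (LINT w|circle_measure. f w)"
      by (rule circle_dominated_convergence[where B=A])
         (use h bounded_borel_measurable in auto)
    moreover have "(\<lambda>m. LINT w|circle_measure. h m (T w)) \<longlonglongrightarrow> (LINT w|circle_measure. f (T w))"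
      by (rule circle_dominated_convergence[where B=A])
         (use h bounded_borel_measurable[OF bounded_borel_comp[OF _ T]] Tn in auto)
    ultimately show "?P f" using h(3) by (simp add: LIMSEQ_unique)
  qed
  have "distr circle_measure circle_measure T = circle_measure"
  proof (rule measure_eqI)
    fix A assume "A \<in> sets (distr circle_measure circle_measure T)"
    then have A: "A \<in> sets circle_measure" by simp
    have "bounded_borel (\<lambda>w. of_real (indicator A w))"
      by (rule bounded_borelI[where B=1]) (use A in \<open>auto split: split_indicator\<close>)
    from bounded_borel[OF this]
    have "(LINT w|circle_measure. indicator A (T w) :: real) = (LINT w|circle_measure. indicator A w)"
      by (simp add: of_real_eq_iff)
    moreover have "(LINT w|circle_measure. indicator A w :: real) = measure circle_measure A"
      using sets.sets_into_space[OF A] by (simp add: Int_absorb2)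
    moreover have "(LINT w|circle_measure. indicator A (T w) :: real) = measure circle_measure (T -` A \<inter> space circle_measure)"
    proof -
      have "(LINT w|circle_measure. indicator A (T w) :: real) = (LINT w|circle_measure. indicator (T -` A \<inter> space circle_measure) w)"
        by (rule Bochner_Integration.integral_cong) (auto simp: indicator_def)
      then show ?thesis using measurable_sets[OF T A] by simp
    qed
    ultimately show "emeasure (distr circle_measure circle_measure T) A = emeasure circle_measure A"
      using A T by (simp add: emeasure_distr circle.emeasure_eq_measure)
  qed simp
  then show ?thesis using T by (simp add: measure_preserving_map_def)
qed

text \<open>The Taylor coefficient of \<open>F\<close> of order \<open>k - j\<close>, which is \<open>0\<close> for \<open>k < j\<close>. Multiplying by
  \<open>z\<^sup>j\<close> avoids the case distinction.\<close>

definition hcoef :: "(complex \<Rightarrow> complex) \<Rightarrow> nat \<Rightarrow> nat \<Rightarrow> complex" where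
  "hcoef F j k = (deriv ^^ k) (\<lambda>z. F z * z ^ j) 0 / fact k"

lemma hcoef_0_0 [simp]: "hcoef F 0 0 = F 0"
  by (simp add: hcoef_def)

text \<open>Cauchy's formula of order \<open>k\<close> at 0 for \<open>F z * z ^ j\<close>, read on
  the circle of radius \<open>r\<close> with \<open>cnj w ^ k = 1 / w ^ k\<close>. The quotient of
  powers is \<open>r\<close> to the possibly negative exponent \<open>k - j\<close>.\<close>

lemma circle_integral_hcoef:
  assumes F: "F holomorphic_on ball 0 1" and r: "0 < r" "r < 1"
  shows "(LINT w|circle_measure. F (of_real r * w) * (w ^ j * cnj w ^ k)) = of_real (r ^ k / r ^ j) * hcoef F j k"
proof -
  let ?f = "\<lambda>u. F u * u ^ j / (u - 0) ^ Suc k"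
  have hol: "(\<lambda>z. F z * z ^ j) holomorphic_on ball 0 1"
    by (intro holomorphic_intros F)
  have cont: "continuous_on (cball 0 r) (\<lambda>z. F z * z ^ j)"
    using holomorphic_on_imp_continuous_on[OF hol] by (rule continuous_on_subset) (use r in auto)
  have "(?f has_contour_integral ((2 * pi * \<i>) / fact k * (deriv ^^ k) (\<lambda>z. F z * z ^ j) 0)) (circlepath 0 r)"
    by (rule Cauchy_has_contour_integral_higher_derivative_circlepath[OF cont])
       (use hol r in \<open>auto intro: holomorphic_on_subset\<close>)
  then have "(?f has_contour_integral (2 * pi * \<i> * hcoef F j k)) (circlepath 0 r)"
    by (simp add: hcoef_def)
  moreover have "continuous_on (sphere 0 r) ?f"
    using r by (intro continuous_intros continuous_on_subset[OF cont]) auto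
  ultimately have "(LINT w|circle_measure. ?f (of_real r * w) * (of_real r * w)) = hcoef F j k"
    using r by (subst contour_integral_circle_measure) auto
  also have "(LINT w|circle_measure. ?f (of_real r * w) * (of_real r * w)) =
      (LINT w|circle_measure. of_real (r ^ j / r ^ k) * (F (of_real r * w) * (w ^ j * cnj w ^ k)))"
  proof (rule Bochner_Integration.integral_cong[OF refl])
    fix w assume "w \<in> space circle_measure"
    then have w: "norm w = 1" by simp
    then have "w * cnj w = 1" by (simp add: complex_norm_square[symmetric])
    then have "w ^ k * cnj w ^ k = 1" by (metis power_mult_distrib power_one)
    moreover have "w \<noteq> 0" using w by auto
    ultimately have "w \<noteq> 0" "w ^ k * cnj w ^ k = 1" by auto
    then show "?f (of_real r * w) * (of_real r * w) = of_real (r ^ j / r ^ k) * (F (of_real r * w) * (w ^ j * cnj w ^ k))"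
      using r \<open>w ^ k * cnj w ^ k = 1\<close> by (simp add: field_simps power_mult_distrib)
  qed
  also have "\<dots> = of_real (r ^ j / r ^ k) * (LINT w|circle_measure. F (of_real r * w) * (w ^ j * cnj w ^ k))"
    by (rule integral_mult_right_zero)
  finally show ?thesis
    using r by (simp only: of_real_divide) (simp add: divide_simps mult.commute)
qed

text \<open>Dominated convergence and measurability of limits are about sequences, so one fixed
  sequence of radii replaces the continuous parameter. The shift by 2 keeps the first radius, 1/2,
  positive.\<close>

definition radius :: "nat \<Rightarrow> real" where
  "radius n = 1 - 1 / (real n + 2)"

lemma radius: "0 < radius n" "radius n < 1"
  by (auto simp: radius_def field_simps)

lemma radius_tendsto: "radius \<longlonglongrightarrow> 1"
  unfolding radius_def by real_asymp

lemma radius_at_left: "filterlim radius (at_left 1) sequentially"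
  unfolding filterlim_at using radius radius_tendsto
  by (auto intro!: always_eventually simp: less_imp_neq)

lemma radial_limit_sequence:
  assumes "radial_limit F w l" shows "(\<lambda>n. F (of_real (radius n) * w)) \<longlonglongrightarrow> l"
  using filterlim_compose[OF assms[unfolded radial_limit_def] radius_at_left] .

lemma radial_limit_unique: "radial_limit F w l \<Longrightarrow> radial_limit F w l' \<Longrightarrow> l = l'"
  using radial_limit_sequence LIMSEQ_unique by blast

lemma bounded_borel_dilation:
  assumes "F holomorphic_on ball 0 1" "0 < r" "r < 1"
  shows "bounded_borel (\<lambda>w. F (of_real r * w))"
proof (rule continuous_on_bounded_borel)
  show "continuous_on (sphere 0 1) (\<lambda>w. F (of_real r * w))"
    by (rule continuous_on_compose2[OF holomorphic_on_imp_continuous_on[OF assms(1)]])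
       (use assms in \<open>auto intro!: continuous_intros simp: norm_mult\<close>)
qed

text \<open>\<open>M\<close> is the boundary function of \<open>F\<close> in the weak sense: their coefficients agree. Radial limits
  are not required.\<close>

definition boundary_function :: "(complex \<Rightarrow> complex) \<Rightarrow> (complex \<Rightarrow> complex) \<Rightarrow> bool" where
  "boundary_function F M \<longleftrightarrow> bounded_borel M \<and>
     (\<forall>j k. (LINT w|circle_measure. M w * (w ^ j * cnj w ^ k)) = hcoef F j k)"

lemma hcoef_dilation_tendsto:
  assumes F: "F holomorphic_on ball 0 1"
  shows "(\<lambda>n. LINT w|circle_measure. F (of_real (radius n) * w) * (w ^ j * cnj w ^ k)) \<longlonglongrightarrow> hcoef F j k"
proof -
  have "(\<lambda>n. of_real (radius n ^ k / radius n ^ j) * hcoef F j k) \<longlonglongrightarrow> of_real (1 ^ k / 1 ^ j) * hcoef F j k"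
    by (intro tendsto_intros radius_tendsto) auto
  then show ?thesis
    using circle_integral_hcoef[OF F radius] by simp
qed

lemma boundary_function_radial:
  assumes F: "F holomorphic_on ball 0 1" and B: "\<And>z. norm z < 1 \<Longrightarrow> norm (F z) \<le> B"
    and M: "bounded_borel M" and lim: "AE w in circle_measure. radial_limit F w (M w)"
  shows "boundary_function F M"
  unfolding boundary_function_def
proof (intro conjI allI M)
  fix j k
  have "(\<lambda>n. LINT w|circle_measure. F (of_real (radius n) * w) * (w ^ j * cnj w ^ k))
      \<longlonglongrightarrow> (LINT w|circle_measure. M w * (w ^ j * cnj w ^ k))"
  proof (rule circle_dominated_convergence[where B=B])
    show "(\<lambda>w. F (of_real (radius n) * w) * (w ^ j * cnj w ^ k)) \<in> borel_measurable circle_measure" for n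
      by (intro bounded_borel_measurable bounded_borel_mult bounded_borel_monomial bounded_borel_dilation F radius)
    show "(\<lambda>w. M w * (w ^ j * cnj w ^ k)) \<in> borel_measurable circle_measure"
      by (intro bounded_borel_measurable bounded_borel_mult bounded_borel_monomial M)
    show "norm (F (of_real (radius n) * w) * (w ^ j * cnj w ^ k)) \<le> B" if "norm w = 1" for n w
      using B[of "of_real (radius n) * w"] radius[of n] that by (simp add: norm_mult norm_power)
    show "AE w in circle_measure. (\<lambda>n. F (of_real (radius n) * w) * (w ^ j * cnj w ^ k))
        \<longlonglongrightarrow> M w * (w ^ j * cnj w ^ k)"
      using lim by eventually_elim (intro tendsto_mult_right radial_limit_sequence)
  qed
  from LIMSEQ_unique[OF this hcoef_dilation_tendsto[OF F]]
  show "(LINT w|circle_measure. M w * (w ^ j * cnj w ^ k)) = hcoef F j k" .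
qed

text \<open>A consequence of the coefficients alone: the dilates are bounded by \<open>B\<close> and
  their coefficients converge. It is thus available inside the proof of Fatou's theorem, where
  radial limits are still to be found.\<close>

lemma boundary_function_weak_limit:
  assumes F: "F holomorphic_on ball 0 1" and B: "\<And>z. norm z < 1 \<Longrightarrow> norm (F z) \<le> B"
    and M: "boundary_function F M" and K: "bounded_borel K"
  shows "(\<lambda>n. LINT w|circle_measure. F (of_real (radius n) * w) * K w) \<longlonglongrightarrow> (LINT w|circle_measure. M w * K w)"
proof (rule weak_convergence_circle[OF _ _ _ _ K])
  show "bounded_borel (\<lambda>w. F (of_real (radius n) * w))" for n
    by (intro bounded_borel_dilation F radius)
  show "norm (F (of_real (radius n) * w)) \<le> B" if "norm w = 1" for n w
    using radius[of n] that by (intro B) (simp add: norm_mult)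
  show "bounded_borel M" using M by (simp add: boundary_function_def)
  show "(\<lambda>n. LINT w|circle_measure. F (of_real (radius n) * w) * (w ^ j * cnj w ^ k))
      \<longlonglongrightarrow> (LINT w|circle_measure. M w * (w ^ j * cnj w ^ k))" for j k
    using hcoef_dilation_tendsto[OF F] M by (simp add: boundary_function_def)
qed

section \<open>Boundary maps of inner functions\<close>

text \<open>Prepares measurability: all quantifiers range over countable sets. Rational radii
  suffice because a strict violation at one radius persists nearby by continuity, hence at a
  rational one. The thresholds \<open>1 - 1 / (real N + 1)\<close> are nonnegative, which keeps the
  radii inside the disc.\<close>

lemma radial_limit_iff_rational:
  assumes F: "continuous_on (ball 0 1) F" and w: "norm w = 1"
  shows "radial_limit F w l \<longleftrightarrow>
    (\<forall>m. \<exists>N. \<forall>q. 1 - 1 / (real N + 1) < of_rat q \<and> of_rat q < (1::real) \<longrightarrow>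
       norm (F (of_real (of_rat q) * w) - l) \<le> 1 / (real m + 1))" (is "_ \<longleftrightarrow> ?R")
proof
  assume *: "radial_limit F w l"
  show ?R
  proof
    fix m
    have "\<forall>\<^sub>F r in at_left 1. dist (F (of_real r * w)) l < 1 / (real m + 1)"
      using * unfolding radial_limit_def by (rule tendstoD) simp
    then obtain b where b: "b < 1" "\<And>r. b < r \<Longrightarrow> r < 1 \<Longrightarrow> dist (F (of_real r * w)) l < 1 / (real m + 1)"
      using eventually_at_left[of "0::real" 1] by auto
    obtain N where N: "1 / (real N + 1) < 1 - b"
      using reals_Archimedean[of "1 - b"] b(1) by (auto simp: inverse_eq_divide add.commute)
    show "\<exists>N. \<forall>q. 1 - 1 / (real N + 1) < of_rat q \<and> of_rat q < (1::real) \<longrightarrow>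
       norm (F (of_real (of_rat q) * w) - l) \<le> 1 / (real m + 1)"
    proof (intro exI[of _ N] allI impI)
      fix q assume "1 - 1 / (real N + 1) < of_rat q \<and> of_rat q < (1::real)"
      then show "norm (F (of_real (of_rat q) * w) - l) \<le> 1 / (real m + 1)"
        using b(2)[of "of_rat q"] N by (simp add: dist_norm)
    qed
  qed
next
  assume R: ?R
  show "radial_limit F w l"
    unfolding radial_limit_def
  proof (rule tendstoI)
    fix e :: real assume "0 < e"
    then obtain m where m: "1 / (real m + 1) < e"
      using reals_Archimedean[of e] by (auto simp: inverse_eq_divide add.commute)
    obtain N where N: "\<And>q. 1 - 1 / (real N + 1) < of_rat q \<Longrightarrow> of_rat q < (1::real) \<Longrightarrow>
       norm (F (of_real (of_rat q) * w) - l) \<le> 1 / (real m + 1)"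
      using R by metis
    have le: "norm (F (of_real r * w) - l) \<le> 1 / (real m + 1)" if r: "1 - 1 / (real N + 1) < r" "r < 1" for r
    proof (rule ccontr)
      assume "\<not> ?thesis"
      then have gt: "1 / (real m + 1) < norm (F (of_real r * w) - l)" by simp
      let ?I = "{1 - 1 / (real N + 1)<..<1}"
      have pos: "norm (complex_of_real x * w) < 1" if "x \<in> ?I" for x
      proof -
        have "0 \<le> 1 - 1 / (real N + 1)" by simp
        then have "0 < x" "x < 1" using that by (simp_all only: greaterThanLessThan_iff) linarith
        then show ?thesis using w by (simp add: norm_mult)
      qed
      have "continuous_on ?I (\<lambda>r. norm (F (of_real r * w) - l))"
        by (intro continuous_intros continuous_on_compose2[OF F])
           (use pos in \<open>auto simp del: norm_mult\<close>)
      then have "isCont (\<lambda>r. norm (F (of_real r * w) - l)) r"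
        using r by (subst (asm) continuous_on_eq_continuous_at) auto
      then have "\<forall>\<^sub>F x in nhds r. 1 / (real m + 1) < norm (F (of_real x * w) - l)"
        using gt by (intro order_tendstoD) (auto simp: isCont_def tendsto_nhds_iff)
      moreover have "\<forall>\<^sub>F x in nhds r. x \<in> ?I"
        using r by (intro eventually_nhds_in_open) auto
      ultimately have "\<forall>\<^sub>F x in nhds r. x \<in> ?I \<and> 1 / (real m + 1) < norm (F (of_real x * w) - l)"
        by (rule eventually_conj[rotated])
      then obtain d where d: "0 < d" "\<And>x. dist x r < d \<Longrightarrow> x \<in> ?I \<and> 1 / (real m + 1) < norm (F (of_real x * w) - l)"
        unfolding eventually_nhds_metric by blast
      obtain q where q: "r < of_rat q" "of_rat q < r + d"
        using of_rat_dense[of r "r + d"] d(1) by auto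
      then have "dist (of_rat q) r < d" by (simp add: dist_real_def)
      from d(2)[OF this] N[of q] show False by auto
    qed
    have "\<forall>\<^sub>F r in at_left 1. r \<in> {1 - 1 / (real N + 1)<..<1}"
      by (rule eventually_at_left_real) simp
    then show "\<forall>\<^sub>F r in at_left 1. dist (F (of_real r * w)) l < e"
      by eventually_elim (use le m in \<open>force simp: dist_norm\<close>)
  qed
qed

lemma radial_limit_sets:
  assumes F: "F holomorphic_on ball 0 1" and L: "L \<in> borel_measurable circle_measure"
  shows "{w \<in> space circle_measure. radial_limit F w (L w)} \<in> sets circle_measure"
proof -
  have "{w \<in> space circle_measure. radial_limit F w (L w)} = {w \<in> space circle_measure. \<forall>m. \<exists>N. \<forall>q.
    1 - 1 / (real N + 1) < of_rat q \<and> of_rat q < (1::real) \<longrightarrow>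
       norm (F (of_real (of_rat q) * w) - L w) \<le> 1 / (real m + 1)}"
    using radial_limit_iff_rational[OF holomorphic_on_imp_continuous_on[OF F]] by auto
  also have "\<dots> \<in> sets circle_measure"
  proof (intro sets.sets_Collect_countable_All sets.sets_Collect_countable_Ex)
    fix m N :: nat and q
    show "{w \<in> space circle_measure. 1 - 1 / (real N + 1) < of_rat q \<and> of_rat q < (1::real) \<longrightarrow>
       norm (F (of_real (of_rat q) * w) - L w) \<le> 1 / (real m + 1)} \<in> circle.events"
    proof (cases "1 - 1 / (real N + 1) < of_rat q \<and> of_rat q < (1::real)")
      case True
      have "0 \<le> 1 - 1 / (real N + 1)" by simp
      then have "0 < real_of_rat q" "real_of_rat q < 1" using True by linarith+
      then have [measurable]: "(\<lambda>w. F (of_real (of_rat q) * w)) \<in> borel_measurable circle_measure"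
        by (intro bounded_borel_measurable bounded_borel_dilation F)
      show ?thesis using L True by (simp only: simp_thms) measurable
    next
      case False
      then show ?thesis by (simp only: simp_thms Collect_mem_eq sets.top)
    qed
  qed
  finally show ?thesis .
qed

lemma boundary_map_eq:
  assumes "radial_limit F w l" "norm l = 1"
  shows "boundary_map F w = l"
proof -
  have "(THE l. radial_limit F w l) = l"
    by (intro the_equality assms(1)) (rule radial_limit_unique[OF _ assms(1)])
  moreover have "\<exists>l. radial_limit F w l \<and> norm l = 1" using assms by blast
  ultimately show ?thesis by (simp add: boundary_map_def)
qed

lemma boundary_map_measurable:
  assumes F: "F holomorphic_on ball 0 1"
  shows "boundary_map F \<in> circle_measure \<rightarrow>\<^sub>M circle_measure"
proof -
  \<comment> \<open>The limit along \<open>radius\<close> is measurable on the whole circle and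
    equals the radial limit wherever the latter exists; \<open>S\<close> collects the points where
    it truly is a radial limit of modulus one.\<close>
  define L where "L w = lim (\<lambda>n. F (of_real (radius n) * w))" for w
  have L: "L \<in> borel_measurable circle_measure"
    unfolding L_def by (rule borel_measurable_lim_metric)
      (intro bounded_borel_measurable bounded_borel_dilation F radius)
  define S where "S = {w \<in> space circle_measure. radial_limit F w (L w) \<and> norm (L w) = 1}"
  have "{w \<in> space circle_measure. norm (L w) = 1} \<in> circle.events"
    using L by measurable
  then have S: "S \<in> sets circle_measure"
    unfolding S_def by (intro sets.sets_Collect_conj radial_limit_sets F L)
  have S_iff: "w \<in> S \<longleftrightarrow> norm w = 1 \<and> radial_limit F w (L w) \<and> norm (L w) = 1" for w
    by (simp add: S_def)
  have lim: "radial_limit F w l \<Longrightarrow> L w = l" for w l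
    unfolding L_def by (rule limI) (rule radial_limit_sequence)
  have eq: "boundary_map F w = (if w \<in> S then L w else w)" if "w \<in> space circle_measure" for w
  proof (cases "\<exists>l. radial_limit F w l \<and> norm l = 1")
    case True
    then obtain l where l: "radial_limit F w l" "norm l = 1" by blast
    then show ?thesis using lim[OF l(1)] that boundary_map_eq[OF l] by (simp add: S_iff)
  next
    case False
    then show ?thesis by (auto simp: S_iff boundary_map_def)
  qed
  have "(\<lambda>w. if w \<in> S then L w else w) \<in> borel_measurable circle_measure"
    using S L by (intro measurable_If_set) (auto intro: borel_measurable_circle sets.Int sets.top[of circle_measure, simplified])
  then have "(\<lambda>w. if w \<in> S then L w else w) \<in> circle_measure \<rightarrow>\<^sub>M restrict_space borel (sphere 0 1)"
    by (intro measurable_restrict_space2) (auto simp: S_iff)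
  then have "(\<lambda>w. if w \<in> S then L w else w) \<in> circle_measure \<rightarrow>\<^sub>M circle_measure"
    by (simp add: measurable_cong_sets[OF refl sets_circle_measure])
  then show ?thesis by (subst measurable_cong[OF eq])
qed

lemma inner_functionD:
  assumes "inner_function F"
  shows "F holomorphic_on ball 0 1" "norm z < 1 \<Longrightarrow> norm (F z) < 1"
    "AE w in circle_measure. radial_limit F w (boundary_map F w)"
proof -
  show "F holomorphic_on ball 0 1" "norm z < 1 \<Longrightarrow> norm (F z) < 1"
    using assms by (auto simp: inner_function_def image_subset_iff)
  have "AE w in circle_measure. \<exists>l. radial_limit F w l \<and> norm l = 1"
    using assms by (simp add: inner_function_def)
  then show "AE w in circle_measure. radial_limit F w (boundary_map F w)"
    by eventually_elim (auto simp: boundary_map_eq)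
qed

lemma bounded_borel_circle_map:
  "T \<in> circle_measure \<rightarrow>\<^sub>M circle_measure \<Longrightarrow> bounded_borel T"
  using bounded_borel_comp[OF bounded_borel_monomial[of 1 0], of T] by simp

lemma norm_circle_map:
  "T \<in> circle_measure \<rightarrow>\<^sub>M circle_measure \<Longrightarrow> norm w = 1 \<Longrightarrow> norm (T w) = 1"
  using measurable_space[of T circle_measure circle_measure w] by simp

lemma boundary_function_power:
  assumes F: "inner_function F"
  shows "boundary_function (\<lambda>z. F z ^ n) (\<lambda>w. boundary_map F w ^ n)"
proof (rule boundary_function_radial[where B=1])
  note D = inner_functionD[OF F]
  show "(\<lambda>z. F z ^ n) holomorphic_on ball 0 1" by (intro holomorphic_intros D)
  show "norm (F z ^ n) \<le> 1" if "norm z < 1" for z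
    using D(2)[OF that] by (simp add: norm_power power_le_one)
  show "bounded_borel (\<lambda>w. boundary_map F w ^ n)"
    by (intro bounded_borel_power bounded_borel_circle_map boundary_map_measurable D)
  show "AE w in circle_measure. radial_limit (\<lambda>z. F z ^ n) w (boundary_map F w ^ n)"
    using D(3) unfolding radial_limit_def by eventually_elim (rule tendsto_power)
qed

lemma circle_monomial:
  assumes "norm z = 1"
  shows "z ^ j * cnj z ^ k = (if k \<le> j then z ^ (j - k) else cnj (z ^ (k - j)))"
proof -
  have "z * cnj z = 1" using assms by (simp add: complex_norm_square[symmetric])
  then have 1: "z ^ m * cnj z ^ m = 1" for m by (metis power_mult_distrib power_one)
  show ?thesis
  proof (cases "k \<le> j")
    case True
    then have "z ^ j = z ^ (j - k) * z ^ k" by (simp flip: power_add)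
    then show ?thesis using True 1[of k] by (simp add: mult.assoc)
  next
    case False
    then have "cnj z ^ k = cnj z ^ j * cnj z ^ (k - j)" by (simp flip: power_add)
    then show ?thesis using False 1[of j] by (simp add: mult.assoc[symmetric])
  qed
qed

lemma inner_function_id: "inner_function id"
  unfolding inner_function_def radial_limit_def
proof (intro conjI AE_I2)
  fix w assume "w \<in> space circle_measure"
  moreover have "((\<lambda>r. id (complex_of_real r * w)) \<longlongrightarrow> of_real 1 * w) (at_left 1)"
    unfolding id_def by (intro tendsto_intros)
  ultimately show "\<exists>l. ((\<lambda>r. id (complex_of_real r * w)) \<longlongrightarrow> l) (at_left 1) \<and> norm l = 1"
    by auto
qed (auto simp: id_def)

text \<open>Together with \<open>inner_function_id\<close> this makes the moments of
  \<open>circle_measure\<close> itself an instance of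
  \<open>integral_boundary_map_monomial\<close>.\<close>

lemma boundary_map_id: "norm w = 1 \<Longrightarrow> boundary_map id w = w"
proof (rule boundary_map_eq)
  have "((\<lambda>r. id (complex_of_real r * w)) \<longlongrightarrow> of_real 1 * w) (at_left 1)"
    unfolding id_def by (intro tendsto_intros)
  then show "radial_limit id w w" by (simp add: radial_limit_def)
qed

text \<open>By the mean value property, \<open>boundary_map F w ^ n\<close> has mean
  \<open>F 0 ^ n = 0 ^ n\<close>. On the circle every monomial is a power or the conjugate of a
  power.\<close>

lemma integral_boundary_map_monomial:
  assumes F: "inner_function F" "F 0 = 0"
  shows "(LINT w|circle_measure. boundary_map F w ^ j * cnj (boundary_map F w) ^ k) = (if j = k then 1 else 0)"
proof -
  let ?T = "boundary_map F"
  have T: "?T \<in> circle_measure \<rightarrow>\<^sub>M circle_measure"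
    by (rule boundary_map_measurable[OF inner_functionD(1)[OF F(1)]])
  have "(LINT w|circle_measure. ?T w ^ n * (w ^ 0 * cnj w ^ 0)) = hcoef (\<lambda>z. F z ^ n) 0 0" for n
    using boundary_function_power[OF F(1), of n] by (simp only: boundary_function_def)
  then have int: "(LINT w|circle_measure. ?T w ^ n) = 0 ^ n" for n
    using F(2) by simp
  have "(LINT w|circle_measure. ?T w ^ j * cnj (?T w) ^ k) =
    (LINT w|circle_measure. (if k \<le> j then ?T w ^ (j - k) else cnj (?T w ^ (k - j))))"
    by (rule Bochner_Integration.integral_cong)
       (use norm_circle_map[OF T] in \<open>auto simp: circle_monomial\<close>)
  also have "\<dots> = (if k \<le> j then 0 ^ (j - k) else cnj (0 ^ (k - j)))"
    by (cases "k \<le> j") (simp_all only: if_True if_False int Bochner_Integration.integral_cnj)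
  also have "\<dots> = (if j = k then 1 else 0)" by (auto simp: zero_power)
  finally show ?thesis .
qed

lemma boundary_map_measure_preserving:
  assumes F: "inner_function F" "F 0 = 0"
  shows "measure_preserving_map circle_measure (boundary_map F)"
proof (rule measure_preserving_of_coefficients)
  show "boundary_map F \<in> circle_measure \<rightarrow>\<^sub>M circle_measure"
    by (rule boundary_map_measurable[OF inner_functionD(1)[OF F(1)]])
  have "(LINT w|circle_measure. w ^ j * cnj w ^ k)
      = (LINT w|circle_measure. boundary_map id w ^ j * cnj (boundary_map id w) ^ k)" for j k
    by (rule Bochner_Integration.integral_cong) (auto simp: boundary_map_id)
  then show "(LINT w|circle_measure. boundary_map F w ^ j * cnj (boundary_map F w) ^ k) =
      (LINT w|circle_measure. w ^ j * cnj w ^ k)" for j k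
    using integral_boundary_map_monomial[OF F] integral_boundary_map_monomial[OF inner_function_id] by simp
qed

section \<open>Coefficients of limits and of composites\<close>

lemma hcoef_tendsto:
  assumes Fn: "\<And>n. F n holomorphic_on ball 0 1" "\<And>n z. norm z < 1 \<Longrightarrow> norm (F n z) \<le> B"
    and G: "G holomorphic_on ball 0 1" and lim: "\<And>z. norm z < 1 \<Longrightarrow> (\<lambda>n. F n z) \<longlonglongrightarrow> G z"
  shows "(\<lambda>n. hcoef (F n) j k) \<longlonglongrightarrow> hcoef G j k"
proof -
  \<comment> \<open>Any radius strictly between 0 and 1 would do: on a fixed circle inside the disc,
    bounded pointwise convergence passes to the integrals, and the factor from
    \<open>circle_integral_hcoef\<close> is divided out at the end.\<close>
  let ?r = "1 / 2 :: real"
  have "(\<lambda>n. LINT w|circle_measure. F n (of_real ?r * w) * (w ^ j * cnj w ^ k))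
      \<longlonglongrightarrow> (LINT w|circle_measure. G (of_real ?r * w) * (w ^ j * cnj w ^ k))"
  proof (rule circle_dominated_convergence[where B=B])
    have *: "H holomorphic_on ball 0 1 \<Longrightarrow> (\<lambda>w. H (of_real ?r * w) * (w ^ j * cnj w ^ k)) \<in> borel_measurable circle_measure" for H
      by (rule bounded_borel_measurable, rule bounded_borel_mult, rule bounded_borel_dilation) auto
    show "(\<lambda>w. F n (of_real ?r * w) * (w ^ j * cnj w ^ k)) \<in> borel_measurable circle_measure" for n
      by (rule *[OF Fn(1)])
    show "(\<lambda>w. G (of_real ?r * w) * (w ^ j * cnj w ^ k)) \<in> borel_measurable circle_measure"
      by (rule *[OF G])
    show "norm (F n (of_real ?r * w) * (w ^ j * cnj w ^ k)) \<le> B" if "norm w = 1" for n w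
      using Fn(2)[of "of_real ?r * w" n] that by (simp add: norm_mult norm_power norm_divide)
    show "AE w in circle_measure. (\<lambda>n. F n (of_real ?r * w) * (w ^ j * cnj w ^ k)) \<longlonglongrightarrow> G (of_real ?r * w) * (w ^ j * cnj w ^ k)"
      by (intro AE_I2 tendsto_mult_right lim) (simp add: norm_mult norm_divide)
  qed
  then have "(\<lambda>n. of_real (?r ^ k / ?r ^ j) * hcoef (F n) j k) \<longlonglongrightarrow> of_real (?r ^ k / ?r ^ j) * hcoef G j k"
    by (subst (asm) (1 2) circle_integral_hcoef) (auto simp: Fn G)
  then have "(\<lambda>n. of_real (?r ^ j / ?r ^ k) * (of_real (?r ^ k / ?r ^ j) * hcoef (F n) j k)) \<longlonglongrightarrow>
      of_real (?r ^ j / ?r ^ k) * (of_real (?r ^ k / ?r ^ j) * hcoef G j k)"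
    by (rule tendsto_mult_left)
  moreover have "of_real (?r ^ j / ?r ^ k) * (of_real (?r ^ k / ?r ^ j) * c) = c" for c :: complex
    by (simp only: mult.assoc[symmetric] of_real_mult[symmetric]) simp
  ultimately show ?thesis by (simp only:)
qed

text \<open>For the dilates \<open>f (of_real r * g z)\<close> the way in which \<open>g\<close>
  approaches the boundary is harmless: \<open>f\<close> is continuous at the interior point
  \<open>of_real r * boundary_map g w\<close>, so their radial limits are immediate. Then
  \<open>r\<close> tends to 1 in the integrals on one side and in the coefficients on the
  other.\<close>

lemma boundary_function_comp:
  assumes f: "inner_function f" and g: "inner_function g" "g 0 = 0"
  shows "boundary_function (f \<circ> g) (\<lambda>w. boundary_map f (boundary_map g w))"
  unfolding boundary_function_def
proof (intro conjI allI)
  note Df = inner_functionD[OF f] and Dg = inner_functionD[OF g(1)]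
  let ?f = "boundary_map f" and ?g = "boundary_map g"
  have fm: "?f \<in> circle_measure \<rightarrow>\<^sub>M circle_measure" and gm: "?g \<in> circle_measure \<rightarrow>\<^sub>M circle_measure"
    using boundary_map_measurable Df(1) Dg(1) by auto
  show bb: "bounded_borel (\<lambda>w. ?f (?g w))"
    by (rule bounded_borel_comp[OF bounded_borel_circle_map[OF fm] gm])
  fix j k
  let ?F = "\<lambda>n z. f (of_real (radius n) * g z)"
  have in_ball: "norm (of_real (radius n) * z) < 1" if "norm z \<le> 1" for n and z :: complex
  proof -
    have "radius n * norm z \<le> radius n * 1" using that radius[of n] by (intro mult_left_mono) auto
    then have "radius n * norm z < 1" using radius[of n] by linarith
    then show ?thesis using radius[of n] by (simp add: norm_mult)
  qed
  have cont: "continuous_on (ball 0 1) f" by (rule holomorphic_on_imp_continuous_on[OF Df(1)])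
  have hol: "?F n holomorphic_on ball 0 1" for n
    by (rule holomorphic_on_compose_gen[of "\<lambda>z. of_real (radius n) * g z" _ f "ball 0 1", unfolded o_def])
       (use Df(1) Dg in_ball in \<open>auto intro!: holomorphic_intros simp: less_imp_le\<close>)
  have bnd: "norm (?F n z) \<le> 1" if "norm z < 1" for n z
    using in_ball[of "g z" n] Dg(2)[OF that] Df(2)[of "of_real (radius n) * g z"] by (simp add: less_imp_le)
  have bbn: "bounded_borel (\<lambda>w. f (of_real (radius n) * ?g w))" for n
    by (rule bounded_borel_comp[OF bounded_borel_dilation[OF Df(1) radius] gm])
  have "boundary_function (?F n) (\<lambda>w. f (of_real (radius n) * ?g w))" for n
  proof (rule boundary_function_radial[OF hol bnd bbn])
    show "AE w in circle_measure. radial_limit (?F n) w (f (of_real (radius n) * ?g w))"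
      using Dg(3) AE_space
    proof eventually_elim
      case (elim w)
      then have "norm (?g w) = 1" using norm_circle_map[OF gm] by simp
      then have "isCont f (of_real (radius n) * ?g w)"
        using cont in_ball[of "?g w" n] by (simp add: continuous_on_eq_continuous_at)
      then show ?case
        using elim(1) unfolding radial_limit_def
        by (intro isCont_tendsto_compose[of _ f] tendsto_mult_left)
    qed
  qed
  then have int: "(LINT w|circle_measure. f (of_real (radius n) * ?g w) * (w ^ j * cnj w ^ k)) = hcoef (?F n) j k" for n
    by (simp add: boundary_function_def)
  have "(\<lambda>n. LINT w|circle_measure. f (of_real (radius n) * ?g w) * (w ^ j * cnj w ^ k))
      \<longlonglongrightarrow> (LINT w|circle_measure. ?f (?g w) * (w ^ j * cnj w ^ k))"
  proof (rule circle_dominated_convergence[where B=1])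
    show "(\<lambda>w. f (of_real (radius n) * ?g w) * (w ^ j * cnj w ^ k)) \<in> borel_measurable circle_measure" for n
      by (intro bounded_borel_measurable bounded_borel_mult bbn bounded_borel_monomial)
    show "(\<lambda>w. ?f (?g w) * (w ^ j * cnj w ^ k)) \<in> borel_measurable circle_measure"
      by (intro bounded_borel_measurable bounded_borel_mult bb bounded_borel_monomial)
    show "norm (f (of_real (radius n) * ?g w) * (w ^ j * cnj w ^ k)) \<le> 1" if "norm w = 1" for n w
      using Df(2)[OF in_ball[of "?g w" n]] norm_circle_map[OF gm that] that by (simp add: norm_mult norm_power)
    \<comment> \<open>Since \<open>boundary_map g\<close> preserves the measure, it pulls the
      exceptional null set of \<open>f\<close> back to a null set. This is where
      \<open>g 0 = 0\<close> enters.\<close>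
    have "AE w in distr circle_measure circle_measure ?g. radial_limit f w (?f w)"
      using boundary_map_measure_preserving[OF g] Df(3) by (metis measure_preserving_map_def)
    from AE_distrD[OF gm this]
    show "AE w in circle_measure. (\<lambda>n. f (of_real (radius n) * ?g w) * (w ^ j * cnj w ^ k)) \<longlonglongrightarrow> ?f (?g w) * (w ^ j * cnj w ^ k)"
      by eventually_elim (intro tendsto_mult_right radial_limit_sequence)
  qed
  moreover have "(\<lambda>n. hcoef (?F n) j k) \<longlonglongrightarrow> hcoef (f \<circ> g) j k"
  proof (rule hcoef_tendsto[OF hol bnd])
    show "(f \<circ> g) holomorphic_on ball 0 1"
      by (rule holomorphic_on_compose_gen[OF Dg(1) Df(1)]) (use Dg(2) in auto)
    fix z :: complex assume z: "norm z < 1"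
    then have "isCont f (of_real 1 * g z)"
      using cont Dg(2)[OF z] by (simp add: continuous_on_eq_continuous_at)
    then have "(\<lambda>n. ?F n z) \<longlonglongrightarrow> f (of_real 1 * g z)"
      by (rule isCont_tendsto_compose) (intro tendsto_intros radius_tendsto)
    then show "(\<lambda>n. ?F n z) \<longlonglongrightarrow> (f \<circ> g) z" by simp
  qed
  ultimately show "(LINT w|circle_measure. ?f (?g w) * (w ^ j * cnj w ^ k)) = hcoef (f \<circ> g) j k"
    unfolding int by (rule LIMSEQ_unique)
qed

section \<open>Fatou's theorem\<close>

text \<open>The points \<open>of_real r * w\<close> and \<open>w / of_real r\<close> are mirror
  images in the unit circle, which is an Apollonius circle for them: the ratio of the two distances
  is constant along it.\<close>

lemma norm_diff_reflected:
  fixes w u :: complex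
  assumes "norm w = 1" "norm u = 1" "0 < r"
  shows "norm (u - w / of_real r) = norm (u - of_real r * w) / r"
proof -
  have "cnj w * w = 1" "cnj u * u = 1"
    using assms by (simp_all add: complex_norm_square[symmetric] mult.commute[of "cnj _"])
  then have "(of_real r * u - w) = - (w * u) * cnj (u - of_real r * w)"
  proof -
    have "- (w * u) * cnj (u - of_real r * w) = of_real r * u * (cnj w * w) - w * (cnj u * u)"
      by (simp add: algebra_simps)
    also have "\<dots> = of_real r * u - w"
      using \<open>cnj w * w = 1\<close> \<open>cnj u * u = 1\<close> by (simp only: mult_1_right)
    finally show ?thesis ..
  qed
  then have "norm (of_real r * u - w) = norm (u - of_real r * w)"
    using assms by (simp add: norm_mult del: complex_cnj_diff complex_cnj_mult)
  moreover have "u - w / of_real r = (of_real r * u - w) / of_real r"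
    using assms by (simp add: field_simps)
  ultimately show ?thesis using assms by (simp add: norm_divide)
qed

lemma Poisson_kernel_integral:
  assumes r: "0 < r" "r < 1" and w: "norm w = 1"
  shows "integrable circle_measure (\<lambda>u. (1 - r\<^sup>2) / (norm (u - of_real r * w))\<^sup>2)"
    and "(LINT u|circle_measure. (1 - r\<^sup>2) / (norm (u - of_real r * w))\<^sup>2) = 1"
proof -
  let ?a = "of_real r * w"
  have na: "norm ?a = r" using r w by (simp add: norm_mult)
  have aa: "?a * cnj ?a = of_real (r\<^sup>2)" using na by (simp only: complex_norm_square[symmetric] of_real_power)
  have ne: "1 - cnj ?a * u \<noteq> 0" if "norm u \<le> 1" for u
  proof
    assume "1 - cnj ?a * u = 0"
    then have "norm (cnj ?a * u) = 1" by (metis norm_one right_minus_eq)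
    moreover have "norm (cnj ?a * u) \<le> r * 1"
      unfolding norm_mult[of "cnj ?a"] complex_mod_cnj na using that r by (intro mult_mono) auto
    ultimately show False using r by simp
  qed
  have ne2: "u \<noteq> ?a" if "norm u = 1" for u using na that r by auto
  \<comment> \<open>On the circle \<open>u * cnj (u - ?a) = 1 - cnj ?a * u\<close>, so
    \<open>?g u / (u - ?a) * u\<close> is Poisson's kernel. As \<open>?g\<close> is holomorphic in
    the disc with value 1 at \<open>?a\<close>, Cauchy's formula evaluates the integral.\<close>
  let ?g = "\<lambda>u. of_real (1 - r\<^sup>2) / (1 - cnj ?a * u)"
  let ?k = "\<lambda>u. (1 - r\<^sup>2) / (norm (u - ?a))\<^sup>2"
  have holg: "?g holomorphic_on ball 0 1" "continuous_on (cball 0 1) ?g"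
    using ne by (auto intro!: holomorphic_intros continuous_intros)
  have "((\<lambda>u. ?g u / (u - ?a)) has_contour_integral (2 * of_real pi * \<i> * ?g ?a)) (circlepath 0 1)"
    by (rule Cauchy_integral_circlepath[OF holg(2,1)]) (use na r in simp)
  moreover have "?g ?a = 1"
  proof -
    have "(1::complex) - cnj ?a * ?a = of_real (1 - r\<^sup>2)" using aa by (simp add: mult.commute)
    moreover have "r\<^sup>2 < 1" using r by (simp add: power_less_one_iff)
    then have "complex_of_real (1 - r\<^sup>2) \<noteq> 0" by (simp only: of_real_eq_0_iff)
    ultimately show ?thesis by (metis divide_self)
  qed
  ultimately have "((\<lambda>u. ?g u / (u - ?a)) has_contour_integral (2 * of_real pi * \<i>)) (circlepath 0 1)"
    by simp
  moreover have cont: "continuous_on (sphere 0 1) (\<lambda>u. ?g u / (u - ?a))"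
    using ne2 by (intro continuous_on_divide continuous_on_subset[OF holg(2)] continuous_intros) auto
  ultimately have "(LINT u|circle_measure. ?g (of_real 1 * u) / (of_real 1 * u - ?a) * (of_real 1 * u)) = 1"
    by (subst contour_integral_circle_measure) auto
  also have "(LINT u|circle_measure. ?g (of_real 1 * u) / (of_real 1 * u - ?a) * (of_real 1 * u))
      = (LINT u|circle_measure. of_real (?k u))"
  proof (rule Bochner_Integration.integral_cong[OF refl])
    fix u assume "u \<in> space circle_measure"
    then have u: "norm u = 1" by simp
    then have uu: "u * cnj u = 1" by (simp add: complex_norm_square[symmetric])
    have "of_real ((norm (u - ?a))\<^sup>2) = (u - ?a) * cnj (u - ?a)"
      by (rule complex_norm_square)
    moreover have "u * cnj (u - ?a) = 1 - cnj ?a * u"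
      using uu by (simp add: right_diff_distrib mult_ac)
    ultimately have "u * of_real ((norm (u - ?a))\<^sup>2) = (u - ?a) * (1 - cnj ?a * u)"
      by (simp add: mult_ac)
    moreover have "u \<noteq> 0" "(u - ?a) * (1 - cnj ?a * u) \<noteq> 0"
      using u ne[of u] ne2[OF u] by auto
    ultimately have "u / ((u - ?a) * (1 - cnj ?a * u)) = 1 / of_real ((norm (u - ?a))\<^sup>2)"
      by (metis nonzero_divide_mult_cancel_left)
    then have "of_real (1 - r\<^sup>2) * (u / ((u - ?a) * (1 - cnj ?a * u))) = of_real (1 - r\<^sup>2) * (1 / of_real ((norm (u - ?a))\<^sup>2))"
      by (rule arg_cong)
    then show "?g (of_real 1 * u) / (of_real 1 * u - ?a) * (of_real 1 * u) = of_real (?k u)"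
      by (simp add: mult_ac)
  qed
  finally have int: "(LINT u|circle_measure. complex_of_real (?k u)) = 1" .
  then show "(LINT u|circle_measure. ?k u) = 1"
    unfolding integral_complex_of_real by (simp only: of_real_eq_1_iff)
  \<comment> \<open>The integral of a non-integrable function is 0 by convention, so the value 1
    already proves integrability.\<close>
  show "integrable circle_measure ?k"
    using int not_integrable_integral_eq by (metis complex_of_real_integrable_eq zero_neq_one)
qed

text \<open>Factoring the difference of squares produces \<open>a - b\<close>, of size
  \<open>(1 - r\<^sup>2) / r\<close>. By reflection \<open>norm (u - b) = norm (u - a) / r\<close>,
  so all remaining distances become powers of \<open>norm (u - a)\<close> and the powers of
  \<open>r\<close> cancel. The last step relaxes the constant from 2 to 4.\<close>

lemma Fatou_kernel_bound:
  fixes w u :: complex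
  assumes w: "norm w = 1" and u: "norm u = 1" and r: "0 < r" "r < 1"
  defines "a \<equiv> of_real r * w" and "b \<equiv> w / of_real r"
  shows "norm ((1 / (u - a)\<^sup>2 - 1 / (u - b)\<^sup>2) * u) \<le> 4 * (1 - r\<^sup>2) / norm (u - a) ^ 3"
proof -
  have na: "norm a = r" using r w by (simp add: a_def norm_mult)
  have ub: "norm (u - b) = norm (u - a) / r"
    unfolding a_def b_def by (rule norm_diff_reflected[OF w u r(1)])
  have ne: "u - a \<noteq> 0" using na u r by auto
  then have nb: "u - b \<noteq> 0" using ub r by auto
  have "a - b = of_real (r - 1 / r) * w" by (simp add: a_def b_def algebra_simps)
  moreover have "\<bar>r - 1 / r\<bar> = (1 - r\<^sup>2) / r"
  proof -
    have "r - 1 / r = - ((1 - r\<^sup>2) / r)" using r by (simp add: field_simps power2_eq_square)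
    moreover have "0 \<le> (1 - r\<^sup>2) / r" using r by (simp add: power_le_one)
    ultimately show ?thesis by (simp only: abs_minus_cancel abs_of_nonneg)
  qed
  ultimately have nab: "norm (a - b) = (1 - r\<^sup>2) / r"
    using w by (simp only: norm_mult norm_of_real mult_1_right)
  have "norm ((u - a) + (u - b)) \<le> norm (u - a) + norm (u - a) / r"
    using norm_triangle_ineq[of "u - a" "u - b"] ub by simp
  also have "\<dots> \<le> 2 * norm (u - a) / r"
    using r mult_right_mono[of r 1 "norm (u - a)"] by (simp add: field_simps)
  finally have nsum: "norm ((u - a) + (u - b)) \<le> 2 * norm (u - a) / r" .
  have "1 / (u - a)\<^sup>2 - 1 / (u - b)\<^sup>2 = (a - b) * ((u - a) + (u - b)) / ((u - a)\<^sup>2 * (u - b)\<^sup>2)"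
    using ne nb by (simp add: divide_simps) (simp add: power2_eq_square algebra_simps)
  then have "norm ((1 / (u - a)\<^sup>2 - 1 / (u - b)\<^sup>2) * u)
      = norm (a - b) * norm ((u - a) + (u - b)) / (norm (u - a) ^ 2 * norm (u - b) ^ 2)"
    using u by (simp only: norm_mult norm_divide norm_power mult_1_right)
  also have "\<dots> \<le> ((1 - r\<^sup>2) / r) * (2 * norm (u - a) / r) / (norm (u - a) ^ 2 * norm (u - b) ^ 2)"
    unfolding nab using nsum r by (intro divide_right_mono mult_left_mono) (auto simp: power_le_one)
  also have "\<dots> = 2 * (1 - r\<^sup>2) / norm (u - a) ^ 3"
    unfolding ub using r ne by (simp add: field_simps power2_eq_square power3_eq_cube)
  also have "\<dots> \<le> 4 * (1 - r\<^sup>2) / norm (u - a) ^ 3"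
    using r by (intro divide_right_mono) (auto simp: power_le_one)
  finally show ?thesis .
qed

text \<open>The pole \<open>b\<close> is the reflection of \<open>a\<close> in the circle, so its kernel integrates to \<open>0\<close>; subtracting it
  improves the decay of the kernel from order \<open>-2\<close> to order \<open>-3\<close>.\<close>

lemma Fatou_kernel_representation:
  assumes cont: "continuous_on (cball 0 1) E"
    and der: "\<And>z. norm z < 1 \<Longrightarrow> (E has_field_derivative f z) (at z)"
    and w: "norm w = 1" and r: "0 < r" "r < 1"
  defines "a \<equiv> of_real r * w" and "b \<equiv> w / of_real r"
  shows "f a = (LINT u|circle_measure. E u * ((1 / (u - a)\<^sup>2 - 1 / (u - b)\<^sup>2) * u))"
proof -
  have na: "norm a < 1" using r w by (simp add: a_def norm_mult)
  have nb: "1 < norm b" using r w by (simp add: b_def norm_divide)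
  have hol: "E holomorphic_on ball 0 1"
    unfolding holomorphic_on_def field_differentiable_def
    using der has_field_derivative_at_within by (metis dist_0_norm mem_ball)
  have "((\<lambda>u. E u / (u - a) ^ Suc 1) has_contour_integral (2 * pi * \<i> / fact 1 * (deriv ^^ 1) E a)) (circlepath 0 1)"
    by (rule Cauchy_has_contour_integral_higher_derivative_circlepath[OF cont hol]) (use na in simp)
  moreover have "(deriv ^^ 1) E a = f a" using DERIV_imp_deriv[OF der[OF na]] by simp
  ultimately have 1: "((\<lambda>u. E u / (u - a)\<^sup>2) has_contour_integral (2 * pi * \<i> * f a)) (circlepath 0 1)"
    by (simp add: numeral_2_eq_2)
  have neb: "u \<noteq> b" if "norm u \<le> 1" for u using nb that by auto
  \<comment> \<open>The factor \<open>u\<close> makes \<open>?g\<close> vanish at 0, so Cauchy's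
    formula at the centre shows that the integral of \<open>E u / (u - b)\<^sup>2\<close> is 0, with
    \<open>E\<close> only continuous up to the circle.\<close>
  let ?g = "\<lambda>u. E u * u / (u - b)\<^sup>2"
  have "((\<lambda>u. ?g u / (u - 0)) has_contour_integral (2 * of_real pi * \<i> * ?g 0)) (circlepath 0 1)"
    by (rule Cauchy_integral_circlepath)
       (use neb in \<open>auto intro!: continuous_intros holomorphic_intros cont hol\<close>)
  then have "((\<lambda>u. ?g u / (u - 0)) has_contour_integral 0) (circlepath 0 1)" by simp
  then have 2: "((\<lambda>u. E u / (u - b)\<^sup>2) has_contour_integral 0) (circlepath 0 1)"
    by (rule has_contour_integral_eq) auto
  let ?h = "\<lambda>u. E u / (u - a)\<^sup>2 - E u / (u - b)\<^sup>2"
  have 3: "(?h has_contour_integral (2 * pi * \<i> * f a - 0)) (circlepath 0 1)"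
    by (rule has_contour_integral_diff[OF 1 2])
  have "continuous_on (sphere 0 1) ?h"
    using na neb by (intro continuous_intros continuous_on_subset[OF cont]) auto
  from contour_integral_circle_measure[OF this _ 3]
  have "(LINT u|circle_measure. ?h (of_real 1 * u) * (of_real 1 * u)) = f a" by simp
  also have "(LINT u|circle_measure. ?h (of_real 1 * u) * (of_real 1 * u)) =
      (LINT u|circle_measure. E u * ((1 / (u - a)\<^sup>2 - 1 / (u - b)\<^sup>2) * u))"
    by (rule Bochner_Integration.integral_cong) (auto simp: algebra_simps)
  finally show ?thesis by simp
qed

text \<open>Subtracting the affine part of \<open>H\<close> at \<open>w\<close> leaves
  \<open>E\<close>, which on the circle near \<open>w\<close> is small compared with
  \<open>norm (u - w)\<close>. There \<open>E\<close> absorbs one power of the cubic kernel bound,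
  leaving a small multiple of Poisson's kernel, whose integral is 1. Away from \<open>w\<close> the
  kernel is of order \<open>1 - r\<^sup>2\<close> and disappears in the limit.\<close>

lemma Fatou_pointwise:
  assumes cont: "continuous_on (cball 0 1) H"
    and der: "\<And>z. norm z < 1 \<Longrightarrow> (H has_field_derivative F z) (at z)"
    and w: "norm w = 1"
    and diff: "\<And>e. 0 < e \<Longrightarrow> \<exists>d>0. \<forall>u. norm u = 1 \<longrightarrow> norm (u - w) < d \<longrightarrow>
        norm (H u - H w - c * (u - w)) \<le> e * norm (u - w)"
  shows "radial_limit F w c"
  unfolding radial_limit_def
proof (rule tendstoI)
  fix e :: real assume e: "0 < e"
  define E where "E u = H u - H w - c * (u - w)" for u
  have contE: "continuous_on (cball 0 1) E"
    unfolding E_def by (intro continuous_intros cont)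
  have derE: "(E has_field_derivative (F z - c)) (at z)" if "norm z < 1" for z
    unfolding E_def by (rule derivative_eq_intros der that refl | simp)+
  have "bounded (E ` cball 0 1)"
    by (rule compact_imp_bounded[OF compact_continuous_image[OF contE compact_cball]])
  then obtain C where C: "0 < C" "\<And>u. norm u \<le> 1 \<Longrightarrow> norm (E u) \<le> C"
    unfolding bounded_pos by auto
  \<comment> \<open>If \<open>s\<close> is the distance from \<open>u\<close> to the pole, then
    \<open>norm (u - w) \<le> 2 * s\<close>. With the kernel constant 4, the choice
    \<open>e / 16\<close> yields exactly \<open>e / 2\<close> times Poisson's kernel.\<close>
  obtain d where d: "0 < d" "\<And>u. norm u = 1 \<Longrightarrow> norm (u - w) < d \<Longrightarrow> norm (E u) \<le> (e / 16) * norm (u - w)"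
    using diff[of "e / 16"] e by (auto simp: E_def)
  have bound: "norm (F (of_real r * w) - c) \<le> e / 2 + 32 * C * (1 - r\<^sup>2) / d ^ 3" if r: "0 < r" "r < 1" for r
  proof -
    let ?a = "of_real r * w" and ?b = "w / of_real r"
    let ?k = "\<lambda>u. (1 / (u - ?a)\<^sup>2 - 1 / (u - ?b)\<^sup>2) * u"
    let ?p = "\<lambda>u. (1 - r\<^sup>2) / (norm (u - ?a))\<^sup>2"
    have na: "norm ?a = r" using r w by (simp add: norm_mult)
    have r2: "0 \<le> 1 - r\<^sup>2" using r by (simp add: power_le_one)
    have "F ?a - c = (LINT u|circle_measure. E u * ?k u)"
      by (rule Fatou_kernel_representation[OF contE derE w r])
    also have "norm \<dots> \<le> (LINT u|circle_measure. (e / 2) * ?p u + 32 * C * (1 - r\<^sup>2) / d ^ 3)"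
    proof (rule norm_circle_integral_le)
      have "u \<noteq> ?a" "u \<noteq> ?b" if "norm u = 1" for u
        using na that r w by (auto simp: norm_divide)
      then show "bounded_borel (\<lambda>u. E u * ?k u)"
        by (intro continuous_on_bounded_borel continuous_intros continuous_on_subset[OF contE]) auto
      show "integrable circle_measure (\<lambda>u. (e / 2) * ?p u + 32 * C * (1 - r\<^sup>2) / d ^ 3)"
        by (intro Bochner_Integration.integrable_add Bochner_Integration.integrable_mult_right
              Poisson_kernel_integral r w circle.integrable_const)
      fix u :: complex assume u: "norm u = 1"
      define s where "s = norm (u - ?a)"
      have s: "0 < s" using na u r by (auto simp: s_def)
      have "norm (?a - w) = 1 - r"
      proof -
        have "?a - w = of_real (r - 1) * w" by (simp add: algebra_simps)
        then show ?thesis using w r by (simp only: norm_mult norm_of_real) simp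
      qed
      moreover have "1 - r \<le> s" unfolding s_def using norm_triangle_ineq2[of u ?a] u na by simp
      ultimately have us: "norm (u - w) \<le> 2 * s"
        using norm_triangle_ineq[of "u - ?a" "?a - w"] by (simp add: s_def)
      have k: "norm (?k u) \<le> 4 * (1 - r\<^sup>2) / s ^ 3"
        unfolding s_def by (rule Fatou_kernel_bound[OF w u r])
      have nonneg: "0 \<le> 4 * (1 - r\<^sup>2) / s ^ 3" "0 \<le> (e / 2) * ?p u" "0 \<le> 32 * C * (1 - r\<^sup>2) / d ^ 3"
        using s r2 e C(1) d(1) by auto
      show "norm (E u * ?k u) \<le> (e / 2) * ?p u + 32 * C * (1 - r\<^sup>2) / d ^ 3"
      proof (cases "norm (u - w) < d")
        case True
        have "norm (E u) \<le> (e / 16) * (2 * s)"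
          using d(2)[OF u True] us e by (meson mult_left_mono order_trans divide_nonneg_nonneg less_imp_le zero_le_numeral)
        then have "norm (E u * ?k u) \<le> ((e / 16) * (2 * s)) * (4 * (1 - r\<^sup>2) / s ^ 3)"
          unfolding norm_mult[of "E u"] by (rule mult_mono) (use k nonneg e s in simp_all)
        also have "\<dots> = (e / 2) * ((1 - r\<^sup>2) / s\<^sup>2)"
          using s by (simp add: field_simps power2_eq_square power3_eq_cube)
        finally show ?thesis using nonneg(3) by (simp add: s_def)
      next
        case False
        \<comment> \<open>Far points lie at distance at least \<open>d / 2\<close> from the pole,
          whence \<open>32 = 4 * 2 ^ 3\<close>.\<close>
        then have "d \<le> 2 * s" using us by simp
        then have "d ^ 3 \<le> (2 * s) ^ 3" using d(1) by (intro power_mono) auto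
        then have d3: "d ^ 3 \<le> 8 * s ^ 3" by (simp add: power_mult_distrib)
        have "norm (E u * ?k u) \<le> C * (4 * (1 - r\<^sup>2) / s ^ 3)"
          unfolding norm_mult[of "E u"] by (rule mult_mono) (use k C u nonneg in simp_all)
        also have "\<dots> \<le> C * (4 * (1 - r\<^sup>2) / (d ^ 3 / 8))"
          using d3 d(1) C(1) r2 s by (intro mult_left_mono divide_left_mono) auto
        also have "\<dots> = 32 * C * (1 - r\<^sup>2) / d ^ 3" by simp
        finally show ?thesis using nonneg(2) by simp
      qed
    qed
    also have "\<dots> = e / 2 + 32 * C * (1 - r\<^sup>2) / d ^ 3"
      using Poisson_kernel_integral[OF r w] circle.prob_space
      by (subst Bochner_Integration.integral_add) (auto simp del: times_divide_eq_right)
    finally show ?thesis .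
  qed
  have "((\<lambda>r::real. e / 2 + 32 * C * (1 - r\<^sup>2) / d ^ 3) \<longlongrightarrow> e / 2 + 32 * C * (1 - 1\<^sup>2) / d ^ 3) (at_left 1)"
    by (intro tendsto_intros) (use d in auto)
  then have "\<forall>\<^sub>F r in at_left 1. e / 2 + 32 * C * (1 - r\<^sup>2) / d ^ 3 < e"
    by (rule order_tendstoD) (use e in simp)
  moreover have "\<forall>\<^sub>F r::real in at_left 1. r \<in> {0<..<1}"
    by (rule eventually_at_left_real) simp
  ultimately show "\<forall>\<^sub>F r in at_left 1. dist (F (of_real r * w)) c < e"
    by eventually_elim (use bound in \<open>force simp: dist_norm\<close>)
qed

section \<open>Boundary values of a primitive along arcs\<close>

lemma cis_has_vector_derivative: "(cis has_vector_derivative (\<i> * cis t)) (at t)"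
proof -
  have *: "((\<lambda>z. exp (\<i> * z)) has_field_derivative (\<i> * exp (\<i> * of_real t))) (at (of_real t))"
    by (auto intro!: derivative_eq_intros)
  have "((\<lambda>x. exp (\<i> * complex_of_real x)) has_vector_derivative (\<i> * exp (\<i> * of_real t))) (at t)"
    by (rule has_vector_derivative_real_field[OF *])
  moreover have "cis = (\<lambda>x. exp (\<i> * complex_of_real x))"
    by (rule ext) (rule cis_conv_exp)
  ultimately show ?thesis by (metis cis_conv_exp)
qed

text \<open>Turns an integral over an interval of angles into a pairing with a bounded Borel
  function on the circle, the form in which weak limits can be taken. With \<open>a\<close> and
  \<open>b\<close> strictly between 0 and \<open>2 * pi\<close>, a point of the arc determines its
  angle even within the closed interval \<open>{0..2 * pi}\<close>.\<close>

lemma circle_arc_integral: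
  fixes K :: "complex \<Rightarrow> complex"
  assumes X: "bounded_borel X" and ab: "0 < a" "a \<le> b" "b < 2 * pi"
  defines "K \<equiv> \<lambda>w. complex_of_real (indicator (cis ` {a..b}) w)"
  shows "bounded_borel K"
    and "((\<lambda>t. X (cis t)) has_integral (2 * pi * (LINT w|circle_measure. X w * K w))) {a..b}"
proof -
  have "compact (cis ` {a..b})"
    by (intro compact_continuous_image continuous_intros) auto
  then have "cis ` {a..b} \<in> sets borel" by (intro borel_closed compact_imp_closed)
  then show K: "bounded_borel K"
    unfolding K_def
    by (intro bounded_borelI[where B=1] borel_measurable_circle) (auto split: split_indicator)
  have XK: "bounded_borel (\<lambda>w. X w * K w)" by (rule bounded_borel_mult[OF X K])
  obtain B where "\<And>w. norm w = 1 \<Longrightarrow> norm (X w * K w) \<le> B" using bounded_borel_bound[OF XK] by blast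
  from circle_integral_HK[OF bounded_borel_measurable[OF XK] this]
  have "((\<lambda>t. X (cis t) * K (cis t)) has_integral (2 * pi * (LINT w|circle_measure. X w * K w))) {0..2 * pi}"
    by (simp add: scaleR_conv_of_real)
  then have "((\<lambda>t. if t \<in> {a..b} then X (cis t) else 0) has_integral (2 * pi * (LINT w|circle_measure. X w * K w))) {0..2 * pi}"
  proof (rule has_integral_eq[rotated])
    fix t assume t: "t \<in> {0..2 * pi}"
    have "t \<in> {a..b}" if in_arc: "cis t \<in> cis ` {a..b}"
    proof -
      obtain s where s: "s \<in> {a..b}" "cis t = cis s" using in_arc by auto
      then obtain n :: int where n: "t = s + 2 * pi * n"
        using sin_cos_eq_iff[of t s] by (auto simp: complex_eq_iff)
      have "0 \<le> t" "t \<le> 2 * pi" "a \<le> s" "s \<le> b" using t s(1) by auto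
      moreover have "2 * pi * real_of_int n = t - s" using n by simp
      ultimately have "2 * pi * n < 2 * pi * 1" "2 * pi * (-1) < 2 * pi * n" using ab by linarith+
      from this[THEN mult_left_less_imp_less] have "real_of_int n < 1" "-1 < real_of_int n"
        by simp_all
      then have "n = 0" by linarith
      then show ?thesis using n s(1) by simp
    qed
    then have "cis t \<in> cis ` {a..b} \<longleftrightarrow> t \<in> {a..b}" by blast
    then show "X (cis t) * K (cis t) = (if t \<in> {a..b} then X (cis t) else 0)"
      by (simp only: K_def indicator_def) simp
  qed
  then show "((\<lambda>t. X (cis t)) has_integral (2 * pi * (LINT w|circle_measure. X w * K w))) {a..b}"
    using ab by (subst (asm) has_integral_restrict) auto
qed

text \<open>On the circle of radius \<open>radius n\<close> this is the fundamental theorem of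
  calculus. As the radius tends to 1, the left side converges weakly, tested against
  \<open>\<i> * w\<close> times the indicator of the arc, and the right side converges by continuity
  of \<open>H\<close>.\<close>

lemma boundary_function_primitive:
  assumes F: "F holomorphic_on ball 0 1" and B: "\<And>z. norm z < 1 \<Longrightarrow> norm (F z) \<le> B"
    and M: "boundary_function F M" and cont: "continuous_on (cball 0 1) H"
    and der: "\<And>z. norm z < 1 \<Longrightarrow> (H has_field_derivative F z) (at z)"
    and ab: "0 < a" "a \<le> b" "b < 2 * pi"
  shows "((\<lambda>t. M (cis t) * (\<i> * cis t)) has_integral (H (cis b) - H (cis a))) {a..b}"
proof -
  define K where "K w = complex_of_real (indicator (cis ` {a..b}) w)" for w
  have K: "bounded_borel K" unfolding K_def by (rule circle_arc_integral(1)[OF bounded_borel_const ab])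
  have iw: "bounded_borel (\<lambda>w. \<i> * w)" by (intro continuous_on_bounded_borel continuous_intros)
  have bM: "bounded_borel M" using M by (simp add: boundary_function_def)
  have I: "((\<lambda>t. M (cis t) * (\<i> * cis t)) has_integral (2 * pi * (LINT w|circle_measure. M w * (\<i> * w) * K w))) {a..b}"
    unfolding K_def by (rule circle_arc_integral(2)[OF bounded_borel_mult[OF bM iw] ab])
  have eq: "H (radius n * cis b) - H (radius n * cis a) =
      radius n * (2 * pi * (LINT w|circle_measure. F (radius n * w) * ((\<i> * w) * K w)))" for n
  proof -
    have "((\<lambda>t. F (radius n * cis t) * (\<i> * cis t)) has_integral
        (2 * pi * (LINT w|circle_measure. F (radius n * w) * (\<i> * w) * K w))) {a..b}"
      unfolding K_def
      by (rule circle_arc_integral(2)[OF bounded_borel_mult[OF bounded_borel_dilation[OF F radius] iw] ab])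
    from has_integral_mult_right[OF this, of "of_real (radius n)"]
    have 1: "((\<lambda>t. radius n * (F (radius n * cis t) * (\<i> * cis t))) has_integral
        (radius n * (2 * pi * (LINT w|circle_measure. F (radius n * w) * ((\<i> * w) * K w))))) {a..b}"
      by (simp add: mult.assoc)
    have "((\<lambda>t. radius n * (F (radius n * cis t) * (\<i> * cis t))) has_integral
        (H (radius n * cis b) - H (radius n * cis a))) {a..b}"
    proof (rule fundamental_theorem_of_calculus[OF ab(2)])
      fix t
      have "norm (complex_of_real (radius n) * cis t) < 1" using radius[of n] by (simp add: norm_mult)
      from der[OF this]
      have "(H has_field_derivative F (radius n * cis t)) (at (radius n * cis t))" .
      moreover have "((\<lambda>t. radius n * cis t) has_vector_derivative (radius n * (\<i> * cis t))) (at t)"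
        by (rule has_vector_derivative_mult_right[OF cis_has_vector_derivative])
      ultimately have "((H \<circ> (\<lambda>t. radius n * cis t)) has_vector_derivative
          ((radius n * (\<i> * cis t)) * F (radius n * cis t))) (at t)"
        by (rule field_vector_diff_chain_at[rotated])
      then show "((\<lambda>t. H (radius n * cis t)) has_vector_derivative
          (radius n * (F (radius n * cis t) * (\<i> * cis t)))) (at t within {a..b})"
        by (simp add: has_vector_derivative_at_within o_def mult_ac)
    qed
    from has_integral_unique[OF this 1] show ?thesis .
  qed
  have lim: "(\<lambda>n. H (radius n * cis t)) \<longlonglongrightarrow> H (cis t)" for t
  proof (rule continuous_on_tendsto_compose[OF cont])
    have "(\<lambda>n. radius n * cis t) \<longlonglongrightarrow> of_real 1 * cis t"
      by (intro tendsto_intros radius_tendsto)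
    then show "(\<lambda>n. radius n * cis t) \<longlonglongrightarrow> cis t" by simp
  qed (use radius in \<open>auto simp: norm_mult less_imp_le intro!: always_eventually\<close>)
  have "(\<lambda>n. H (radius n * cis b) - H (radius n * cis a)) \<longlonglongrightarrow> H (cis b) - H (cis a)"
    by (intro tendsto_diff lim)
  moreover have "(\<lambda>n. H (radius n * cis b) - H (radius n * cis a)) \<longlonglongrightarrow>
      of_real 1 * (2 * pi * (LINT w|circle_measure. M w * ((\<i> * w) * K w)))"
    unfolding eq
    by (intro tendsto_intros radius_tendsto boundary_function_weak_limit[OF F B M] bounded_borel_mult iw K)
  ultimately have "H (cis b) - H (cis a) = 2 * pi * (LINT w|circle_measure. M w * ((\<i> * w) * K w))"
    by (simp add: LIMSEQ_unique)
  with I show ?thesis by (simp add: mult.assoc)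
qed

text \<open>Compares angle and chord: \<open>h\<close> is the argument of \<open>u / w\<close>. The
  restriction \<open>1 / 2\<close> and the factor 2 come from the estimate of the logarithm near
  1.\<close>

lemma sphere_arc_parameter:
  fixes u w :: complex
  assumes "norm w = 1" "norm u = 1" "norm (u - w) < 1 / 2"
  obtains h where "u = w * cis h" "\<bar>h\<bar> \<le> 2 * norm (u - w)"
proof -
  define q where "q = u / w"
  have q: "norm q = 1" "q \<noteq> 0" using assms by (auto simp: q_def norm_divide)
  have "w \<noteq> 0" using assms by auto
  then have "q - 1 = (u - w) / w" by (simp add: q_def diff_divide_distrib)
  then have n: "norm (q - 1) = norm (u - w)" using assms by (simp add: norm_divide)
  have "norm (Ln (1 + (q - 1))) \<le> 2 * norm (q - 1)"
    by (rule norm_Ln_le) (use n assms in simp)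
  then have "\<bar>Im (Ln q)\<bar> \<le> 2 * norm (u - w)"
    using n abs_Im_le_cmod[of "Ln q"] by simp
  moreover have "cis (Im (Ln q)) = q"
    using exp_Ln[OF q(2)] q by (metis exp_eq_polar Re_Ln ln_one exp_zero mult_1 of_real_1)
  ultimately show ?thesis
    using assms by (intro that[of "Im (Ln q)"]) (auto simp: q_def)
qed

text \<open>Lebesgue's differentiation theorem, for intervals to the right of \<open>t\<close> only;
  the left side is recovered in \<open>Fatou\<close> by reflection.\<close>

lemma bounded_borel_averages:
  assumes X: "bounded_borel X"
  obtains N where "negligible N"
    "\<And>t e. t \<notin> N \<Longrightarrow> 0 < e \<Longrightarrow> \<exists>d>0. \<forall>h. 0 < h \<and> h < d \<longrightarrow>
        norm (integral {t..t + h} (\<lambda>s. X (cis s)) - h * X (cis t)) \<le> e * h"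
proof -
  have int: "(\<lambda>s. X (cis s)) integrable_on cbox a b" for a b
  proof -
    obtain B where B: "\<And>w. norm w = 1 \<Longrightarrow> norm (X w) \<le> B" using bounded_borel_bound[OF X] by blast
    have "set_integrable lborel {a..b} (\<lambda>t. X (cis t))"
    proof (rule set_integrable_bound[where f="\<lambda>_. B"])
      show "set_integrable lborel {a..b} (\<lambda>_. B)"
        by (auto simp: set_integrable_def emeasure_lborel_Icc_eq intro!: integrable_mult_left integrable_real_indicator)
      show "set_borel_measurable lborel {a..b} (\<lambda>t. X (cis t))"
        unfolding set_borel_measurable_def using measurable_comp_cis[OF bounded_borel_measurable[OF X]] by auto
      show "AE x\<in>{a..b} in lborel. norm (X (cis x)) \<le> norm B"
        using order_trans[OF B abs_ge_self] by (intro AE_I2) (simp add: norm_cis)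
    qed
    from set_borel_integral_eq_integral(1)[OF this] show ?thesis by simp
  qed
  obtain N where N: "negligible N" "\<And>t e. t \<notin> N \<Longrightarrow> 0 < e \<Longrightarrow> \<exists>d>0. \<forall>h. 0 < h \<and> h < d \<longrightarrow>
      norm (integral (cbox t (t + h *\<^sub>R One)) (\<lambda>s. X (cis s)) /\<^sub>R h ^ DIM(real) - X (cis t)) < e"
    using integrable_ccontinuous_explicit[of "\<lambda>s. X (cis s)", OF int] by blast
  have "\<exists>d>0. \<forall>h. 0 < h \<and> h < d \<longrightarrow>
        norm (integral {t..t + h} (\<lambda>s. X (cis s)) - h * X (cis t)) \<le> e * h" if t: "t \<notin> N" and e: "0 < e" for t e
  proof -
    obtain d where d: "0 < d" "\<And>h. 0 < h \<Longrightarrow> h < d \<Longrightarrow>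
        norm (integral {t..t + h} (\<lambda>s. X (cis s)) /\<^sub>R h - X (cis t)) < e"
      using N(2)[OF t e] by auto
    have "norm (integral {t..t + h} (\<lambda>s. X (cis s)) - h * X (cis t)) \<le> e * h" if h: "0 < h" "h < d" for h
    proof -
      have "integral {t..t + h} (\<lambda>s. X (cis s)) - h * X (cis t) =
          h *\<^sub>R (integral {t..t + h} (\<lambda>s. X (cis s)) /\<^sub>R h - X (cis t))"
        using h by (simp add: scaleR_conv_of_real right_diff_distrib mult.assoc[symmetric])
      then have "norm (integral {t..t + h} (\<lambda>s. X (cis s)) - h * X (cis t)) =
          h * norm (integral {t..t + h} (\<lambda>s. X (cis s)) /\<^sub>R h - X (cis t))"
        using h by (simp only: norm_scaleR abs_of_pos)
      also have "\<dots> \<le> h * e" using d(2)[OF h] h by (intro mult_left_mono) auto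
      finally show ?thesis by (simp add: mult.commute)
    qed
    then show ?thesis using d(1) by blast
  qed
  with N(1) show ?thesis using that by blast
qed

text \<open>A primitive \<open>H\<close> of \<open>F\<close> is Lipschitz, and along the circle it is an indefinite integral of \<open>M\<close>,
  hence differentiable almost everywhere by Lebesgue's differentiation theorem.\<close>

theorem Fatou:
  assumes F: "F holomorphic_on ball 0 1" and B: "\<And>z. norm z < 1 \<Longrightarrow> norm (F z) \<le> B"
    and M: "boundary_function F M"
  shows "AE w in circle_measure. radial_limit F w (M w)"
proof -
  have bM: "bounded_borel M" using M by (simp add: boundary_function_def)
  obtain H0 where H0: "\<And>z. z \<in> ball 0 1 \<Longrightarrow> (H0 has_field_derivative F z) (at z within ball 0 1)"
    using holomorphic_convex_primitive'[OF convex_ball open_ball F] by blast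
  have "0 \<le> B" using order_trans[OF norm_ge_zero B[of 0]] by simp
  have B': "norm (F z) \<le> B" if "z \<in> ball 0 1" for z using B that by simp
  have "B-lipschitz_on (ball 0 1) H0"
  proof (rule lipschitz_onI)
    fix x y :: complex assume xy: "x \<in> ball 0 1" "y \<in> ball 0 1"
    show "dist (H0 x) (H0 y) \<le> B * dist x y"
      unfolding dist_norm
    proof (rule field_differentiable_bound[OF convex_ball[of 0 1]])
      show "(H0 has_field_derivative F z) (at z within ball 0 1)" if "z \<in> ball 0 1" for z
        by (rule H0[OF that])
      show "norm (F z) \<le> B" if "z \<in> ball 0 1" for z
        by (rule B'[OF that])
    qed (rule xy)+
  qed fact
  then obtain H where H: "B-lipschitz_on (closure (ball 0 1)) H" "\<And>z. z \<in> ball 0 1 \<Longrightarrow> H z = H0 z"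
    using lipschitz_extend_closure by blast
  have cont: "continuous_on (cball 0 1) H"
    using lipschitz_on_continuous_on[OF H(1)] by simp
  have der: "(H has_field_derivative F z) (at z)" if "norm z < 1" for z
  proof (rule has_field_derivative_transform_within_open[where S="ball 0 1"])
    show "(H0 has_field_derivative F z) (at z)"
      using H0[of z] that by (simp add: at_within_open[of z "ball 0 1"])
  qed (use that H(2) in auto)
  define X where "X w = M w * (\<i> * w)" for w
  have iw: "bounded_borel (\<lambda>w. \<i> * w)" by (intro continuous_on_bounded_borel continuous_intros)
  have X: "bounded_borel X" unfolding X_def by (intro bounded_borel_mult bM iw)
  have cnj_meas: "cnj \<in> circle_measure \<rightarrow>\<^sub>M circle_measure"
  proof -
    have "cnj \<in> circle_measure \<rightarrow>\<^sub>M restrict_space borel (sphere 0 1)"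
      by (intro measurable_restrict_space2 bounded_borel_measurable continuous_on_bounded_borel continuous_intros) auto
    then show ?thesis by (simp add: measurable_cong_sets[OF refl sets_circle_measure])
  qed
  obtain N where N: "negligible N"
    "\<And>t e. t \<notin> N \<Longrightarrow> 0 < e \<Longrightarrow> \<exists>d>0. \<forall>h. 0 < h \<and> h < d \<longrightarrow>
        norm (integral {t..t + h} (\<lambda>s. X (cis s)) - h * X (cis t)) \<le> e * h"
    using bounded_borel_averages[OF X] by blast
  \<comment> \<open>Conjugation reverses the angle: right-hand averages of the reflected function at
    \<open>- t\<close> are left-hand averages of \<open>X\<close> at \<open>t\<close>.\<close>
  obtain N' where N': "negligible N'"
    "\<And>t e. t \<notin> N' \<Longrightarrow> 0 < e \<Longrightarrow> \<exists>d>0. \<forall>h. 0 < h \<and> h < d \<longrightarrow>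
        norm (integral {t..t + h} (\<lambda>s. X (cnj (cis s))) - h * X (cnj (cis t))) \<le> e * h"
    using bounded_borel_averages[OF bounded_borel_comp[OF X cnj_meas]] by blast
  have arc: "integral {a..b} (\<lambda>s. X (cis s)) = H (cis b) - H (cis a)" if "0 < a" "a \<le> b" "b < 2 * pi" for a b
    using boundary_function_primitive[OF F B M cont der that] by (simp add: X_def integral_unique)
  have main: "radial_limit F (cis t) (M (cis t))" if t: "0 < t" "t < 2 * pi" "t \<notin> N" "- t \<notin> N'" for t
  proof (rule Fatou_pointwise[OF cont der])
    have "((\<lambda>s. H (cis s)) has_vector_derivative X (cis t)) (at t)"
      unfolding has_vector_derivative_def has_derivative_at_alt
    proof (intro conjI bounded_linear_scaleR_left allI impI)
      fix e :: real assume e: "0 < e"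
      obtain d1 where d1: "0 < d1" "\<And>h. 0 < h \<Longrightarrow> h < d1 \<Longrightarrow>
          norm (integral {t..t + h} (\<lambda>s. X (cis s)) - h * X (cis t)) \<le> e * h"
        using N(2)[OF t(3) e] by blast
      obtain d2 where d2: "0 < d2" "\<And>h. 0 < h \<Longrightarrow> h < d2 \<Longrightarrow>
          norm (integral {- t..- t + h} (\<lambda>s. X (cis (- s))) - h * X (cis t)) \<le> e * h"
        using N'(2)[OF t(4) e] by (auto simp: cis_cnj)
      define d where "d = min (min d1 d2) (min t (2 * pi - t))"
      have "norm (H (cis y) - H (cis t) - (y - t) *\<^sub>R X (cis t)) \<le> e * norm (y - t)"
        if y: "norm (y - t) < d" for y
      proof (cases y t rule: linorder_cases)
        case greater
        then have "integral {t..t + (y - t)} (\<lambda>s. X (cis s)) = H (cis y) - H (cis t)"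
          using arc[of t y] t y by (simp add: d_def)
        then show ?thesis
          using d1(2)[of "y - t"] greater y by (simp add: d_def scaleR_conv_of_real)
      next
        case less
        have "integral {- t..- t + (t - y)} (\<lambda>s. X (cis (- s))) = integral {y..t} (\<lambda>s. X (cis s))"
          using Henstock_Kurzweil_Integration.integral_reflect_real[where a=y and b=t and f="\<lambda>s. X (cis s)"] by simp
        also have "\<dots> = H (cis t) - H (cis y)"
          using arc[of y t] t y less by (simp add: d_def)
        finally have eq: "integral {- t..- t + (t - y)} (\<lambda>s. X (cis (- s))) = H (cis t) - H (cis y)" .
        have "norm (H (cis t) - H (cis y) - (t - y) * X (cis t)) \<le> e * (t - y)"
          using d2(2)[of "t - y"] less y unfolding eq by (simp add: d_def)
        moreover have "H (cis y) - H (cis t) - (y - t) *\<^sub>R X (cis t) = - (H (cis t) - H (cis y) - (t - y) * X (cis t))"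
          by (simp add: scaleR_conv_of_real algebra_simps)
        ultimately show ?thesis using less by (simp only: norm_minus_cancel) simp
      qed simp
      moreover have "0 < d" using d1 d2 t by (simp add: d_def)
      ultimately show "\<exists>d>0. \<forall>y. norm (y - t) < d \<longrightarrow>
          norm (H (cis y) - H (cis t) - (y - t) *\<^sub>R X (cis t)) \<le> e * norm (y - t)"
        by blast
    qed
    \<comment> \<open>Passage from the angular derivative to a derivative in \<open>u\<close>: since
      \<open>X (cis t) = M (cis t) * (\<i> * cis t)\<close>, subtracting
      \<open>M (cis t) * cis s\<close> leaves derivative 0.\<close>
    moreover have "((\<lambda>s. M (cis t) * cis s) has_vector_derivative (M (cis t) * (\<i> * cis t))) (at t)"
      by (rule has_vector_derivative_mult_right[OF cis_has_vector_derivative])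
    ultimately have "((\<lambda>s. H (cis s) - M (cis t) * cis s) has_vector_derivative (X (cis t) - M (cis t) * (\<i> * cis t))) (at t)"
      by (rule has_vector_derivative_diff)
    then have deriv0: "((\<lambda>s. H (cis s) - M (cis t) * cis s) has_vector_derivative 0) (at t)"
      by (simp add: X_def)
    fix e :: real assume e: "0 < e"
    \<comment> \<open>The half in \<open>e / 2\<close>, like that in \<open>d / 2\<close> below,
      absorbs the factor 2 between the angle \<open>h\<close> and the chord.\<close>
    then obtain d where d: "0 < d" "\<And>y. norm (y - t) < d \<Longrightarrow>
        norm (H (cis y) - M (cis t) * cis y - (H (cis t) - M (cis t) * cis t)) \<le> (e / 2) * norm (y - t)"
      using deriv0[unfolded has_vector_derivative_def has_derivative_at_alt, THEN conjunct2, rule_format, of "e / 2"]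
      by auto
    show "\<exists>d>0. \<forall>u. norm u = 1 \<longrightarrow> norm (u - cis t) < d \<longrightarrow>
        norm (H u - H (cis t) - M (cis t) * (u - cis t)) \<le> e * norm (u - cis t)"
    proof (intro exI[of _ "min (1/2) (d / 2)"] conjI allI impI)
      fix u assume u: "norm u = 1" "norm (u - cis t) < min (1/2) (d / 2)"
      obtain h where h: "u = cis t * cis h" "\<bar>h\<bar> \<le> 2 * norm (u - cis t)"
        using sphere_arc_parameter[of "cis t" u] u by auto
      then have u_eq: "u = cis (t + h)" by (simp add: cis_mult)
      have "norm (t + h - t) < d" using h(2) u(2) by simp
      from d(2)[OF this]
      have "norm (H u - H (cis t) - M (cis t) * (u - cis t)) \<le> (e / 2) * \<bar>h\<bar>"
        unfolding u_eq by (simp add: algebra_simps)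
      also have "\<dots> \<le> (e / 2) * (2 * norm (u - cis t))"
        using h(2) e by (intro mult_left_mono) auto
      finally show "norm (H u - H (cis t) - M (cis t) * (u - cis t)) \<le> e * norm (u - cis t)" by simp
    qed (use d(1) in auto)
  qed auto
  \<comment> \<open>The angle 0 is excluded because \<open>arc\<close> requires angles strictly
    between 0 and \<open>2 * pi\<close>; \<open>N'\<close> enters reflected because
    \<open>main\<close> tests \<open>- t\<close>.\<close>
  have "negligible (N \<union> uminus ` N' \<union> {0})"
  proof (intro negligible_Un N)
    show "negligible (uminus ` N')"
      by (rule negligible_differentiable_image_negligible[OF order_refl N'(1)]) (intro derivative_intros)
  qed auto
  then have "AE t in lebesgue. t \<notin> N \<union> uminus ` N' \<union> {0}"
    by (intro AE_not_in) (simp add: negligible_iff_null_sets)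
  then have "AE t in lborel. t \<notin> N \<union> uminus ` N' \<union> {0}"
    by (simp only: AE_completion_iff)
  then have "AE t in lborel. t \<in> {0..<2*pi} \<longrightarrow> radial_limit F (cis t) (M (cis t))"
  proof eventually_elim
    case (elim t)
    then have "- t \<notin> N'" by (auto intro: image_eqI[of _ _ "- t"])
    with elim show ?case using main[of t] by auto
  qed
  then show ?thesis
  proof (rule AE_circleI)
    show "{w \<in> sphere 0 1. radial_limit F w (M w)} \<in> sets circle_measure"
      using radial_limit_sets[OF F bounded_borel_measurable[OF bM]] by simp
  qed
qed

text \<open>The coefficients identify the composite of the boundary maps as the boundary function,
  and Fatou's theorem turns this into radial convergence. Modulus one is then automatic, as both
  boundary maps send the circle into itself.\<close>

lemma inner_function_comp:
  assumes f: "inner_function f" and g: "inner_function g" "g 0 = 0"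
  shows "inner_function (f \<circ> g)"
proof -
  note Df = inner_functionD[OF f] and Dg = inner_functionD[OF g(1)]
  have hol: "(f \<circ> g) holomorphic_on ball 0 1"
    by (rule holomorphic_on_compose_gen[OF Dg(1) Df(1)]) (use Dg(2) in auto)
  have lt: "norm ((f \<circ> g) z) < 1" if "norm z < 1" for z
    using Df(2) Dg(2) that by simp
  have "AE w in circle_measure. radial_limit (f \<circ> g) w (boundary_map f (boundary_map g w))"
    by (rule Fatou[OF hol less_imp_le[OF lt] boundary_function_comp[OF f g]])
  then have "AE w in circle_measure. \<exists>l. radial_limit (f \<circ> g) w l \<and> norm l = 1"
    using AE_space
  proof eventually_elim
    case (elim w)
    then have "norm w = 1" by simp
    then have "norm (boundary_map f (boundary_map g w)) = 1"
      by (rule norm_circle_map[OF boundary_map_measurable[OF Df(1)]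
            norm_circle_map[OF boundary_map_measurable[OF Dg(1)]]])
    with elim show ?case by blast
  qed
  then show ?thesis
    using hol lt by (auto simp: inner_function_def image_subset_iff simp del: o_apply)
qed

section \<open>Ergodic averages on the circle\<close>

abbreviation square_integral :: "(complex \<Rightarrow> complex) \<Rightarrow> real" where
  "square_integral f \<equiv> LINT x|circle_measure. (norm (f x))\<^sup>2"

abbreviation circle_L2 :: "(complex \<Rightarrow> complex) \<Rightarrow> bool" where
  "circle_L2 \<equiv> in_L2 circle_measure"

lemma in_L2D:
  assumes "circle_L2 f"
  shows "f \<in> borel_measurable circle_measure" "integrable circle_measure (\<lambda>x. (norm (f x))\<^sup>2)"
    "integrable circle_measure (\<lambda>x. norm (f x))" "integrable circle_measure f"
proof -
  show f: "f \<in> borel_measurable circle_measure" "integrable circle_measure (\<lambda>x. (norm (f x))\<^sup>2)"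
    using assms by (auto simp: in_L2_def)
  have le: "norm x \<le> 1 + (norm x)\<^sup>2" for x :: complex
    using zero_le_power2[of "norm x - 1 / 2"] by (simp add: power2_eq_square algebra_simps)
  show "integrable circle_measure f"
  proof (rule Bochner_Integration.integrable_bound[OF _ f(1)])
    show "integrable circle_measure (\<lambda>x. 1 + (norm (f x))\<^sup>2)"
      by (intro Bochner_Integration.integrable_add f circle.integrable_const)
    show "AE x in circle_measure. norm (f x) \<le> norm (1 + (norm (f x))\<^sup>2)"
      using le by (intro AE_I2) (simp only: real_norm_def abs_of_nonneg add_nonneg_nonneg zero_le_power2 zero_le_one)
  qed
  then show "integrable circle_measure (\<lambda>x. norm (f x))" by (rule integrable_norm)
qed

lemma norm_add_square_le: "(norm (a + b))\<^sup>2 \<le> 2 * (norm a)\<^sup>2 + 2 * (norm (b::complex))\<^sup>2"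
proof -
  have "(norm (a + b))\<^sup>2 \<le> (norm a + norm b)\<^sup>2"
    by (intro power_mono norm_triangle_ineq) auto
  also have "\<dots> \<le> 2 * (norm a)\<^sup>2 + 2 * (norm b)\<^sup>2"
    using zero_le_power2[of "norm a - norm b"] by (simp add: power2_sum power2_diff)
  finally show ?thesis .
qed

lemma norm_add_square:
  fixes a b :: complex
  shows "(norm (a + b))\<^sup>2 = (norm a)\<^sup>2 + (norm b)\<^sup>2 + 2 * Re (a * cnj b)"
  unfolding cmod_power2 by (simp add: power2_eq_square algebra_simps)

lemma norm_average_square_le:
  "(norm ((\<Sum>n=1..N. a n) / of_nat N))\<^sup>2 \<le> (\<Sum>n=1..N. (norm (a n :: complex))\<^sup>2) / N"
proof (cases "N = 0")
  case False
  have "(norm (\<Sum>n=1..N. a n))\<^sup>2 \<le> (\<Sum>n=1..N. norm (a n))\<^sup>2"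
    by (intro power_mono norm_sum) auto
  also have "\<dots> \<le> (\<Sum>n=1..N. (norm (a n))\<^sup>2) * card {1..N}"
    by (rule sum_squared_le_sum_of_squares)
  finally show ?thesis
    using False by (simp add: norm_divide power_divide field_simps power2_eq_square)
qed auto

lemma in_L2_add [intro]:
  assumes "circle_L2 f" "circle_L2 g" shows "circle_L2 (\<lambda>x. f x + g x)"
  unfolding in_L2_def
proof
  show m: "(\<lambda>x. f x + g x) \<in> borel_measurable circle_measure"
    using assms[THEN in_L2D(1)] by (intro borel_measurable_add)
  then have m2: "(\<lambda>x. (norm (f x + g x))\<^sup>2) \<in> borel_measurable circle_measure" by measurable
  show "integrable circle_measure (\<lambda>x. (norm (f x + g x))\<^sup>2)"
  proof (rule Bochner_Integration.integrable_bound[OF _ m2])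
    show "integrable circle_measure (\<lambda>x. 2 * (norm (f x))\<^sup>2 + 2 * (norm (g x))\<^sup>2)"
      using assms[THEN in_L2D(2)]
      by (intro Bochner_Integration.integrable_add Bochner_Integration.integrable_mult_right)
    show "AE x in circle_measure. norm ((norm (f x + g x))\<^sup>2) \<le> norm (2 * (norm (f x))\<^sup>2 + 2 * (norm (g x))\<^sup>2)"
      using norm_add_square_le by (intro AE_I2) simp
  qed
qed

lemma in_L2_mult [intro]: "circle_L2 f \<Longrightarrow> circle_L2 (\<lambda>x. c * f x)"
  unfolding in_L2_def
  by (auto simp: norm_mult power_mult_distrib intro!: borel_measurable_times Bochner_Integration.integrable_mult_right)

lemma in_L2_diff [intro]: "circle_L2 f \<Longrightarrow> circle_L2 g \<Longrightarrow> circle_L2 (\<lambda>x. f x - g x)"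
  using in_L2_add[of f "\<lambda>x. (-1) * g x"] in_L2_mult[of g "-1"] by simp

lemma in_L2_bounded_borel: "bounded_borel f \<Longrightarrow> circle_L2 f"
proof -
  assume f: "bounded_borel f"
  then obtain B where B: "\<And>w. norm w = 1 \<Longrightarrow> norm (f w) \<le> B" using bounded_borel_bound by blast
  have "(\<lambda>w. (norm (f w))\<^sup>2) \<in> borel_measurable circle_measure"
    using bounded_borel_measurable[OF f] by measurable
  then have "integrable circle_measure (\<lambda>w. (norm (f w))\<^sup>2)"
    by (rule circle.integrable_const_bound[where B="B\<^sup>2", rotated])
       (use B in \<open>intro AE_I2, simp add: power_mono\<close>)
  with f show ?thesis by (simp add: in_L2_def bounded_borel_measurable)
qed

lemma in_L2_sum: "(\<And>i. i \<in> I \<Longrightarrow> circle_L2 (f i)) \<Longrightarrow> circle_L2 (\<lambda>x. \<Sum>i\<in>I. f i x)"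
  by (induction I rule: infinite_finite_induct) (auto intro: in_L2_bounded_borel)

lemma norm_integral_square_le:
  assumes "circle_L2 f"
  shows "(LINT x|circle_measure. norm (f x))\<^sup>2 \<le> square_integral f"
    and "(norm (LINT x|circle_measure. f x))\<^sup>2 \<le> square_integral f"
proof -
  show 1: "(LINT x|circle_measure. norm (f x))\<^sup>2 \<le> square_integral f"
    using circle.variance_positive[of "\<lambda>x. norm (f x)"] circle.variance_eq[of "\<lambda>x. norm (f x)"] in_L2D[OF assms]
    by simp
  have "(norm (LINT x|circle_measure. f x))\<^sup>2 \<le> (LINT x|circle_measure. norm (f x))\<^sup>2"
    by (intro power_mono integral_norm_bound) auto
  from this 1 show "(norm (LINT x|circle_measure. f x))\<^sup>2 \<le> square_integral f" by (rule order_trans)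
qed

lemma in_L2_comp:
  assumes T: "measure_preserving_map circle_measure T" and f: "circle_L2 f"
  shows "circle_L2 (\<lambda>x. f (T x))" "square_integral (\<lambda>x. f (T x)) = square_integral f"
proof -
  have Tm: "T \<in> circle_measure \<rightarrow>\<^sub>M circle_measure" and D: "distr circle_measure circle_measure T = circle_measure"
    using T by (auto simp: measure_preserving_map_def)
  note f' = in_L2D[OF f]
  have m: "(\<lambda>x. (norm (f x))\<^sup>2) \<in> borel_measurable circle_measure" using f'(1) by measurable
  show "square_integral (\<lambda>x. f (T x)) = square_integral f"
    using integral_distr[OF Tm m] by (simp add: D)
  have "integrable circle_measure (\<lambda>x. (norm (f (T x)))\<^sup>2)"
    using integrable_distr_eq[OF Tm m] f'(2) by (simp add: D)
  then show "circle_L2 (\<lambda>x. f (T x))"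
    using measurable_compose[OF Tm f'(1)] by (simp add: in_L2_def)
qed

definition deviation :: "(nat \<Rightarrow> complex \<Rightarrow> complex) \<Rightarrow> (complex \<Rightarrow> complex) \<Rightarrow> nat \<Rightarrow> complex \<Rightarrow> complex" where
  "deviation T \<phi> N x = (\<Sum>n=1..N. \<phi> (T n x)) / of_nat N - (LINT y|circle_measure. \<phi> y)"

text \<open>With squared norms all estimates stay inside integrals; the triangle inequality is
  replaced by \<open>norm_add_square_le\<close> at the price of a factor 2.\<close>

lemma ergodic_seq_iff:
  "ergodic_seq circle_measure T \<longleftrightarrow> (\<forall>n\<ge>1. measure_preserving_map circle_measure (T n)) \<and>
     (\<forall>\<phi>. circle_L2 \<phi> \<longrightarrow> (\<lambda>N. square_integral (deviation T \<phi> N)) \<longlonglongrightarrow> 0)"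
proof -
  have "(\<lambda>N. sqrt (a N)) \<longlonglongrightarrow> 0 \<longleftrightarrow> a \<longlonglongrightarrow> 0" if "\<And>N. 0 \<le> a N" for a :: "nat \<Rightarrow> real"
  proof
    assume "(\<lambda>N. sqrt (a N)) \<longlonglongrightarrow> 0"
    from tendsto_power[OF this, of 2] show "a \<longlonglongrightarrow> 0" using that by simp
  next
    assume "a \<longlonglongrightarrow> 0"
    from tendsto_real_sqrt[OF this] show "(\<lambda>N. sqrt (a N)) \<longlonglongrightarrow> 0" by simp
  qed
  then show ?thesis
    by (simp add: ergodic_seq_def norm_L2_def deviation_def o_def)
qed

section \<open>Ergodicity criteria for measure-preserving sequences\<close>

locale preserving_sequence =
  fixes T :: "nat \<Rightarrow> complex \<Rightarrow> complex"
  assumes preserving: "\<And>n. n \<ge> 1 \<Longrightarrow> measure_preserving_map circle_measure (T n)"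
begin

lemma in_L2_average: "circle_L2 \<phi> \<Longrightarrow> circle_L2 (\<lambda>x. (\<Sum>n=1..N. \<phi> (T n x)) / of_nat N)"
  using in_L2_mult[OF in_L2_sum[of "{1..N}" "\<lambda>n x. \<phi> (T n x)"], of "1 / of_nat N"]
    in_L2_comp(1)[OF preserving] by simp

lemma in_L2_deviation: "circle_L2 \<phi> \<Longrightarrow> circle_L2 (deviation T \<phi> N)"
  unfolding deviation_def[abs_def] by (intro in_L2_diff in_L2_average in_L2_bounded_borel[OF bounded_borel_const])

text \<open>Averaging is a contraction of L^2 by Cauchy-Schwarz and invariance of the measure, and
  so is taking the mean, whence \<open>4 = 2 + 2\<close>. Uniformity in \<open>N\<close> is what
  lets \<open>deviation_limit\<close> pass to L^2 limits.\<close>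

lemma square_integral_deviation_le:
  assumes "circle_L2 \<phi>"
  shows "square_integral (deviation T \<phi> N) \<le> 4 * square_integral \<phi>"
proof -
  let ?A = "\<lambda>x. (\<Sum>n=1..N. \<phi> (T n x)) / of_nat N"
  let ?c = "LINT y|circle_measure. \<phi> y"
  note \<phi> = assms and c = in_L2_comp[OF preserving assms]
  have "square_integral ?A \<le> (LINT x|circle_measure. (\<Sum>n=1..N. (norm (\<phi> (T n x)))\<^sup>2) / N)"
    using c(1) in_L2_average[OF \<phi>] norm_average_square_le
    by (intro integral_mono) (auto intro!: in_L2D(2) Bochner_Integration.integrable_divide Bochner_Integration.integrable_sum)
  also have "\<dots> = (\<Sum>n=1..N. square_integral (\<lambda>x. \<phi> (T n x))) / N"
    using c(1)[THEN in_L2D(2)] by (simp add: Bochner_Integration.integral_sum)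
  also have "\<dots> \<le> square_integral \<phi>"
    using c(2) by simp
  finally have A: "square_integral ?A \<le> square_integral \<phi>" .
  have "square_integral (deviation T \<phi> N) \<le> (LINT x|circle_measure. 2 * (norm (?A x))\<^sup>2 + 2 * (norm ?c)\<^sup>2)"
  proof (rule integral_mono)
    show "integrable circle_measure (\<lambda>x. (norm (deviation T \<phi> N x))\<^sup>2)"
      using in_L2D(2)[OF in_L2_deviation[OF \<phi>]] .
    show "integrable circle_measure (\<lambda>x. 2 * (norm (?A x))\<^sup>2 + 2 * (norm ?c)\<^sup>2)"
      using in_L2D(2)[OF in_L2_average[OF \<phi>]] by auto
    show "(norm (deviation T \<phi> N x))\<^sup>2 \<le> 2 * (norm (?A x))\<^sup>2 + 2 * (norm ?c)\<^sup>2" for x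
      using norm_add_square_le[of "?A x" "- ?c"] by (simp add: deviation_def)
  qed
  also have "\<dots> = 2 * square_integral ?A + 2 * (norm ?c)\<^sup>2"
    using in_L2D(2)[OF in_L2_average[OF \<phi>]] circle.prob_space
    by (subst Bochner_Integration.integral_add) auto
  also have "\<dots> \<le> 4 * square_integral \<phi>"
    using A norm_integral_square_le(2)[OF \<phi>] by simp
  finally show ?thesis .
qed

lemma deviation_add:
  assumes "circle_L2 \<phi>" "circle_L2 \<psi>"
  shows "deviation T (\<lambda>x. \<phi> x + \<psi> x) N x = deviation T \<phi> N x + deviation T \<psi> N x"
  using assms[THEN in_L2D(4)] by (simp add: deviation_def sum.distrib add_divide_distrib)

lemma square_integral_deviation_add_le:
  assumes "circle_L2 \<phi>" "circle_L2 \<psi>"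
  shows "square_integral (deviation T (\<lambda>x. \<phi> x + \<psi> x) N)
    \<le> 2 * square_integral (deviation T \<phi> N) + 2 * square_integral (deviation T \<psi> N)"
proof -
  have "square_integral (deviation T (\<lambda>x. \<phi> x + \<psi> x) N)
      \<le> (LINT x|circle_measure. 2 * (norm (deviation T \<phi> N x))\<^sup>2 + 2 * (norm (deviation T \<psi> N x))\<^sup>2)"
    using assms in_L2_deviation[of "\<lambda>x. \<phi> x + \<psi> x" N]
    by (intro integral_mono) (auto intro!: in_L2D(2) in_L2_deviation Bochner_Integration.integrable_add
        simp: deviation_add norm_add_square_le simp del: in_L2_add)
  also have "\<dots> = 2 * square_integral (deviation T \<phi> N) + 2 * square_integral (deviation T \<psi> N)"
    using assms by (subst Bochner_Integration.integral_add) (auto intro!: in_L2D(2) in_L2_deviation)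
  finally show ?thesis .
qed

lemma deviation_limit:
  assumes \<phi>: "circle_L2 \<phi>" and \<psi>: "\<And>m. circle_L2 (\<psi> m)"
    and conv: "\<And>m. (\<lambda>N. square_integral (deviation T (\<psi> m) N)) \<longlonglongrightarrow> 0"
    and lim: "(\<lambda>m. square_integral (\<lambda>x. \<phi> x - \<psi> m x)) \<longlonglongrightarrow> 0"
  shows "(\<lambda>N. square_integral (deviation T \<phi> N)) \<longlonglongrightarrow> 0"
proof (rule LIMSEQ_I)
  fix e :: real assume e: "0 < e"
  \<comment> \<open>The two contributions are \<open>2 * 4 * (e / 16)\<close> and
    \<open>2 * (e / 4)\<close>, each \<open>e / 2\<close>.\<close>
  obtain m where m: "square_integral (\<lambda>x. \<phi> x - \<psi> m x) < e / 16"
    using order_tendstoD(2)[OF lim, of "e / 16"] e by (auto simp: eventually_sequentially)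
  obtain N0 where N0: "\<And>N. N \<ge> N0 \<Longrightarrow> square_integral (deviation T (\<psi> m) N) < e / 4"
    using order_tendstoD(2)[OF conv, of "e / 4" m] e by (auto simp: eventually_sequentially)
  have "square_integral (deviation T \<phi> N) < e" if "N \<ge> N0" for N
  proof -
    have "square_integral (deviation T (\<lambda>x. (\<phi> x - \<psi> m x) + \<psi> m x) N)
      \<le> 2 * square_integral (deviation T (\<lambda>x. \<phi> x - \<psi> m x) N) + 2 * square_integral (deviation T (\<psi> m) N)"
      by (intro square_integral_deviation_add_le in_L2_diff \<phi> \<psi>)
    also have "\<dots> \<le> 2 * (4 * square_integral (\<lambda>x. \<phi> x - \<psi> m x)) + 2 * square_integral (deviation T (\<psi> m) N)"
      using square_integral_deviation_le[OF in_L2_diff[OF \<phi> \<psi>[of m]], of N] by simp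
    also have "\<dots> < e" using m N0[OF that] by simp
    finally show ?thesis by simp
  qed
  then show "\<exists>N0. \<forall>N\<ge>N0. norm (square_integral (deviation T \<phi> N) - 0) < e"
    by (intro exI[of _ N0]) (simp add: abs_of_nonneg)
qed

lemma square_integral_dominated:
  assumes "circle_L2 \<phi>" "\<And>m. circle_L2 (\<psi> m)" "integrable circle_measure g"
    and "\<And>m w. norm w = 1 \<Longrightarrow> (norm (\<phi> w - \<psi> m w))\<^sup>2 \<le> g w"
    and "\<And>w. norm w = 1 \<Longrightarrow> (\<lambda>m. \<psi> m w) \<longlonglongrightarrow> \<phi> w"
  shows "(\<lambda>m. square_integral (\<lambda>x. \<phi> x - \<psi> m x)) \<longlonglongrightarrow> 0"
proof -
  have "(\<lambda>m. square_integral (\<lambda>x. \<phi> x - \<psi> m x)) \<longlonglongrightarrow> (LINT x|circle_measure. 0)"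
  proof (rule integral_dominated_convergence[where w=g])
    show "(\<lambda>x. (norm (\<phi> x - \<psi> m x))\<^sup>2) \<in> borel_measurable circle_measure" for m
      using in_L2D(2)[OF in_L2_diff[OF assms(1) assms(2)[of m]]] by (rule borel_measurable_integrable)
    show "AE x in circle_measure. (\<lambda>m. (norm (\<phi> x - \<psi> m x))\<^sup>2) \<longlonglongrightarrow> 0"
    proof (rule AE_I2)
      fix x assume "x \<in> space circle_measure"
      then have "(\<lambda>m. \<psi> m x) \<longlonglongrightarrow> \<phi> x" using assms(5) by simp
      from tendsto_power[OF tendsto_norm[OF tendsto_diff[OF tendsto_const[of "\<phi> x"] this]], of 2]
      show "(\<lambda>m. (norm (\<phi> x - \<psi> m x))\<^sup>2) \<longlonglongrightarrow> 0" by simp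
    qed
  qed (use assms in auto)
  then show ?thesis by simp
qed

text \<open>Two density steps: \<open>circle_class\<close> leads from monomials to bounded Borel
  functions, and truncation by modulus, dominated by the square of \<open>\<phi>\<close>, leads from
  those to L^2.\<close>

lemma ergodic_of_monomials:
  assumes mono: "\<And>j k. (\<lambda>N. square_integral (deviation T (\<lambda>w. w ^ j * cnj w ^ k) N)) \<longlonglongrightarrow> 0"
  shows "ergodic_seq circle_measure T"
proof -
  let ?P = "\<lambda>\<phi>. (\<lambda>N. square_integral (deviation T \<phi> N)) \<longlonglongrightarrow> 0"
  interpret circle_class ?P
  proof
    show "?P (\<lambda>w. w ^ j * cnj w ^ k)" for j k by (rule mono)
  next
    fix f g assume fg: "bounded_borel f" "bounded_borel g" "?P f" "?P g"
    show "?P (\<lambda>w. f w + g w)"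
    proof (rule tendsto_sandwich[OF _ _ tendsto_const])
      show "(\<lambda>N. 2 * square_integral (deviation T f N) + 2 * square_integral (deviation T g N)) \<longlonglongrightarrow> 0"
        using tendsto_add[OF tendsto_mult_left[OF fg(3), of 2] tendsto_mult_left[OF fg(4), of 2]] by simp
    qed (use fg square_integral_deviation_add_le in_L2_bounded_borel in auto)
  next
    fix c f assume f: "bounded_borel f" "?P f"
    have "deviation T (\<lambda>w. c * f w) N x = c * deviation T f N x" for N x
      by (simp add: deviation_def sum_distrib_left[symmetric] right_diff_distrib)
    then show "?P (\<lambda>w. c * f w)"
      using tendsto_mult_left[OF f(2), of "(norm c)\<^sup>2"] by (simp add: norm_mult power_mult_distrib)
  next
    fix u :: "nat \<Rightarrow> complex \<Rightarrow> complex" and f A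
    assume u: "\<And>m. bounded_borel (u m)" "bounded_borel f" "\<And>m. ?P (u m)"
      "\<And>m w. norm w = 1 \<Longrightarrow> norm (u m w) \<le> A" "\<And>w. norm w = 1 \<Longrightarrow> (\<lambda>m. u m w) \<longlonglongrightarrow> f w"
    show "?P f"
    proof (rule deviation_limit[OF _ _ u(3)])
      show "(\<lambda>m. square_integral (\<lambda>x. f x - u m x)) \<longlonglongrightarrow> 0"
      proof (rule square_integral_dominated)
        fix m w assume w: "norm (w::complex) = 1"
        have "norm (f w) \<le> A"
          by (rule LIMSEQ_le_const2[OF tendsto_norm[OF u(5)[OF w]]]) (use u(4) w in auto)
        then have "norm (f w - u m w) \<le> 2 * A"
          using norm_triangle_ineq4[of "f w" "u m w"] u(4)[OF w, of m] by simp
        then show "(norm (f w - u m w))\<^sup>2 \<le> (2 * A)\<^sup>2" by (intro power_mono) auto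
      qed (use u in_L2_bounded_borel in auto)
    qed (use u in_L2_bounded_borel in auto)
  qed
  have "?P \<phi>" if \<phi>: "circle_L2 \<phi>" for \<phi>
  proof -
    define \<psi> where "\<psi> m w = (if norm (\<phi> w) \<le> real m then \<phi> w else 0)" for m w
    have bb: "bounded_borel (\<psi> m)" for m
    proof (rule bounded_borelI)
      show "\<psi> m \<in> borel_measurable circle_measure"
        unfolding \<psi>_def using in_L2D(1)[OF \<phi>] by measurable
      show "norm (\<psi> m w) \<le> real m" for w by (simp add: \<psi>_def)
    qed
    show ?thesis
    proof (rule deviation_limit[OF \<phi> in_L2_bounded_borel[OF bb] bounded_borel[OF bb]])
      show "(\<lambda>m. square_integral (\<lambda>x. \<phi> x - \<psi> m x)) \<longlonglongrightarrow> 0"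
      proof (rule square_integral_dominated[OF \<phi> in_L2_bounded_borel[OF bb] in_L2D(2)[OF \<phi>]])
        show "(norm (\<phi> w - \<psi> m w))\<^sup>2 \<le> (norm (\<phi> w))\<^sup>2" for m w by (simp add: \<psi>_def)
        fix w
        have "\<forall>\<^sub>F m in sequentially. norm (\<phi> w) \<le> real m" by real_asymp
        then have "\<forall>\<^sub>F m in sequentially. \<psi> m w = \<phi> w" by eventually_elim (simp add: \<psi>_def)
        then show "(\<lambda>m. \<psi> m w) \<longlonglongrightarrow> \<phi> w" by (rule tendsto_eventually)
      qed
    qed
  qed
  then show ?thesis using preserving by (simp add: ergodic_seq_iff)
qed

lemma T_measurable: "n \<ge> 1 \<Longrightarrow> T n \<in> circle_measure \<rightarrow>\<^sub>M circle_measure"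
  using preserving by (simp add: measure_preserving_map_def)

lemma ergodic_of_powers:
  assumes pow: "\<And>i. i \<ge> 1 \<Longrightarrow> (\<lambda>N. square_integral (\<lambda>x. (\<Sum>n=1..N. T n x ^ i) / of_nat N)) \<longlonglongrightarrow> 0"
  shows "ergodic_seq circle_measure T"
proof (rule ergodic_of_monomials)
  fix j k :: nat
  have c: "(LINT w|circle_measure. w ^ j * cnj w ^ k) = (if j = k then 1 else 0)"
  proof -
    have "(LINT w|circle_measure. w ^ j * cnj w ^ k)
        = (LINT w|circle_measure. boundary_map id w ^ j * cnj (boundary_map id w) ^ k)"
      by (rule Bochner_Integration.integral_cong) (auto simp: boundary_map_id)
    then show ?thesis using integral_boundary_map_monomial[OF inner_function_id] by simp
  qed
  have Tn: "norm (T n w) = 1" if "n \<ge> 1" "norm w = 1" for n w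
    using norm_circle_map[OF T_measurable] that by blast
  let ?\<phi> = "\<lambda>w::complex. w ^ j * cnj w ^ k"
  have sum: "(\<Sum>n=1..N. ?\<phi> (T n w)) = (\<Sum>n=1..N. if k \<le> j then T n w ^ (j - k) else cnj (T n w ^ (k - j)))"
    if "norm w = 1" for w N
    by (rule sum.cong) (use Tn that in \<open>auto simp: circle_monomial\<close>)
  consider "j = k" | "k < j" | "j < k" by linarith
  then show "(\<lambda>N. square_integral (deviation T ?\<phi> N)) \<longlonglongrightarrow> 0"
  proof cases
    case 1
    \<comment> \<open>At \<open>N = 0\<close> the quotient is 0 by convention and the deviation is
      -1, hence the restriction on \<open>N\<close>.\<close>
    have "square_integral (deviation T ?\<phi> N) = 0" if "N \<ge> 1" for N
    proof -
      have "square_integral (deviation T ?\<phi> N) = (LINT x|circle_measure. 0)"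
        by (rule Bochner_Integration.integral_cong)
           (use that 1 sum c in \<open>auto simp: deviation_def\<close>)
      then show ?thesis by simp
    qed
    then show ?thesis
      by (intro tendsto_eventually) (auto simp: eventually_sequentially)
  next
    case 2
    have "square_integral (deviation T ?\<phi> N) = square_integral (\<lambda>x. (\<Sum>n=1..N. T n x ^ (j - k)) / of_nat N)" for N
      by (rule Bochner_Integration.integral_cong) (use 2 sum c in \<open>auto simp: deviation_def\<close>)
    then show ?thesis using pow[of "j - k"] 2 by simp
  next
    case 3
    have "(\<Sum>n=1..N. cnj (T n x ^ (k - j))) / of_nat N = cnj ((\<Sum>n=1..N. T n x ^ (k - j)) / of_nat N)" for N x
      by simp
    then have "norm ((\<Sum>n=1..N. cnj (T n x ^ (k - j))) / of_nat N) = norm ((\<Sum>n=1..N. T n x ^ (k - j)) / of_nat N)" for N x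
      by (simp only: complex_mod_cnj)
    then have "square_integral (deviation T ?\<phi> N) = square_integral (\<lambda>x. (\<Sum>n=1..N. T n x ^ (k - j)) / of_nat N)" for N
      by (intro Bochner_Integration.integral_cong) (use 3 sum c in \<open>auto simp: deviation_def simp del: complex_cnj_power\<close>)
    then show ?thesis using pow[of "k - j"] 3 by simp
  qed
qed

text \<open>Adding the term \<open>Suc N\<close> adds 1 from its own modulus and twice the real part
  of \<open>N\<close> correlations. If \<open>i \<le> Suc N\<close> these total at most 1; otherwise
  each is at most 1 and there are fewer than \<open>i\<close> of them. Each step thus costs at most
  \<open>1 + 2 * (1 + i)\<close>, which is linear growth.\<close>

lemma power_sums_bound:
  assumes corr: "\<And>k l. 1 \<le> k \<Longrightarrow> k < l \<Longrightarrow> i \<le> l \<Longrightarrow>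
    norm (LINT w|circle_measure. T l w ^ i * cnj (T k w ^ i)) \<le> 1 / real l"
  shows "square_integral (\<lambda>x. \<Sum>n=1..N. T n x ^ i) \<le> real N * (2 * real i + 3)"
proof (induction N)
  case (Suc N)
  let ?S = "\<lambda>x. \<Sum>n=1..N. T n x ^ i" and ?t = "\<lambda>x. T (Suc N) x ^ i"
  let ?c = "\<lambda>k. LINT w|circle_measure. ?t w * cnj (T k w ^ i)"
  have Tn: "norm (T n w) = 1" if "n \<ge> 1" "norm w = 1" for n w
    using norm_circle_map[OF T_measurable] that by blast
  have bb: "bounded_borel (\<lambda>w. T n w ^ i)" if "n \<ge> 1" for n
    by (intro bounded_borel_power bounded_borel_circle_map T_measurable that)
  have bS: "bounded_borel ?S" by (intro bounded_borel_sum bb) auto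
  have bt: "bounded_borel (\<lambda>x. ?t x * cnj (?S x))"
    by (intro bounded_borel_mult bb bounded_borel_cnj bS) auto
  have integral_expand: "(LINT x|circle_measure. a x + 1 + 2 * Re (p x))
      = (LINT x|circle_measure. a x) + 1 + 2 * Re (LINT x|circle_measure. p x)"
    if "integrable circle_measure a" "integrable circle_measure p" for a :: "complex \<Rightarrow> real" and p :: "complex \<Rightarrow> complex"
    using that circle.prob_space by simp
  have "square_integral (\<lambda>x. \<Sum>n=1..Suc N. T n x ^ i)
      = (LINT x|circle_measure. (norm (?S x))\<^sup>2 + 1 + 2 * Re (?t x * cnj (?S x)))"
  proof (rule Bochner_Integration.integral_cong[OF refl])
    fix x assume "x \<in> space circle_measure"
    then have "norm (?t x) = 1" using Tn[of "Suc N" x] by (simp add: norm_power)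
    then show "(norm (\<Sum>n=1..Suc N. T n x ^ i))\<^sup>2 = (norm (?S x))\<^sup>2 + 1 + 2 * Re (?t x * cnj (?S x))"
      using norm_add_square[of "?t x" "?S x"] by (simp add: add.commute)
  qed
  also have "\<dots> = square_integral ?S + 1 + 2 * Re (LINT x|circle_measure. ?t x * cnj (?S x))"
    by (rule integral_expand[OF in_L2D(2)[OF in_L2_bounded_borel[OF bS]] bounded_borel_integrable[OF bt]])
  also have "(LINT x|circle_measure. ?t x * cnj (?S x)) = (\<Sum>k=1..N. ?c k)"
  proof -
    have "(LINT x|circle_measure. ?t x * cnj (?S x)) = (LINT x|circle_measure. (\<Sum>k=1..N. ?t x * cnj (T k x ^ i)))"
      by (simp add: sum_distrib_left)
    also have "\<dots> = (\<Sum>k=1..N. ?c k)"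
      by (intro Bochner_Integration.integral_sum bounded_borel_integrable bounded_borel_mult bounded_borel_cnj bb) auto
    finally show ?thesis .
  qed
  also have "Re (\<Sum>k=1..N. ?c k) \<le> 1 + real i"
  proof -
    have "Re (\<Sum>k=1..N. ?c k) \<le> norm (\<Sum>k=1..N. ?c k)" by (rule complex_Re_le_cmod)
    also have "\<dots> \<le> (\<Sum>k=1..N. norm (?c k))" by (rule norm_sum)
    also have "\<dots> \<le> 1 + real i"
    proof (cases "i \<le> Suc N")
      case True
      have "(\<Sum>k=1..N. norm (?c k)) \<le> (\<Sum>k=1..N. 1 / real (Suc N))"
        by (intro sum_mono corr True) auto
      also have "\<dots> \<le> 1" by simp
      finally show ?thesis by simp
    next
      case False
      have "norm (?c k) \<le> 1" if "k \<in> {1..N}" for k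
      proof -
        have "norm (?c k) \<le> (LINT x|circle_measure. 1)"
        proof (rule norm_circle_integral_le)
          show "bounded_borel (\<lambda>w. ?t w * cnj (T k w ^ i))"
            using that by (intro bounded_borel_mult bounded_borel_cnj bb) auto
          show "norm (?t w * cnj (T k w ^ i)) \<le> 1" if "norm w = 1" for w
            using Tn[of "Suc N" w] Tn[of k w] that \<open>k \<in> {1..N}\<close> by (simp add: norm_mult norm_power)
        qed simp
        then show ?thesis using circle.prob_space by simp
      qed
      then have "(\<Sum>k=1..N. norm (?c k)) \<le> (\<Sum>k=1..N. 1)" by (intro sum_mono) auto
      then show ?thesis using False by simp
    qed
    finally show ?thesis .
  qed
  finally show ?case using Suc.IH by (simp add: algebra_simps)
qed simp

lemma ergodic_of_correlations:
  assumes corr: "\<And>i k l. 1 \<le> k \<Longrightarrow> k < l \<Longrightarrow> 1 \<le> i \<Longrightarrow> i \<le> l \<Longrightarrow>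
    norm (LINT w|circle_measure. T l w ^ i * cnj (T k w ^ i)) \<le> 1 / real l"
  shows "ergodic_seq circle_measure T"
proof (rule ergodic_of_powers)
  fix i :: nat assume i: "1 \<le> i"
  let ?S = "\<lambda>N x. \<Sum>n=1..N. T n x ^ i"
  show "(\<lambda>N. square_integral (\<lambda>x. ?S N x / of_nat N)) \<longlonglongrightarrow> 0"
  proof (rule tendsto_sandwich[OF _ _ tendsto_const])
    have "square_integral (\<lambda>x. ?S N x / of_nat N) \<le> (2 * real i + 3) / real N" for N
    proof -
      have "square_integral (\<lambda>x. ?S N x / of_nat N) = square_integral (?S N) / (real N)\<^sup>2"
        by (simp add: norm_divide power_divide)
      also have "\<dots> \<le> real N * (2 * real i + 3) / (real N)\<^sup>2"
        by (intro divide_right_mono power_sums_bound corr) (use i in auto)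
      also have "\<dots> = (2 * real i + 3) / real N" by (simp add: power2_eq_square)
      finally show ?thesis .
    qed
    then show "\<forall>\<^sub>F N in sequentially. square_integral (\<lambda>x. ?S N x / of_nat N) \<le> (2 * real i + 3) / real N"
      by simp
    show "(\<lambda>N. (2 * real i + 3) / real N) \<longlonglongrightarrow> 0" by real_asymp
  qed simp
qed

end

section \<open>Contracting sequences\<close>

lemma inner_function_forward_comp:
  assumes "\<And>n. n \<ge> 1 \<Longrightarrow> inner_function (g n)" "\<And>n. n \<ge> 1 \<Longrightarrow> g n 0 = 0"
  shows "inner_function (forward_comp g n) \<and> forward_comp g n 0 = 0"
proof (induction n)
  case 0
  show ?case using inner_function_id by (simp add: id_def)
next
  case (Suc n)
  have "inner_function (g (Suc n) \<circ> forward_comp g n)"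
    by (rule inner_function_comp) (use Suc assms(1) in auto)
  then show ?case using Suc assms(2)[of "Suc n"] by (simp add: o_def)
qed

lemma norm_forward_comp_antimono:
  assumes "\<And>n. n \<ge> 1 \<Longrightarrow> inner_function (g n)" "\<And>n. n \<ge> 1 \<Longrightarrow> g n 0 = 0"
    and z: "norm z < 1" and mn: "m \<le> n"
  shows "norm (forward_comp g n z) \<le> norm (forward_comp g m z)"
  using mn
proof (induction n rule: dec_induct)
  case (step n)
  have "norm (forward_comp g n z) < 1"
    using inner_functionD(2) inner_function_forward_comp[of g, OF assms(1,2)] z by blast
  then have "norm (g (Suc n) (forward_comp g n z)) \<le> norm (forward_comp g n z)"
    by (intro Schwarz_Lemma(1)) (use inner_functionD(1,2) assms(1,2) in auto)
  then show ?case using step.IH by simp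
qed simp

section \<open>From contraction to mixing\<close>

lemma mixing_subsequence_of_weak_convergence:
  fixes T :: "nat \<Rightarrow> complex \<Rightarrow> complex"
  assumes T: "\<And>n. measure_preserving_map circle_measure (T n)"
    and weak: "\<And>i K. 1 \<le> i \<Longrightarrow> bounded_borel K \<Longrightarrow> (\<lambda>n. LINT w|circle_measure. T n w ^ i * K w) \<longlonglongrightarrow> 0"
  shows "\<exists>s. strict_mono s \<and> mixing_seq circle_measure (T \<circ> s)"
proof -
  let ?c = "\<lambda>i m n. LINT w|circle_measure. T n w ^ i * cnj (T m w ^ i)"
  have Tm: "T n \<in> circle_measure \<rightarrow>\<^sub>M circle_measure" for n
    using T by (simp add: measure_preserving_map_def)
  have bb: "bounded_borel (\<lambda>w. cnj (T m w ^ i))" for m i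
    by (rule bounded_borel_cnj[OF bounded_borel_power[OF bounded_borel_circle_map[OF Tm]]])
  \<comment> \<open>The requirement covers all \<open>m \<le> p\<close>, not only the indices
    already chosen, so the recursive choice has to remember just the last index
    \<open>p\<close>.\<close>
  have "\<exists>q>p. \<forall>m\<in>{..p}. \<forall>i\<in>{1..Suc l}. norm (?c i m q) < 1 / real (Suc l)" for p l
  proof -
    have "\<forall>\<^sub>F q in sequentially. norm (?c i m q) < 1 / real (Suc l)" if "1 \<le> i" for i m
      by (rule order_tendstoD(2)[OF tendsto_norm_zero[OF weak[OF that]]])
         (use bb in simp_all)
    then have "\<forall>\<^sub>F q in sequentially. q > p \<and> (\<forall>m\<in>{..p}. \<forall>i\<in>{1..Suc l}. norm (?c i m q) < 1 / real (Suc l))"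
      by (intro eventually_conj eventually_gt_at_top eventually_ball_finite ballI) auto
    then show ?thesis by (auto dest!: eventually_happens)
  qed
  then obtain s where s: "\<And>l. s l < s (Suc l) \<and> (\<forall>m\<in>{..s l}. \<forall>i\<in>{1..Suc l}. norm (?c i m (s (Suc l))) < 1 / real (Suc l))"
    using dependent_nat_choice[of "\<lambda>_ _. True" "\<lambda>l p q. p < q \<and> (\<forall>m\<in>{..p}. \<forall>i\<in>{1..Suc l}. norm (?c i m q) < 1 / real (Suc l))"]
    by auto
  then have mono: "strict_mono s" by (simp add: strict_mono_Suc_iff)
  have corr: "norm (?c i (s k) (s l)) < 1 / real l" if kl: "k < l" "1 \<le> i" "i \<le> l" for k l i
  proof -
    obtain l' where l': "l = Suc l'" using kl(1) by (cases l) auto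
    then have "s k \<le> s l'" using kl(1) mono by (simp add: strict_mono_less_eq)
    then show ?thesis using s[of l'] kl unfolding l' by auto
  qed
  have "mixing_seq circle_measure (T \<circ> s)"
    unfolding mixing_seq_def
  proof (intro allI impI)
    fix t :: "nat \<Rightarrow> nat" assume t: "strict_mono t"
    interpret preserving_sequence "T \<circ> s \<circ> t"
      by unfold_locales (simp add: T)
    show "ergodic_seq circle_measure (T \<circ> s \<circ> t)"
    proof (rule ergodic_of_correlations)
      fix i k l :: nat assume kl: "1 \<le> k" "k < l" "1 \<le> i" "i \<le> l"
      \<comment> \<open>This is the inheritance by further subsequences: at position
        \<open>l\<close> the original bound is \<open>1 / t l\<close> and covers all powers up to
        \<open>t l\<close>.\<close>
      have "l \<le> t l" using t by (rule strict_mono_imp_increasing)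
      moreover have "t k < t l" using t kl(2) by (rule strict_monoD)
      ultimately have "norm (?c i (s (t k)) (s (t l))) < 1 / real (t l)"
        using kl by (intro corr) auto
      also have "\<dots> \<le> 1 / real l" using \<open>l \<le> t l\<close> kl by (intro divide_left_mono) auto
      finally show "norm (LINT w|circle_measure. (T \<circ> s \<circ> t) l w ^ i * cnj ((T \<circ> s \<circ> t) k w ^ i)) \<le> 1 / real l"
        by simp
    qed
  qed
  with mono show ?thesis by blast
qed

lemma boundary_maps_weak_convergence:
  assumes G: "\<And>n. inner_function (G n)"
    and lim: "\<And>z. norm z < 1 \<Longrightarrow> (\<lambda>n. G n z) \<longlonglongrightarrow> 0"
    and i: "1 \<le> i" and K: "bounded_borel K"
  shows "(\<lambda>n. LINT w|circle_measure. boundary_map (G n) w ^ i * K w) \<longlonglongrightarrow> 0"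
proof -
  note D = inner_functionD[OF G]
  have "(\<lambda>n. LINT w|circle_measure. boundary_map (G n) w ^ i * K w) \<longlonglongrightarrow> (LINT w|circle_measure. 0 * K w)"
  proof (rule weak_convergence_circle[where B=1, OF _ _ _ _ K])
    have m: "boundary_map (G n) \<in> circle_measure \<rightarrow>\<^sub>M circle_measure" for n
      by (rule boundary_map_measurable[OF D(1)])
    show "bounded_borel (\<lambda>w. boundary_map (G n) w ^ i)" for n
      by (intro bounded_borel_power bounded_borel_circle_map m)
    show "norm (boundary_map (G n) w ^ i) \<le> 1" if "norm w = 1" for n w
      using norm_circle_map[OF m that] by (simp add: norm_power)
    fix j k
    have "(\<lambda>n. hcoef (\<lambda>z. G n z ^ i) j k) \<longlonglongrightarrow> hcoef (\<lambda>z. 0) j k"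
    proof (rule hcoef_tendsto[where B=1])
      show "(\<lambda>z. G n z ^ i) holomorphic_on ball 0 1" for n by (intro holomorphic_intros D)
      show "norm (G n z ^ i) \<le> 1" if "norm z < 1" for n z
        using D(2)[OF that, of n] by (simp add: norm_power power_le_one)
      show "(\<lambda>n. G n z ^ i) \<longlonglongrightarrow> 0" if "norm z < 1" for z
        using tendsto_power[OF lim[OF that], of i] i by (simp add: zero_power)
    qed simp
    moreover have "hcoef (\<lambda>z. 0) j k = 0" by (simp add: hcoef_def higher_deriv_const)
    ultimately show "(\<lambda>n. LINT w|circle_measure. boundary_map (G n) w ^ i * (w ^ j * cnj w ^ k))
        \<longlonglongrightarrow> (LINT w|circle_measure. 0 * (w ^ j * cnj w ^ k))"
      using boundary_function_power[OF G, where n=i] by (simp add: boundary_function_def)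
  qed simp
  then show ?thesis by simp
qed

section \<open>From mixing to contraction\<close>

lemma Cauchy_formula_boundary_map:
  assumes F: "inner_function F" and z: "norm z < 1"
  shows "bounded_borel (\<lambda>w. w / (w - z))"
    and "F z = (LINT w|circle_measure. boundary_map F w * (w / (w - z)))"
proof -
  note D = inner_functionD[OF F]
  have ne: "w \<noteq> z" if "norm w = 1" for w using z that by auto
  show K: "bounded_borel (\<lambda>w. w / (w - z))"
    by (rule continuous_on_bounded_borel) (use ne in \<open>auto intro!: continuous_intros\<close>)
  have cont: "continuous_on (ball 0 1) F" by (rule holomorphic_on_imp_continuous_on[OF D(1)])
  \<comment> \<open>Cauchy's formula is first applied to dilates, which are continuous on the closed
    disc; the weak limit is then taken against the fixed bounded kernel
    \<open>w / (w - z)\<close>.\<close>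
  have eq: "F (of_real r * z) = (LINT w|circle_measure. F (of_real r * w) * (w / (w - z)))" if r: "0 < r" "r < 1" for r
  proof -
    let ?F = "\<lambda>u. F (of_real r * u)"
    have im: "norm (of_real r * u) < 1" if "norm u \<le> 1" for u :: complex
    proof -
      have "r * norm u \<le> r * 1" using that r by (intro mult_left_mono) auto
      then have "r * norm u < 1" using r by linarith
      then show ?thesis using r by (simp add: norm_mult)
    qed
    have c: "continuous_on (cball 0 1) ?F"
      by (intro continuous_on_compose2[OF cont] continuous_intros) (use im in auto)
    have h: "?F holomorphic_on ball 0 1"
      by (rule holomorphic_on_compose_gen[of "\<lambda>u. of_real r * u" _ F "ball 0 1", unfolded o_def])
         (use D(1) im in \<open>auto intro!: holomorphic_intros simp: less_imp_le\<close>)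
    have "((\<lambda>u. ?F u / (u - z)) has_contour_integral (2 * of_real pi * \<i> * ?F z)) (circlepath 0 1)"
      by (rule Cauchy_integral_circlepath[OF c h]) (use z in simp)
    moreover have "continuous_on (sphere 0 1) (\<lambda>u. ?F u / (u - z))"
      using ne by (intro continuous_intros continuous_on_subset[OF c]) auto
    ultimately have "(LINT w|circle_measure. ?F (of_real 1 * w) / (of_real 1 * w - z) * (of_real 1 * w)) = ?F z"
      by (subst contour_integral_circle_measure) auto
    then show ?thesis by simp
  qed
  have M: "boundary_function F (boundary_map F)"
    using boundary_function_power[OF F, of 1] by simp
  have "(\<lambda>n. F (of_real (radius n) * z)) \<longlonglongrightarrow> (LINT w|circle_measure. boundary_map F w * (w / (w - z)))"
    unfolding eq[OF radius]
    by (rule boundary_function_weak_limit[OF D(1) less_imp_le[OF D(2)] M K])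
  moreover have "(\<lambda>n. F (of_real (radius n) * z)) \<longlonglongrightarrow> F (of_real 1 * z)"
  proof (rule isCont_tendsto_compose[of _ F])
    show "isCont F (of_real 1 * z)" using cont z by (simp add: continuous_on_eq_continuous_at)
  qed (intro tendsto_intros radius_tendsto)
  ultimately show "F z = (LINT w|circle_measure. boundary_map F w * (w / (w - z)))"
    by (simp add: LIMSEQ_unique)
qed

text \<open>Cauchy's kernel makes evaluation at \<open>z\<close> a linear functional of the boundary
  map, bounded in L^1 and hence in L^2, so L^2 convergence of the averages of boundary maps forces
  convergence at \<open>z\<close>. The limit is the mean of \<open>w\<close>, which is 0.\<close>

lemma averages_tendsto_zero_of_ergodic:
  assumes G: "\<And>n. inner_function (G n)"
    and erg: "ergodic_seq circle_measure (\<lambda>n. boundary_map (G n))" and z: "norm z < 1"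
  shows "(\<lambda>N. (\<Sum>n=1..N. G n z) / of_nat N) \<longlonglongrightarrow> 0"
proof -
  let ?T = "\<lambda>n. boundary_map (G n)"
  let ?A = "\<lambda>N w. (\<Sum>n=1..N. ?T n w) / of_nat N"
  have bT: "bounded_borel (?T n)" for n
    by (intro bounded_borel_circle_map boundary_map_measurable inner_functionD(1) G)
  have "bounded_borel (\<lambda>w. w)" using bounded_borel_monomial[of 1 0] by simp
  moreover have "(LINT w|circle_measure. w) = 0"
  proof -
    have "(LINT w|circle_measure. w) = (LINT w|circle_measure. boundary_map id w ^ 1 * cnj (boundary_map id w) ^ 0)"
      by (rule Bochner_Integration.integral_cong) (auto simp: boundary_map_id)
    then show ?thesis using integral_boundary_map_monomial[OF inner_function_id, of 1 0] by simp
  qed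
  ultimately have sq: "(\<lambda>N. square_integral (?A N)) \<longlonglongrightarrow> 0"
    using erg unfolding ergodic_seq_iff deviation_def
    by (auto dest!: spec[of _ "\<lambda>w. w"] simp: in_L2_bounded_borel)
  have bA: "bounded_borel (?A N)" for N
    using bounded_borel_mult[OF bounded_borel_const[of "1 / of_nat N"] bounded_borel_sum[of "{1..N}" ?T]] bT by simp
  obtain C where C: "0 < C" "\<And>w. norm w = 1 \<Longrightarrow> norm (w / (w - z)) \<le> C"
    using bounded_borel_bound[OF Cauchy_formula_boundary_map(1)[OF G z]] by blast
  note K = Cauchy_formula_boundary_map(1)[OF G z]
  have "norm ((\<Sum>n=1..N. G n z) / of_nat N) \<le> C * sqrt (square_integral (?A N))" for N
  proof -
    have "(\<Sum>n=1..N. G n z) / of_nat N = (LINT w|circle_measure. (\<Sum>n=1..N. ?T n w * (w / (w - z)))) / of_nat N"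
    proof -
      have "(LINT w|circle_measure. (\<Sum>n=1..N. ?T n w * (w / (w - z)))) = (\<Sum>n=1..N. LINT w|circle_measure. ?T n w * (w / (w - z)))"
        by (intro Bochner_Integration.integral_sum bounded_borel_integrable bounded_borel_mult bT K)
      then show ?thesis using Cauchy_formula_boundary_map(2)[OF G z] by simp
    qed
    also have "\<dots> = (LINT w|circle_measure. ?A N w * (w / (w - z)))"
    proof -
      have "?A N w * (w / (w - z)) = (\<Sum>n=1..N. ?T n w * (w / (w - z))) / of_nat N" for w
        by (simp only: sum_distrib_right times_divide_eq_left)
      then show ?thesis by (simp only: integral_divide_zero)
    qed
    also have "norm \<dots> \<le> (LINT w|circle_measure. C * norm (?A N w))"
    proof (rule norm_circle_integral_le)
      show "norm (?A N w * (w / (w - z))) \<le> C * norm (?A N w)" if "norm w = 1" for w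
        using mult_left_mono[OF C(2)[OF that], of "norm (?A N w)"] by (simp only: norm_mult norm_ge_zero) (simp add: mult.commute)
      show "integrable circle_measure (\<lambda>w. C * norm (?A N w))"
        by (intro Bochner_Integration.integrable_mult_right integrable_norm bounded_borel_integrable bA)
    qed (intro bounded_borel_mult bA K)
    also have "\<dots> = C * (LINT w|circle_measure. norm (?A N w))" by simp
    also have "\<dots> \<le> C * sqrt (square_integral (?A N))"
      using C(1) norm_integral_square_le(1)[OF in_L2_bounded_borel[OF bA[of N]]]
      by (intro mult_left_mono real_le_rsqrt) auto
    finally show ?thesis .
  qed
  moreover have "(\<lambda>N. C * sqrt (square_integral (?A N))) \<longlonglongrightarrow> 0"
    using tendsto_mult_left[OF tendsto_real_sqrt[OF sq], of C] by simp
  ultimately show ?thesis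
    by (auto intro: Lim_null_comparison[where g="\<lambda>N. C * sqrt (square_integral (?A N))"])
qed

text \<open>Mixing speaks only of indices in the range of \<open>s\<close>; by monotonicity of the
  norms, failure of convergence gives a lower bound \<open>d\<close> at every index, in particular
  along \<open>s\<close>. Convergence to some nonzero \<open>a\<close> along a further subsequence,
  still ergodic by mixing, keeps the averages away from 0 in the direction of
  \<open>a\<close>.\<close>

lemma pointwise_limit_of_mixing_subsequence:
  assumes G: "\<And>n. inner_function (G n)"
    and s: "strict_mono s" and mix: "mixing_seq circle_measure ((\<lambda>n. boundary_map (G n)) \<circ> s)"
    and z: "norm z < 1" and anti: "\<And>m n. m \<le> n \<Longrightarrow> norm (G n z) \<le> norm (G m z)"
  shows "(\<lambda>n. G n z) \<longlonglongrightarrow> 0"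
proof (rule ccontr)
  assume not: "\<not> ?thesis"
  have "\<exists>d>0. \<forall>n. d \<le> norm (G n z)"
  proof (rule ccontr)
    assume neg: "\<not> (\<exists>d>0. \<forall>n. d \<le> norm (G n z))"
    have "(\<lambda>n. G n z) \<longlonglongrightarrow> 0"
    proof (rule LIMSEQ_I)
      fix e :: real assume "0 < e"
      then obtain m where "norm (G m z) < e" using neg by (auto simp: not_le)
      then show "\<exists>N. \<forall>n\<ge>N. norm (G n z - 0) < e"
        using anti[of m] by (intro exI[of _ m]) (auto intro: le_less_trans)
    qed
    with not show False by contradiction
  qed
  then obtain d where d: "0 < d" "\<And>n. d \<le> norm (G n z)" by blast
  have "\<forall>n. G (s n) z \<in> cball 0 1"
    using inner_functionD(2)[OF G z] by (simp add: less_imp_le)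
  then obtain a r where r: "strict_mono r" "((\<lambda>n. G (s n) z) \<circ> r) \<longlonglongrightarrow> a"
    using compact_cball[of "0::complex" 1] unfolding compact_def by metis
  have "d \<le> norm a"
    by (rule LIMSEQ_le_const[OF tendsto_norm[OF r(2)]]) (use d(2) in auto)
  then have a: "0 < (norm a)\<^sup>2" using d(1) by auto
  have "(\<lambda>n. Re (cnj a * ((\<lambda>n. G (s n) z) \<circ> r) n)) \<longlonglongrightarrow> Re (cnj a * a)"
    by (intro tendsto_intros r(2))
  moreover have "Re (cnj a * a) = (norm a)\<^sup>2" unfolding cmod_power2 by (simp add: power2_eq_square)
  ultimately have "\<forall>\<^sub>F n in sequentially. (norm a)\<^sup>2 / 2 < Re (cnj a * ((\<lambda>n. G (s n) z) \<circ> r) n)"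
    using a by (intro order_tendstoD) auto
  then obtain n0 where n0: "\<And>n. n \<ge> n0 \<Longrightarrow> (norm a)\<^sup>2 / 2 < Re (cnj a * G (s (r n)) z)"
    by (auto simp: eventually_sequentially)
  \<comment> \<open>Discarding the first \<open>n0\<close> terms makes the lower bound valid for
    every summand, so each average inherits it directly.\<close>
  define t where "t n = r (n + n0)" for n
  have "strict_mono t" using r(1) by (auto simp: strict_mono_def t_def)
  then have "ergodic_seq circle_measure (\<lambda>n. boundary_map (G (s (t n))))"
    using mix by (simp add: mixing_seq_def o_def)
  from averages_tendsto_zero_of_ergodic[OF G this z]
  have "(\<lambda>N. (\<Sum>n=1..N. G (s (t n)) z) / of_nat N) \<longlonglongrightarrow> 0" .
  then have "(\<lambda>N. Re (cnj a * ((\<Sum>n=1..N. G (s (t n)) z) / of_nat N))) \<longlonglongrightarrow> Re (cnj a * 0)"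
    by (intro tendsto_intros)
  then have "\<forall>\<^sub>F N in sequentially. Re (cnj a * ((\<Sum>n=1..N. G (s (t n)) z) / of_nat N)) < (norm a)\<^sup>2 / 2"
    using a by (intro order_tendstoD) auto
  from eventually_happens[OF eventually_conj[OF eventually_ge_at_top[of 1] this]]
  obtain N where N: "N \<ge> 1" "Re (cnj a * ((\<Sum>n=1..N. G (s (t n)) z) / of_nat N)) < (norm a)\<^sup>2 / 2"
    by (auto simp del: Re_divide_of_nat times_divide_eq_right)
  have "real N * ((norm a)\<^sup>2 / 2) = (\<Sum>n=1..N. (norm a)\<^sup>2 / 2)" by simp
  also have "\<dots> \<le> (\<Sum>n=1..N. Re (cnj a * G (s (t n)) z))"
    by (intro sum_mono less_imp_le n0[of "_ + n0", folded t_def]) auto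
  also have "\<dots> = Re (cnj a * (\<Sum>n=1..N. G (s (t n)) z))"
    by (simp only: sum_distrib_left Re_sum)
  finally have "real N * ((norm a)\<^sup>2 / 2) / real N \<le> Re (cnj a * (\<Sum>n=1..N. G (s (t n)) z)) / real N"
    by (rule divide_right_mono) simp
  also have "\<dots> = Re (cnj a * ((\<Sum>n=1..N. G (s (t n)) z) / of_nat N))"
    by (metis Re_divide_of_nat times_divide_eq_right)
  finally show False using N by simp
qed

text \<open>Dini's argument: the sets where the iterate has norm below \<open>e\<close> are open,
  increase with \<open>n\<close> and cover \<open>K\<close>, so finitely many of them suffice and
  the largest index serves all of \<open>K\<close>.\<close>

lemma contracting_of_pointwise:
  assumes cont: "\<And>n. continuous_on (ball 0 1) (forward_comp g n)"
    and anti: "\<And>m n z. norm z < 1 \<Longrightarrow> m \<le> n \<Longrightarrow> norm (forward_comp g n z) \<le> norm (forward_comp g m z)"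
    and lim: "\<And>z. norm z < 1 \<Longrightarrow> (\<lambda>n. forward_comp g n z) \<longlonglongrightarrow> 0"
  shows "contracting g"
  unfolding contracting_def uniform_limit_iff
proof (intro allI impI)
  fix K :: "complex set" and e :: real assume K: "compact K \<and> K \<subseteq> ball 0 1" and e: "0 < e"
  define U where "U n = {z \<in> ball 0 1. forward_comp g n z \<in> ball 0 e}" for n
  have "open (U n)" for n
  proof -
    have "U n = ball 0 1 \<inter> forward_comp g n -` ball 0 e" by (auto simp: U_def)
    then show ?thesis using continuous_open_preimage[OF cont open_ball open_ball] by simp
  qed
  moreover have "K \<subseteq> (\<Union>n\<in>UNIV. U n)"
  proof
    fix z assume "z \<in> K"
    then have z: "norm z < 1" using K by auto
    from order_tendstoD(2)[OF tendsto_norm_zero[OF lim[OF z]] e]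
    obtain n where "norm (forward_comp g n z) < e" by (auto dest!: eventually_happens)
    then show "z \<in> (\<Union>n\<in>UNIV. U n)" using z by (auto simp: U_def)
  qed
  ultimately obtain C where C: "finite C" "K \<subseteq> (\<Union>n\<in>C. U n)"
    using compactE_image[of K UNIV U] K by metis
  show "\<forall>\<^sub>F n in sequentially. \<forall>z\<in>K. dist (forward_comp g n z) 0 < e"
    unfolding eventually_sequentially
  \<comment> \<open>If \<open>K\<close> is empty, \<open>C\<close> may be empty and
    \<open>Max C\<close> unspecified; the claim is then vacuous.\<close>
  proof (intro exI[of _ "Max C"] allI impI ballI)
    fix n z assume n: "Max C \<le> n" and "z \<in> K"
    then obtain m where m: "m \<in> C" "z \<in> U m" using C(2) by auto
    then have "m \<le> n" using n C(1) Max_ge order_trans by blast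
    then have "norm (forward_comp g n z) \<le> norm (forward_comp g m z)"
      using m(2) by (intro anti) (auto simp: U_def)
    also have "\<dots> < e" using m(2) by (simp add: U_def)
    finally show "dist (forward_comp g n z) 0 < e" by simp
  qed
qed

theorem corollary1p5:
  fixes g :: "nat \<Rightarrow> complex \<Rightarrow> complex"
  assumes "\<And>n. n \<ge> 1 \<Longrightarrow> inner_function (g n)"
    and "\<And>n. n \<ge> 1 \<Longrightarrow> g n 0 = 0"
  shows "contracting g \<longleftrightarrow>
    (\<exists>s::nat \<Rightarrow> nat. strict_mono s \<and>
       mixing_seq circle_measure ((\<lambda>n. boundary_map (forward_comp g n)) \<circ> s))"
proof
  note G = inner_function_forward_comp[of g, OF assms, THEN conjunct1]
    and G0 = inner_function_forward_comp[of g, OF assms, THEN conjunct2]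
  show "\<exists>s. strict_mono s \<and> mixing_seq circle_measure ((\<lambda>n. boundary_map (forward_comp g n)) \<circ> s)"
    if "contracting g"
  proof (rule mixing_subsequence_of_weak_convergence)
    \<comment> \<open>Index 0 is included: there the composition is the identity, which is inner and
      fixes 0.\<close>
    show "measure_preserving_map circle_measure (boundary_map (forward_comp g n))" for n
      by (rule boundary_map_measure_preserving[OF G G0])
    have lim: "(\<lambda>n. forward_comp g n z) \<longlonglongrightarrow> 0" if z: "norm z < 1" for z
    proof -
      show ?thesis
        using \<open>contracting g\<close>[unfolded contracting_def, rule_format, of "{z}"] z by simp
    qed
    show "(\<lambda>n. LINT w|circle_measure. boundary_map (forward_comp g n) w ^ i * K w) \<longlonglongrightarrow> 0"
      if "1 \<le> i" "bounded_borel K" for i K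
      by (rule boundary_maps_weak_convergence[OF G lim that])
  qed
  assume "\<exists>s. strict_mono s \<and> mixing_seq circle_measure ((\<lambda>n. boundary_map (forward_comp g n)) \<circ> s)"
  then obtain s where s: "strict_mono s"
      "mixing_seq circle_measure ((\<lambda>n. boundary_map (forward_comp g n)) \<circ> s)"
    by blast
  show "contracting g"
  proof (rule contracting_of_pointwise)
    show "continuous_on (ball 0 1) (forward_comp g n)" for n
      by (rule holomorphic_on_imp_continuous_on[OF inner_functionD(1)[OF G]])
    show "norm (forward_comp g n z) \<le> norm (forward_comp g m z)" if "norm z < 1" "m \<le> n" for m n z
      by (rule norm_forward_comp_antimono[OF assms that])
    then show "(\<lambda>n. forward_comp g n z) \<longlonglongrightarrow> 0" if "norm z < 1" for z
      using that by (intro pointwise_limit_of_mixing_subsequence[OF G s that])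
  qed
qed

end
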